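(* Let $a_0,a_1,a_2,a_3\in\,]0,\pi[$, let $k_j:=e^{a_ji}$ for $0\leqslant j\leqslant3$, and let $u_j:=t_j(\overline k_j-k_j)+k_j$ for $j=1,2,3$. Consider the equations $$1+2\,\mathrm{Re}(\overline k_0u_1u_2u_3)=|u_1|^2+|u_2|^2+|u_3|^2\qquad(E_1)$$ $$1-2\,\mathrm{Re}(\overline k_0u_1u_2u_3)=|u_1|^2+|u_2|^2+|u_3|^2\qquad(E_0)$$ in real $t_1,t_2,t_3\geqslant1$. (1) For either type of hexagons, the solutions of $(E_1)$ in $t_1,t_2,t_3\geqslant1$ form a connected component $C_1$ of $S:=S(a_0,a_1,a_2,a_3)$ of this type, topologically a plane, with hyperbolic isometry $R_0R_3$ for some point in the component. (2) The equation $(E_0)$ has no solutions in $t_1,t_2,t_3\geqslant1$ unless $\sum_ja_j\leqslant\pi$ or $3\pi\leqslant\sum_ja_j$. If $\sum_ja_j=\pi$ or $\sum_ja_j=3\pi$, then $(E_0)$ has a unique solution in $t_1,t_2,t_3\geqslant1$; it constitutes a connected component $C_0$ of $S$ of either type, and the isometry $R_0R_3$ is elliptic for this point. If $\sum_ja_j<\pi$ or $3\pi<\sum_ja_j$, then the solutions of $(E_0)$ in $t_1,t_2,t_3\geqslant1$ form a connected component $C_0$ of $S$ (of either type), topologically a $2$-sphere, and the isometry $R_0R_3$ is elliptic for every point in this component. (3) $S$ has no other connected components: for either type of hexagons, the connected components of $S$ of this type are exactly $C_1$ and $C_0$ if $\sum_ja_j\leqslant\pi$ or $3\pi\leqslant\sum_ja_j$,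 and $C_1$ is the only connected component of $S$ of this type otherwise.
   Context: Let $V$ be a $2$-dimensional complex vector space with a hermitian form $\langle-,-\rangle$ (linear in the first argument) of signature $(1,1)$, and let $\mathrm BV:=\{p\in\mathbb P_{\mathbb C}V\mid\langle p,p\rangle>0\}$. This is the hyperbolic plane of curvature $-1$, oriented by its complex structure, with $\cosh^2\frac{\mathrm{dist}(p,q)}2=\mathrm{ta}(p,q):=\frac{\langle p,q\rangle\langle q,p\rangle}{\langle p,p\rangle\langle q,q\rangle}$; $\mathrm{PU}V$ is its group of orientation-preserving isometries. For $c\in\mathrm BV$ and $k\in\mathbb C$, $|k|=1$, the map $R_{c,k}:p\mapsto(\overline k-k)\frac{\langle p,c\rangle}{\langle c,c\rangle}c+kp$ lies in $\mathrm{SU}V$ and acts on $\mathrm BV$ as the counterclockwise rotation about $c$ by the angle $2\arg k$. The space $S(a_0,a_1,a_2,a_3)$. Put $k_j:=e^{a_ji}$. A hexagon of the first (respectively, second) type is a quadruple $(c_0,c_1,c_2,c_3)\in(\mathrm BV)^4$, considered up to the diagonal action of $\mathrm{PU}V$, such that $R_3R_2R_1R_0=1$ (respectively, $R_0R_1R_2R_3=1$) in $\mathrm{PU}V$, where $R_j:=R_{c_j,k_j}$. $S(a_0,a_1,a_2,a_3)$ is the disjoint union of the spaces of hexagons of the two types, with the natural topology. For a hexagon $P$ put $p_3:=c_0$ and $p_1:=R_1p_3$, $p_2:=R_2p_1$ (then $p_3=R_3p_2$) for the first type; $p_1:=R_1^{-1}p_3$, $p_2:=R_2^{-1}p_1$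 (then $p_3=R_3^{-1}p_2$) for the second type. Put $t_jP:=\mathrm{ta}(c_j,p_j)\geqslant1$ for $j=1,2,3$. Saying that the solutions of an equation form a component of a given type means that the map $P\mapsto(t_1P,t_2P,t_3P)$ identifies this component with the set of solutions. (For the second type, the natural isometry is $R_3R_0$; it is conjugate to $R_0R_3$.) *)

theory Defs
  imports "HOL-Analysis.Analysis"
begin

section \<open>The hermitian plane and its isometries\<close>

type_synonym cvec = "complex ^ 2"

definition hermitian_form :: "(cvec \<Rightarrow> cvec \<Rightarrow> complex) \<Rightarrow> bool" where
  "hermitian_form h \<longleftrightarrow>
     (\<forall>x y z. h (x + y) z = h x z + h y z) \<and>
     (\<forall>s x y. h (s *s x) y = s * h x y) \<and>
     (\<forall>x y. h y x = cnj (h x y))"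

text \<open>Since the space has dimension 2, such \<open>e\<close> and \<open>f\<close> form an orthonormal basis.\<close>
definition signature_1_1 :: "(cvec \<Rightarrow> cvec \<Rightarrow> complex) \<Rightarrow> bool" where
  "signature_1_1 h \<longleftrightarrow> (\<exists>e f. h e e = 1 \<and> h f f = -1 \<and> h e f = 0)"

definition unitary :: "(cvec \<Rightarrow> cvec \<Rightarrow> complex) \<Rightarrow> (cvec \<Rightarrow> cvec) \<Rightarrow> bool" where
  "unitary h g \<longleftrightarrow> Vector_Spaces.linear (*s) (*s) g \<and> bij g \<and> (\<forall>x y. h (g x) (g y) = h x y)"

text \<open>PU is U modulo the unimodular scalars.\<close>
definition trivial_in_PU :: "(cvec \<Rightarrow> cvec) \<Rightarrow> bool" where
  "trivial_in_PU g \<longleftrightarrow> (\<exists>l. cmod l = 1 \<and> (\<forall>v. g v = l *s v))"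


section \<open>The projective line and the hyperbolic plane\<close>

definition quotient_topology :: "'a topology \<Rightarrow> ('a \<Rightarrow> 'b) \<Rightarrow> 'b topology" where
  "quotient_topology X f =
     topology (\<lambda>U. U \<subseteq> f ` topspace X \<and> openin X {x \<in> topspace X. f x \<in> U})"

lemma openin_quotient_topology:
  "openin (quotient_topology X f) U \<longleftrightarrow>
     U \<subseteq> f ` topspace X \<and> openin X {x \<in> topspace X. f x \<in> U}"
proof -
  have "istopology (\<lambda>U. U \<subseteq> f ` topspace X \<and> openin X {x \<in> topspace X. f x \<in> U})"
    unfolding istopology_def
  proof (intro conjI allI impI)
    fix S T
    assume "S \<subseteq> f ` topspace X \<and> openin X {x \<in> topspace X. f x \<in> S}"
      and "T \<subseteq> f ` topspace X \<and> openin X {x \<in> topspace X. f x \<in> T}"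
    moreover have "{x \<in> topspace X. f x \<in> S \<inter> T} =
        {x \<in> topspace X. f x \<in> S} \<inter> {x \<in> topspace X. f x \<in> T}"
      by blast
    ultimately show "S \<inter> T \<subseteq> f ` topspace X" "openin X {x \<in> topspace X. f x \<in> S \<inter> T}"
      by (auto simp: openin_Int)
  next
    fix K
    assume K: "\<forall>S\<in>K. S \<subseteq> f ` topspace X \<and> openin X {x \<in> topspace X. f x \<in> S}"
    then show "\<Union>K \<subseteq> f ` topspace X" by blast
    have "{x \<in> topspace X. f x \<in> \<Union>K} = \<Union>((\<lambda>S. {x \<in> topspace X. f x \<in> S}) ` K)"
      by blast
    then show "openin X {x \<in> topspace X. f x \<in> \<Union>K}"
      using K by auto
  qed
  then show ?thesis
    by (simp add: quotient_topology_def)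
qed

lemma topspace_quotient_topology: "topspace (quotient_topology X f) = f ` topspace X"
proof (rule antisym)
  show "topspace (quotient_topology X f) \<subseteq> f ` topspace X"
    by (metis openin_quotient_topology openin_topspace)
  have "{x \<in> topspace X. f x \<in> f ` topspace X} = topspace X" by blast
  then have "openin (quotient_topology X f) (f ` topspace X)"
    by (simp add: openin_quotient_topology)
  then show "f ` topspace X \<subseteq> topspace (quotient_topology X f)"
    by (rule openin_subset)
qed

lemma quotient_map_quotient_topology: "quotient_map X (quotient_topology X f) f"
  by (auto simp: quotient_map_def topspace_quotient_topology openin_quotient_topology)

text \<open>A point of the projective line is a one-dimensional subspace.\<close>
type_synonym point = "cvec set"

definition line :: "cvec \<Rightarrow> point" where
  "line v = vec.span {v}"

definition projective_line :: "point topology" where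
  "projective_line = quotient_topology (top_of_set (- {0})) line"

definition rep :: "point \<Rightarrow> cvec" where
  "rep L = (SOME v. v \<in> L \<and> v \<noteq> 0)"

definition BV :: "(cvec \<Rightarrow> cvec \<Rightarrow> complex) \<Rightarrow> point set" where
  "BV h = {line v | v. v \<noteq> 0 \<and> Re (h v v) > 0}"

text \<open>The ideal boundary of the hyperbolic plane: the isotropic points.\<close>
definition absolute :: "(cvec \<Rightarrow> cvec \<Rightarrow> complex) \<Rightarrow> point set" where
  "absolute h = {line v | v. v \<noteq> 0 \<and> h v v = 0}"

text \<open>The quotient is real whenever \<open>h\<close> is hermitian.\<close>
definition ta :: "(cvec \<Rightarrow> cvec \<Rightarrow> complex) \<Rightarrow> cvec \<Rightarrow> cvec \<Rightarrow> real" where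
  "ta h p q = Re (h p q * h q p / (h p p * h q q))"

definition rot :: "(cvec \<Rightarrow> cvec \<Rightarrow> complex) \<Rightarrow> cvec \<Rightarrow> complex \<Rightarrow> cvec \<Rightarrow> cvec" where
  "rot h c k p = ((cnj k - k) * (h p c / h c c)) *s c + k *s p"

text \<open>Neither \<open>ta\<close> nor \<open>rot\<close> depends on the vectors chosen to represent the points
  (lemmas \<open>ta_rep_line\<close> and \<open>rot_rep_line\<close> below).\<close>
definition pta :: "(cvec \<Rightarrow> cvec \<Rightarrow> complex) \<Rightarrow> point \<Rightarrow> point \<Rightarrow> real" where
  "pta h L M = ta h (rep L) (rep M)"

definition prot :: "(cvec \<Rightarrow> cvec \<Rightarrow> complex) \<Rightarrow> point \<Rightarrow> complex \<Rightarrow> cvec \<Rightarrow> cvec" where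
  "prot h L k = rot h (rep L) k"

lemma hermitian_form_simps:
  assumes "hermitian_form h"
  shows "h (x + y) z = h x z + h y z" "h (s *s x) y = s * h x y"
    "h x (y + z) = h x y + h x z" "h x (s *s y) = cnj s * h x y"
  using assms unfolding hermitian_form_def by (metis, metis, metis complex_cnj_add, metis complex_cnj_mult)

lemma rep_line:
  assumes "v \<noteq> 0"
  obtains s where "s \<noteq> 0" "rep (line v) = s *s v"
proof -
  have "v \<in> line v" by (simp add: line_def vec.span_base)
  then have "rep (line v) \<in> line v \<and> rep (line v) \<noteq> 0"
    unfolding rep_def using assms by (intro someI[of "\<lambda>w. w \<in> line v \<and> w \<noteq> 0" v]) auto
  then show thesis
    using that by (auto simp: line_def vec.span_singleton)
qed

lemma ta_rep_line:
  assumes "hermitian_form h" "p \<noteq> 0" "q \<noteq> 0"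
  shows "pta h (line p) (line q) = ta h p q"
proof -
  obtain s where s: "s \<noteq> 0" "rep (line p) = s *s p" using rep_line assms by blast
  obtain r where r: "r \<noteq> 0" "rep (line q) = r *s q" using rep_line assms by blast
  have "(s * (cnj r * h p q)) * (r * (cnj s * h q p)) /
      ((s * (cnj s * h p p)) * (r * (cnj r * h q q))) =
    ((s * cnj s * r * cnj r) * (h p q * h q p)) / ((s * cnj s * r * cnj r) * (h p p * h q q))"
    by (simp add: mult_ac)
  also have "\<dots> = h p q * h q p / (h p p * h q q)"
    using s r by (intro mult_divide_mult_cancel_left) simp
  finally show ?thesis
    by (simp add: pta_def ta_def s r hermitian_form_simps[OF assms(1)])
qed

lemma rot_rep_line:
  assumes "hermitian_form h" "c \<noteq> 0"
  shows "prot h (line c) k = rot h c k"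
proof -
  obtain s where s: "s \<noteq> 0" "rep (line c) = s *s c" using rep_line assms by blast
  then show ?thesis
    by (auto simp: prot_def rot_def hermitian_form_simps[OF assms(1)] fun_eq_iff)
qed

text \<open>An orientation-preserving isometry other than the identity is elliptic if it fixes a point
  of the hyperbolic plane, and hyperbolic if it fixes exactly two points of the absolute. Both
  predicates are meant for unitary \<open>g\<close>.\<close>
definition elliptic :: "(cvec \<Rightarrow> cvec \<Rightarrow> complex) \<Rightarrow> (cvec \<Rightarrow> cvec) \<Rightarrow> bool" where
  "elliptic h g \<longleftrightarrow> \<not> trivial_in_PU g \<and> (\<exists>L \<in> BV h. g ` L = L)"

definition hyperbolic :: "(cvec \<Rightarrow> cvec \<Rightarrow> complex) \<Rightarrow> (cvec \<Rightarrow> cvec) \<Rightarrow> bool" where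
  "hyperbolic h g \<longleftrightarrow> card {L \<in> absolute h. g ` L = L} = 2"


section \<open>Hexagons\<close>

text \<open>The four indices form the type \<open>4\<close> (the integers modulo 4), so that \<open>a 0, \<dots>, a 3\<close>
  are all the values of \<open>a :: 4 \<Rightarrow> real\<close>.\<close>

datatype hexagon_type = First | Second

type_synonym quad = "4 \<Rightarrow> point"

abbreviation vertex_rot ::
    "(cvec \<Rightarrow> cvec \<Rightarrow> complex) \<Rightarrow> (4 \<Rightarrow> real) \<Rightarrow> quad \<Rightarrow> 4 \<Rightarrow> cvec \<Rightarrow> cvec" where
  "vertex_rot h a c j \<equiv> prot h (c j) (cis (a j))"

fun closes_up :: "(cvec \<Rightarrow> cvec \<Rightarrow> complex) \<Rightarrow> (4 \<Rightarrow> real) \<Rightarrow> hexagon_type \<Rightarrow> quad \<Rightarrow> bool" where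
  "closes_up h a First c \<longleftrightarrow> trivial_in_PU
     (vertex_rot h a c 3 \<circ> vertex_rot h a c 2 \<circ> vertex_rot h a c 1 \<circ> vertex_rot h a c 0)"
| "closes_up h a Second c \<longleftrightarrow> trivial_in_PU
     (vertex_rot h a c 0 \<circ> vertex_rot h a c 1 \<circ> vertex_rot h a c 2 \<circ> vertex_rot h a c 3)"

definition quads ::
    "(cvec \<Rightarrow> cvec \<Rightarrow> complex) \<Rightarrow> (4 \<Rightarrow> real) \<Rightarrow> hexagon_type \<Rightarrow> quad set" where
  "quads h a T = {c. (\<forall>j. c j \<in> BV h) \<and> closes_up h a T c}"

text \<open>The orbit of the diagonal action; scalars act trivially on points, so U and PU have
  the same orbits.\<close>
definition orbit :: "(cvec \<Rightarrow> cvec \<Rightarrow> complex) \<Rightarrow> quad \<Rightarrow> quad set" where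
  "orbit h c = {(\<lambda>j. g ` c j) | g. unitary h g}"

definition hexagon_space ::
    "(cvec \<Rightarrow> cvec \<Rightarrow> complex) \<Rightarrow> (4 \<Rightarrow> real) \<Rightarrow> (hexagon_type \<times> quad set) topology" where
  "hexagon_space h a = sum_topology
     (\<lambda>T. quotient_topology
        (subtopology (product_topology (\<lambda>_. projective_line) UNIV) (quads h a T)) (orbit h))
     UNIV"

fun vertex_t ::
    "(cvec \<Rightarrow> cvec \<Rightarrow> complex) \<Rightarrow> (4 \<Rightarrow> real) \<Rightarrow> hexagon_type \<Rightarrow> quad \<Rightarrow> real \<times> real \<times> real" where
  "vertex_t h a First c =
     (let p3 = c 0; p1 = vertex_rot h a c 1 ` p3; p2 = vertex_rot h a c 2 ` p1
      in (pta h (c 1) p1, pta h (c 2) p2, pta h (c 3) p3))"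
| "vertex_t h a Second c =
     (let p3 = c 0; p1 = inv (vertex_rot h a c 1) ` p3; p2 = inv (vertex_rot h a c 2) ` p1
      in (pta h (c 1) p1, pta h (c 2) p2, pta h (c 3) p3))"

lemma linear_image_line:
  assumes "Vector_Spaces.linear (*s) (*s) g"
  shows "g ` line v = line (g v)"
proof -
  interpret Vector_Spaces.linear "(*s)" "(*s)" g by fact
  show ?thesis by (auto simp: line_def vec.span_singleton scale image_iff)
qed

lemma linear_rot:
  assumes "hermitian_form h"
  shows "Vector_Spaces.linear (*s) (*s) (rot h c k)"
  by unfold_locales
    (auto simp: rot_def hermitian_form_simps[OF assms] vec_eq_iff algebra_simps add_divide_distrib)

lemma rot_rot_cnj:
  assumes "hermitian_form h" "h c c \<noteq> 0" "cmod k = 1"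
  shows "rot h c k (rot h c (cnj k) p) = p"
proof -
  have k: "k * cnj k = 1" using assms(3) by (simp add: complex_norm_square[symmetric])
  define z where "z = h p c / h c c"
  have hp: "h p c = z * h c c" using assms(2) by (simp add: z_def)
  have q: "rot h c (cnj k) p = ((k - cnj k) * z) *s c + cnj k *s p"
    by (simp add: rot_def z_def)
  have "h (rot h c (cnj k) p) c / h c c = k * z"
    using assms(2) by (simp add: q hermitian_form_simps[OF assms(1)] hp) (simp add: field_simps)
  then have "rot h c k (rot h c (cnj k) p) = ((cnj k - k) * (k * z)) *s c + k *s rot h c (cnj k) p"
    by (simp only: rot_def[of h c k])
  also have "\<dots> = (k * cnj k) *s p"
    unfolding q by (simp add: vec_eq_iff algebra_simps)
  finally show ?thesis by (simp add: k)
qed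

lemma BV_E:
  assumes "L \<in> BV h"
  obtains v where "L = line v" "v \<noteq> 0" "h v v \<noteq> 0"
  using assms by (force simp: BV_def)

lemma inv_prot:
  assumes "hermitian_form h" "L \<in> BV h" "cmod k = 1"
  shows "inv (prot h L k) = prot h L (cnj k)"
proof -
  obtain v where v: "L = line v" "v \<noteq> 0" "h v v \<noteq> 0" using assms(2) by (rule BV_E)
  show ?thesis
    unfolding v(1) rot_rep_line[OF assms(1) v(2)]
    using rot_rot_cnj[OF assms(1) v(3), of k] rot_rot_cnj[OF assms(1) v(3), of "cnj k"] assms(3)
    by (intro inv_equality) auto
qed

lemma prot_image_line:
  assumes "hermitian_form h" "L \<in> BV h" "cmod k = 1" "p \<noteq> 0"
  obtains q where "q \<noteq> 0" "prot h L k ` line p = line q"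
proof -
  obtain v where v: "L = line v" "v \<noteq> 0" "h v v \<noteq> 0" using assms(2) by (rule BV_E)
  have "rot h v (cnj k) (rot h v k p) = p"
    using rot_rot_cnj[OF assms(1) v(3), of "cnj k"] assms(3) by simp
  moreover have "rot h v (cnj k) 0 = 0"
    using hermitian_form_simps(2)[OF assms(1), of 0 0 v] by (simp add: rot_def)
  ultimately have "rot h v k p \<noteq> 0" using assms(4) by metis
  then show thesis
    using that linear_image_line[OF linear_rot[OF assms(1)]]
    by (simp add: v(1) rot_rep_line[OF assms(1) v(2)])
qed

lemma unitary_nonzero:
  assumes "unitary h g" "v \<noteq> 0"
  shows "g v \<noteq> 0"
proof -
  interpret Vector_Spaces.linear "(*s)" "(*s)" g using assms(1) by (simp add: unitary_def)
  show ?thesis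
    using assms zero unfolding unitary_def bij_def by (metis injD)
qed

lemma prot_unitary_image:
  assumes "hermitian_form h" "unitary h g" "L \<in> BV h"
  shows "prot h (g ` L) k ` g ` M = g ` prot h L k ` M"
proof -
  obtain v where v: "L = line v" "v \<noteq> 0" "h v v \<noteq> 0" using assms(3) by (rule BV_E)
  interpret Vector_Spaces.linear "(*s)" "(*s)" g using assms(2) by (simp add: unitary_def)
  have "rot h (g v) k (g p) = g (rot h v k p)" for p
    using assms(2) by (simp add: rot_def unitary_def add scale)
  moreover have "g ` L = line (g v)"
    unfolding v(1) by (intro linear_image_line linear_axioms)
  ultimately show ?thesis
    by (simp add: image_image v(1) rot_rep_line assms v unitary_nonzero[OF assms(2)])
qed

lemma pta_unitary_image:
  assumes "hermitian_form h" "unitary h g" "L \<in> BV h" "p \<noteq> 0"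
  shows "pta h (g ` L) (g ` line p) = pta h L (line p)"
proof -
  obtain v where v: "L = line v" "v \<noteq> 0" "h v v \<noteq> 0" using assms(3) by (rule BV_E)
  have "g ` line w = line (g w)" for w
    using assms(2) by (intro linear_image_line) (simp add: unitary_def)
  then have "pta h (g ` L) (g ` line p) = ta h (g v) (g p)"
    using v assms(4) by (simp add: ta_rep_line[OF assms(1)] unitary_nonzero[OF assms(2)])
  also have "\<dots> = ta h v p" using assms(2) by (simp add: ta_def unitary_def)
  finally show ?thesis using v assms(4) by (simp add: ta_rep_line[OF assms(1)])
qed

lemma vertex_t_orbit:
  assumes h: "hermitian_form h" and c: "\<And>j. c j \<in> BV h" and "d \<in> orbit h c"
  shows "vertex_t h a T d = vertex_t h a T c"
proof -
  obtain g where g: "unitary h g" and d: "\<And>j. d j = g ` c j"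
    using assms(3) by (auto simp: orbit_def)
  have gBV: "g ` L \<in> BV h" if "L \<in> BV h" for L
  proof -
    obtain v where v: "L = line v" "v \<noteq> 0" "Re (h v v) > 0" using \<open>L \<in> BV h\<close> by (auto simp: BV_def)
    then have "g ` L = line (g v)" using g by (auto simp: unitary_def linear_image_line)
    moreover have "g v \<noteq> 0" "Re (h (g v) (g v)) > 0"
      using v g by (auto simp: unitary_nonzero) (simp add: unitary_def)
    ultimately show ?thesis by (auto simp: BV_def)
  qed
  have *: "pta h (g ` c 1) (prot h (g ` c 1) k1 ` g ` c 0) = pta h (c 1) (prot h (c 1) k1 ` c 0) \<and>
     pta h (g ` c 2) (prot h (g ` c 2) k2 ` prot h (g ` c 1) k1 ` g ` c 0) =
       pta h (c 2) (prot h (c 2) k2 ` prot h (c 1) k1 ` c 0) \<and>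
     pta h (g ` c 3) (g ` c 0) = pta h (c 3) (c 0)"
    if k: "cmod k1 = 1" "cmod k2 = 1" for k1 k2
  proof -
    obtain p3 where p3: "p3 \<noteq> 0" "c 0 = line p3" using BV_E[OF c] by metis
    obtain p1 where p1: "p1 \<noteq> 0" "prot h (c 1) k1 ` line p3 = line p1"
      using prot_image_line[OF h c k(1) p3(1)] by metis
    obtain p2 where p2: "p2 \<noteq> 0" "prot h (c 2) k2 ` line p1 = line p2"
      using prot_image_line[OF h c k(2) p1(1)] by metis
    show ?thesis
      by (simp only: prot_unitary_image[OF h g c] p3(2) p1(2) p2(2)
          pta_unitary_image[OF h g c p3(1)] pta_unitary_image[OF h g c p1(1)]
          pta_unitary_image[OF h g c p2(1)])
  qed
  show ?thesis
    using *[of "cis (a 1)" "cis (a 2)"] *[of "cnj (cis (a 1))" "cnj (cis (a 2))"]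
    by (cases T) (simp_all add: d Let_def inv_prot[OF h c] inv_prot[OF h gBV[OF c]])
qed

text \<open>\<open>vertex_t\<close> is constant on orbits by \<open>vertex_t_orbit\<close>.\<close>
fun hexagon_t ::
    "(cvec \<Rightarrow> cvec \<Rightarrow> complex) \<Rightarrow> (4 \<Rightarrow> real) \<Rightarrow> hexagon_type \<times> quad set \<Rightarrow> real \<times> real \<times> real"
  where "hexagon_t h a (T, P) = vertex_t h a T (SOME c. c \<in> P)"


section \<open>The equations and the components\<close>

definition u_coeff :: "(4 \<Rightarrow> real) \<Rightarrow> 4 \<Rightarrow> real \<Rightarrow> complex" where
  "u_coeff a j t = of_real t * (cnj (cis (a j)) - cis (a j)) + cis (a j)"

definition E1_solutions :: "(4 \<Rightarrow> real) \<Rightarrow> (real \<times> real \<times> real) set" where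
  "E1_solutions a = {(t1, t2, t3). t1 \<ge> 1 \<and> t2 \<ge> 1 \<and> t3 \<ge> 1 \<and>
     1 + 2 * Re (cnj (cis (a 0)) * u_coeff a 1 t1 * u_coeff a 2 t2 * u_coeff a 3 t3) =
       (cmod (u_coeff a 1 t1))\<^sup>2 + (cmod (u_coeff a 2 t2))\<^sup>2 + (cmod (u_coeff a 3 t3))\<^sup>2}"

definition E0_solutions :: "(4 \<Rightarrow> real) \<Rightarrow> (real \<times> real \<times> real) set" where
  "E0_solutions a = {(t1, t2, t3). t1 \<ge> 1 \<and> t2 \<ge> 1 \<and> t3 \<ge> 1 \<and>
     1 - 2 * Re (cnj (cis (a 0)) * u_coeff a 1 t1 * u_coeff a 2 t2 * u_coeff a 3 t3) =
       (cmod (u_coeff a 1 t1))\<^sup>2 + (cmod (u_coeff a 2 t2))\<^sup>2 + (cmod (u_coeff a 3 t3))\<^sup>2}"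

text \<open>The connected components consisting of hexagons of the given type.\<close>
definition components_of_type ::
    "(cvec \<Rightarrow> cvec \<Rightarrow> complex) \<Rightarrow> (4 \<Rightarrow> real) \<Rightarrow> hexagon_type \<Rightarrow> (hexagon_type \<times> quad set) set set"
  where "components_of_type h a T =
    {C \<in> connected_components_of (hexagon_space h a). C \<subseteq> {T} \<times> UNIV}"

text \<open>The hexagons of the given type whose parameters lie in \<open>E\<close>.\<close>
definition hexagons_over ::
    "(cvec \<Rightarrow> cvec \<Rightarrow> complex) \<Rightarrow> (4 \<Rightarrow> real) \<Rightarrow> hexagon_type \<Rightarrow> (real \<times> real \<times> real) set \<Rightarrow>
     (hexagon_type \<times> quad set) set"
  where "hexagons_over h a T E =
    {P \<in> topspace (hexagon_space h a). fst P = T \<and> hexagon_t h a P \<in> E}"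

definition form_component ::
    "(cvec \<Rightarrow> cvec \<Rightarrow> complex) \<Rightarrow> (4 \<Rightarrow> real) \<Rightarrow> hexagon_type \<Rightarrow> (real \<times> real \<times> real) set \<Rightarrow> bool"
  where "form_component h a T E \<longleftrightarrow>
    hexagons_over h a T E \<in> components_of_type h a T \<and>
    homeomorphic_map (subtopology (hexagon_space h a) (hexagons_over h a T E)) (top_of_set E)
      (hexagon_t h a)"

end

theory Submission
  imports Defs "HOL-Complex_Analysis.Riemann_Mapping" "HOL-Real_Asymp.Real_Asymp"
begin

text \<open>
  Lift the rotations to \<open>SU V\<close>. Then \<open>R\<^sub>3 R\<^sub>2 R\<^sub>1 R\<^sub>0 = d\<close> with \<open>d = 1\<close> or \<open>d = -1\<close>, and the
  Gram matrix of representatives of \<open>p\<^sub>3, p\<^sub>1, p\<^sub>2\<close> with \<open>\<langle>p\<^sub>j, p\<^sub>j\<rangle> = 1\<close> has the entries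
  \<open>u\<^sub>1, u\<^sub>2\<close> and \<open>d k\<^sub>0\<^sup>-\<^sup>1 u\<^sub>3\<close>. Since \<open>dim V = 2\<close>, its determinant vanishes: this is the equation
  for the sign \<open>d\<close>. Conversely, a solution determines the three vectors up to \<open>U V\<close>, and the centre
  of the rotation taking \<open>x\<close> to \<open>y\<close> is \<open>y - k x\<close>, so hexagons up to isometry correspond to solutions.

  In the heights \<open>y\<^sub>j = (2 t\<^sub>j - 1) sin a\<^sub>j\<close>, the slices of the solution set at constant \<open>y\<^sub>3\<close> are
  conics whose type depends on half the trace \<open>r\<close> of \<open>R\<^sub>0 R\<^sub>3\<close>. Every solution has
  \<open>r \<le> cos (a\<^sub>0 + a\<^sub>3)\<close> and \<open>d r \<le> cos (a\<^sub>1 + a\<^sub>2)\<close>. For \<open>d = -1\<close> this leaves ellipses that shrink to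
  points at both ends: a sphere. For \<open>d = 1\<close> a projective change of coordinates turns all slices into
  arcs of concentric circles, and the solution set becomes an open subset of the complex plane that
  is simply connected because its complement is connected and unbounded; the Riemann mapping theorem
  then makes it a plane.
\<close>

section \<open>The solution set as a family of conics\<close>

text \<open>Two obstacles shape the proof. The first is the boundary: \<open>t1, t2 \<ge> 1\<close>
  are closed conditions, yet the solution set for \<open>d = 1\<close> has to be a plane.
  \<open>gram_solutions_iff\<close> resolves this. On each slice of admissible height, both bounds
  are equivalent to the single strict inequality \<open>y1 + y2 > 0\<close>, which becomes an open
  condition in the chart. Its proof needs the sign of \<open>sigma\<close> on the slices with
  \<open>rho \<ge> -1\<close>, hence the assumption of \<open>plane_angles\<close>. Reflecting all
  angles and permuting the indices 1, 2, 3 leads there from every quadruple except four right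
  angles, which get a parametrisation of their own.

  The second is continuity of the inverse of the parameter map. Rebuilding a hexagon from a solution
  requires a relative phase of two vectors, and this phase is undetermined wherever a component
  vanishes. Instead of choosing it, the proof keeps all admissible phases. Since they range over a
  compact set, forgetting them is a quotient map, so \<open>vertex_t\<close> is one too. As its
  fibres are exactly the orbits, it descends to a homeomorphism.\<close>

definition slice_conic :: "real \<Rightarrow> real \<Rightarrow> real \<Rightarrow> real \<Rightarrow> real \<Rightarrow> real \<Rightarrow> real" where
  "slice_conic r s c1 c2 y1 y2 =
     y1\<^sup>2 + y2\<^sup>2 + 2 * r * y1 * y2 + 2 * s * (c1 * y2 + c2 * y1)
       + c1\<^sup>2 + c2\<^sup>2 + r\<^sup>2 + s\<^sup>2 - 1 - 2 * r * c1 * c2"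

text \<open>With \<open>m = r - i s\<close> and \<open>uj = cj - i yj\<close>, the conic is minus
  the determinant of the hermitian 3x3 matrix with unit diagonal and off-diagonal entries
  \<open>u1\<close>, \<open>u2\<close>, \<open>m\<close>. Singling out \<open>u1\<close> writes it
  as \<open>|cnj u1 - m u2|^2 - (|m|^2 - 1) (|u2|^2 - 1)\<close>; \<open>slice_conic_eq2\<close>
  singles out \<open>m\<close> in the same way.\<close>

lemma slice_conic_eq1:
  "slice_conic r s c1 c2 y1 y2 =
     (c1 - r * c2 + s * y2)\<^sup>2 + (y1 + r * y2 + s * c2)\<^sup>2 - (r\<^sup>2 + s\<^sup>2 - 1) * (y2\<^sup>2 + c2\<^sup>2 - 1)"
  unfolding slice_conic_def by algebra

lemma slice_conic_eq2:
  "slice_conic r s c1 c2 y1 y2 =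
     (r - c1 * c2 + y1 * y2)\<^sup>2 + (s + c1 * y2 + c2 * y1)\<^sup>2 - (y1\<^sup>2 + c1\<^sup>2 - 1) * (y2\<^sup>2 + c2\<^sup>2 - 1)"
  unfolding slice_conic_def by algebra

lemma slice_conic_commute: "slice_conic r s c1 c2 y1 y2 = slice_conic r s c2 c1 y2 y1"
  unfolding slice_conic_def by algebra

lemma slice_conic_minus: "slice_conic r (- s) (- c1) (- c2) y1 y2 = slice_conic r s c1 c2 y1 y2"
  unfolding slice_conic_def by algebra

text \<open>Dropping the second square of \<open>slice_conic_eq2\<close> leaves
  \<open>(r - cos a1 cos a2 + y1 y2)^2\<close> at most
  \<open>(y1^2 - sin^2 a1) (y2^2 - sin^2 a2)\<close>, which is at most
  \<open>(y1 y2 - sin a1 sin a2)^2\<close>; comparing the bases gives the bound.\<close>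

lemma slice_conic_bound:
  fixes a1 a2 :: real
  assumes y: "y1 \<ge> sin a1" "y2 \<ge> sin a2" and s: "sin a1 > 0" "sin a2 > 0"
    and Q: "slice_conic r \<sigma> (cos a1) (cos a2) y1 y2 = 0"
  shows "r \<le> cos (a1 + a2)"
proof (rule ccontr)
  assume "\<not> ?thesis"
  then have r: "r > cos a1 * cos a2 - sin a1 * sin a2" by (simp add: cos_add)
  have W: "y1\<^sup>2 + (cos a1)\<^sup>2 - 1 = y1\<^sup>2 - (sin a1)\<^sup>2" "y2\<^sup>2 + (cos a2)\<^sup>2 - 1 = y2\<^sup>2 - (sin a2)\<^sup>2"
    using sin_cos_squared_add[of a1] sin_cos_squared_add[of a2] by linarith+
  have "(y1 * y2 - sin a1 * sin a2)\<^sup>2 - (y1\<^sup>2 - (sin a1)\<^sup>2) * (y2\<^sup>2 - (sin a2)\<^sup>2) =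
      (sin a1 * y2 - sin a2 * y1)\<^sup>2"
    by algebra
  then have 1: "(y1\<^sup>2 - (sin a1)\<^sup>2) * (y2\<^sup>2 - (sin a2)\<^sup>2) \<le> (y1 * y2 - sin a1 * sin a2)\<^sup>2"
    by (metis diff_ge_0_iff_ge zero_le_power2)
  have "sin a1 * sin a2 \<le> y1 * y2" using y s by (intro mult_mono) auto
  then have "(y1 * y2 - sin a1 * sin a2)\<^sup>2 < (r - cos a1 * cos a2 + y1 * y2)\<^sup>2"
    using r by (intro power_strict_mono) auto
  moreover have "(r - cos a1 * cos a2 + y1 * y2)\<^sup>2 \<le> (y1\<^sup>2 - (sin a1)\<^sup>2) * (y2\<^sup>2 - (sin a2)\<^sup>2)"
    using Q unfolding slice_conic_eq2 W by (smt (verit) zero_le_power2)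
  ultimately show False using 1 by linarith
qed

text \<open>On such a hyperbola \<open>slice_conic_eq1\<close> and its mirror image give
  \<open>|yj| \<ge> sin aj\<close>, and \<open>slice_conic_eq2\<close> excludes opposite signs. So
  \<open>y1 + y2 > 0\<close> merely selects a branch.\<close>

lemma slice_conic_outer:
  fixes a1 a2 :: real
  assumes s: "sin a1 > 0" "sin a2 > 0" and r: "r < -1" and P: "y1 + y2 > 0"
    and Q: "slice_conic r \<sigma> (cos a1) (cos a2) y1 y2 = 0"
  shows "y1 \<ge> sin a1 \<and> y2 \<ge> sin a2"
proof -
  have W: "y1\<^sup>2 + (cos a1)\<^sup>2 - 1 = y1\<^sup>2 - (sin a1)\<^sup>2" "y2\<^sup>2 + (cos a2)\<^sup>2 - 1 = y2\<^sup>2 - (sin a2)\<^sup>2"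
    using sin_cos_squared_add[of a1] sin_cos_squared_add[of a2] by linarith+
  have r2: "r\<^sup>2 > 1" using one_less_power[of "- r" 2] r by simp
  then have w: "r\<^sup>2 + \<sigma>\<^sup>2 - 1 > 0" by (smt (verit) zero_le_power2)
  have "(r\<^sup>2 + \<sigma>\<^sup>2 - 1) * (y2\<^sup>2 - (sin a2)\<^sup>2) \<ge> 0"
    using Q unfolding slice_conic_eq1 W by (smt (verit) zero_le_power2)
  then have y2: "(sin a2)\<^sup>2 \<le> y2\<^sup>2" using w by (simp add: zero_le_mult_iff)
  have Q': "slice_conic r \<sigma> (cos a2) (cos a1) y2 y1 = 0"
    using Q by (simp add: slice_conic_commute)
  have "(r\<^sup>2 + \<sigma>\<^sup>2 - 1) * (y1\<^sup>2 - (sin a1)\<^sup>2) \<ge> 0"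
    using Q' unfolding slice_conic_eq1 W by (smt (verit) zero_le_power2)
  then have y1: "(sin a1)\<^sup>2 \<le> y1\<^sup>2" using w by (simp add: zero_le_mult_iff)
  have pos: "y1 * y2 > 0"
  proof (rule ccontr)
    assume "\<not> ?thesis"
    then have neg: "y1 * y2 \<le> 0" by simp
    have "cos a1 * cos a2 \<ge> -1"
      using abs_cos_le_one[of a1] abs_cos_le_one[of a2]
      by (metis abs_le_iff abs_mult abs_ge_zero minus_le_iff mult_le_one)
    then have "(- (y1 * y2))\<^sup>2 < (- (r - cos a1 * cos a2 + y1 * y2))\<^sup>2"
      using r neg by (intro power_strict_mono) auto
    then have "(y1 * y2)\<^sup>2 < (r - cos a1 * cos a2 + y1 * y2)\<^sup>2" by (simp only: power2_minus)
    also have "\<dots> \<le> (y1\<^sup>2 - (sin a1)\<^sup>2) * (y2\<^sup>2 - (sin a2)\<^sup>2)"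
      using Q unfolding slice_conic_eq2 W by (smt (verit) zero_le_power2)
    also have "\<dots> \<le> y1\<^sup>2 * y2\<^sup>2" using y1 y2 by (intro mult_mono) auto
    finally show False by (simp add: power_mult_distrib)
  qed
  with P have "y1 > 0" "y2 > 0" by (auto simp: zero_less_mult_iff)
  then show ?thesis using y1 y2 by (auto intro: power2_le_imp_le)
qed

text \<open>On an elliptic or parabolic slice the weight \<open>r\<^sup>2 + \<sigma>\<^sup>2 - 1\<close> is at most \<open>\<sigma>\<^sup>2\<close>, so that the first
  square in \<open>slice_conic_eq1\<close> already decides on which side of the axis the conic lies.\<close>
lemma slice_conic_inner_pos:
  fixes a1 a2 :: real
  assumes r: "r\<^sup>2 \<le> 1" and \<sigma>: "\<sigma> > 0" and W: "r\<^sup>2 + \<sigma>\<^sup>2 \<ge> 1"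
    and c: "cos a1 - r * cos a2 < 0" and s: "sin a2 > 0"
    and Q: "slice_conic r \<sigma> (cos a1) (cos a2) y1 y2 = 0"
  shows "y2 > 0"
proof (rule ccontr)
  assume y2: "\<not> ?thesis"
  have W2: "y2\<^sup>2 + (cos a2)\<^sup>2 - 1 = y2\<^sup>2 - (sin a2)\<^sup>2"
    using sin_cos_squared_add[of a2] by linarith
  have y: "\<sigma> * y2 \<le> 0" using y2 \<sigma> by (simp add: mult_le_0_iff)
  have "(- (\<sigma> * y2))\<^sup>2 < (- (cos a1 - r * cos a2 + \<sigma> * y2))\<^sup>2"
    using y c by (intro power_strict_mono) auto
  then have "\<sigma>\<^sup>2 * y2\<^sup>2 < (cos a1 - r * cos a2 + \<sigma> * y2)\<^sup>2"
    by (simp only: power2_minus power_mult_distrib)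
  also have "\<dots> \<le> (r\<^sup>2 + \<sigma>\<^sup>2 - 1) * (y2\<^sup>2 - (sin a2)\<^sup>2)"
    using Q unfolding slice_conic_eq1 W2 by (smt (verit) zero_le_power2)
  also have "\<dots> \<le> (r\<^sup>2 + \<sigma>\<^sup>2 - 1) * y2\<^sup>2" using W by (intro mult_left_mono) auto
  also have "\<dots> \<le> \<sigma>\<^sup>2 * y2\<^sup>2" using r by (intro mult_right_mono) auto
  finally show False by simp
qed

lemma slice_conic_inner:
  fixes a1 a2 :: real
  assumes r: "r\<^sup>2 \<le> 1" and \<sigma>: "\<sigma> > 0" and W: "r\<^sup>2 + \<sigma>\<^sup>2 > 1"
    and c: "cos a1 - r * cos a2 < 0" and s: "sin a2 > 0"
    and Q: "slice_conic r \<sigma> (cos a1) (cos a2) y1 y2 = 0"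
  shows "y2 \<ge> sin a2"
proof -
  have W2: "y2\<^sup>2 + (cos a2)\<^sup>2 - 1 = y2\<^sup>2 - (sin a2)\<^sup>2"
    using sin_cos_squared_add[of a2] by linarith
  have "y2 > 0" using slice_conic_inner_pos[OF r \<sigma> _ c s Q] W by simp
  have "(r\<^sup>2 + \<sigma>\<^sup>2 - 1) * (y2\<^sup>2 - (sin a2)\<^sup>2) \<ge> 0"
    using Q unfolding slice_conic_eq1 W2 by (smt (verit) zero_le_power2)
  then have "(sin a2)\<^sup>2 \<le> y2\<^sup>2" using W by (simp add: zero_le_mult_iff)
  with \<open>y2 > 0\<close> show ?thesis by (auto intro: power2_le_imp_le)
qed

lemma slice_conic_point:
  assumes W: "r\<^sup>2 + \<sigma>\<^sup>2 = 1" and Q: "slice_conic r \<sigma> c1 c2 y1 y2 = 0"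
  shows "\<sigma> * y2 = r * c2 - c1"
proof -
  have "(c1 - r * c2 + \<sigma> * y2)\<^sup>2 + (y1 + r * y2 + \<sigma> * c2)\<^sup>2 = 0"
    using Q W unfolding slice_conic_eq1 by simp
  then have "c1 - r * c2 + \<sigma> * y2 = 0" by (simp add: sum_power2_eq_zero_iff)
  then show ?thesis by simp
qed

text \<open>The first two arguments of the conic are the real part and the negated imaginary part of
  \<open>d * cnj k0 * u3\<close>. This singles out the index 3; the swap lemmas below recover the
  symmetry of the determinant.\<close>

definition gram_solutions :: "real \<Rightarrow> real \<Rightarrow> real \<Rightarrow> real \<Rightarrow> real \<Rightarrow> (real \<times> real \<times> real) set" where
  "gram_solutions d a0 a1 a2 a3 = {(y1, y2, y3). sin a1 \<le> y1 \<and> sin a2 \<le> y2 \<and> sin a3 \<le> y3 \<and>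
     slice_conic (d * (cos a0 * cos a3 - sin a0 * y3)) (d * (cos a0 * y3 + cos a3 * sin a0))
       (cos a1) (cos a2) y1 y2 = 0}"

lemma slice_conic_swap13:
  assumes "d\<^sup>2 = (1::real)" "s\<^sup>2 + c\<^sup>2 = (1::real)"
  shows "slice_conic (d * (c * c3 - s * y3)) (d * (c * y3 + c3 * s)) c1 c2 y1 y2 =
    slice_conic (d * (c * c1 - s * y1)) (d * (c * y1 + c1 * s)) c3 c2 y3 y2"
  using assms unfolding slice_conic_def by algebra

lemma gram_solutions_swap13:
  assumes "d\<^sup>2 = 1"
  shows "(y1, y2, y3) \<in> gram_solutions d a0 a1 a2 a3 \<longleftrightarrow> (y3, y2, y1) \<in> gram_solutions d a0 a3 a2 a1"
  using slice_conic_swap13[OF assms sin_cos_squared_add[of a0], of "cos a3" y3 "cos a1" "cos a2" y1 y2]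
  by (auto simp: gram_solutions_def)

lemma gram_solutions_swap12:
  "(y1, y2, y3) \<in> gram_solutions d a0 a1 a2 a3 \<longleftrightarrow> (y2, y1, y3) \<in> gram_solutions d a0 a2 a1 a3"
  by (auto simp: gram_solutions_def slice_conic_commute)

text \<open>The reflection replaces \<open>k0\<close> and every \<open>uj\<close> by minus its
  conjugate: the four signs cancel, and the real part ignores conjugation. The angle sum
  \<open>S\<close> becomes \<open>4 * pi - S\<close>.\<close>

lemma gram_solutions_reflect:
  "gram_solutions d (pi - a0) (pi - a1) (pi - a2) (pi - a3) = gram_solutions d a0 a1 a2 a3"
proof -
  have *: "- (d * (cos a0 * y) ) - d * (cos a3 * sin a0) = - (d * (cos a0 * y + cos a3 * sin a0))" for y
    by algebra
  have "slice_conic (d * (cos a0 * cos a3 - sin a0 * y3)) (d * (- (cos a0 * y3) - cos a3 * sin a0))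
       (- cos a1) (- cos a2) y1 y2 =
     slice_conic (d * (cos a0 * cos a3 - sin a0 * y3)) (d * (cos a0 * y3 + cos a3 * sin a0))
       (cos a1) (cos a2) y1 y2" for y1 y2 y3
    using slice_conic_minus[of _ "d * (cos a0 * y3 + cos a3 * sin a0)"]
    by (simp add: algebra_simps)
  then show ?thesis
    by (auto simp: gram_solutions_def)
qed

section \<open>Signs of the half trace and of \<open>sigma\<close>\<close>

locale four_angles =
  fixes a0 a1 a2 a3 :: real
  assumes angle_bounds: "0 < a0" "a0 < pi" "0 < a1" "a1 < pi" "0 < a2" "a2 < pi" "0 < a3" "a3 < pi"
begin

lemma sin_pos: "sin a0 > 0" "sin a1 > 0" "sin a2 > 0" "sin a3 > 0"
  using angle_bounds by (auto intro: sin_gt_zero)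

text \<open>The half trace of \<open>R\<^sub>0 R\<^sub>3\<close> as a function of the height \<open>y\<^sub>3\<close>, and the negative imaginary part of
  the same matrix entry.\<close>
definition rho :: "real \<Rightarrow> real" where "rho y = cos a0 * cos a3 - sin a0 * y"
definition sigma :: "real \<Rightarrow> real" where "sigma y = cos a0 * y + cos a3 * sin a0"

lemma rho_sigma: "(rho y)\<^sup>2 + (sigma y)\<^sup>2 - 1 = y\<^sup>2 - (sin a3)\<^sup>2"
  unfolding rho_def sigma_def
  using sin_cos_squared_add[of a0] sin_cos_squared_add[of a3] by algebra

lemma rho_le: "y \<ge> sin a3 \<Longrightarrow> rho y \<le> cos (a0 + a3)"
  using sin_pos by (simp add: rho_def cos_add)

lemma cos_lt_1: "cos (a0 + a3) < 1" "cos (a1 + a2) < 1"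
proof -
  have *: "cos (a + b) < 1" if "0 < a" "a < pi" "0 < b" "b < pi" for a b :: real
  proof -
    have "sin ((a + b) / 2) > 0" using that by (intro sin_gt_zero) auto
    moreover have "2 * ((a + b) / 2) = a + b" by simp
    then have "cos (a + b) = 1 - 2 * (sin ((a + b) / 2))\<^sup>2"
      using cos_double_sin[of "(a + b) / 2"] by (simp only:)
    ultimately show ?thesis by simp
  qed
  show "cos (a0 + a3) < 1" "cos (a1 + a2) < 1" using * angle_bounds by auto
qed

lemma rho_lt_1: "y \<ge> sin a3 \<Longrightarrow> rho y < 1"
  using rho_le[of y] cos_lt_1 by simp

lemma rho_sigma_ge: "y \<ge> sin a3 \<Longrightarrow> (rho y)\<^sup>2 + (sigma y)\<^sup>2 \<ge> 1"
proof -
  assume "y \<ge> sin a3"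
  then have "(sin a3)\<^sup>2 \<le> y\<^sup>2" using sin_pos by (intro power_mono) auto
  then show ?thesis using rho_sigma[of y] by simp
qed

lemma rho_sigma_gt: "y > sin a3 \<Longrightarrow> (rho y)\<^sup>2 + (sigma y)\<^sup>2 > 1"
proof -
  assume "y > sin a3"
  then have "(sin a3)\<^sup>2 < y\<^sup>2" using sin_pos by (intro power_strict_mono) auto
  then show ?thesis using rho_sigma[of y] by simp
qed

text \<open>\<open>sigma\<close> is affine, so it is enough to know its sign at both ends of the range \<open>-1 \<le> rho y\<close>.\<close>
lemma sigma_pos:
  assumes A: "a0 + a3 < pi" and y: "y \<ge> sin a3" "rho y \<ge> -1"
  shows "sigma y > 0"
proof (cases "cos a0 \<ge> 0")
  case True
  have "sin (a0 + a3) > 0" using A angle_bounds by (intro sin_gt_zero) auto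
  also have "sin (a0 + a3) \<le> sigma y"
    using mult_left_mono[OF y(1) True] by (simp add: sigma_def sin_add mult.commute)
  finally show ?thesis .
next
  case False
  have "cos (pi - a3) < cos a0" using A angle_bounds by (intro cos_monotone_0_pi) auto
  then have "0 < cos a0 + cos a3" by simp
  \<comment> \<open>This is \<open>sin a0 * sigma y\<close> at the end \<open>rho y = -1\<close>,
    where \<open>sin a0 * y = 1 + cos a0 * cos a3\<close>.\<close>
  also have "\<dots> = cos a0 * (1 + cos a0 * cos a3) + cos a3 * (sin a0)\<^sup>2"
    using sin_cos_squared_add[of a0] by algebra
  also have "\<dots> \<le> cos a0 * (sin a0 * y) + cos a3 * (sin a0)\<^sup>2"
    using False y by (intro add_right_mono mult_left_mono_neg) (auto simp: rho_def)
  also have "\<dots> = sin a0 * sigma y" unfolding sigma_def by algebra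
  finally show ?thesis using sin_pos by (simp add: zero_less_mult_iff)
qed

text \<open>In the limiting case \<open>a0 + a3 = pi\<close> the range \<open>-1 \<le> rho y\<close>
  shrinks to the point \<open>y = sin a3\<close>, where \<open>sigma\<close> vanishes.\<close>

lemma sigma_nonneg:
  assumes A: "a0 + a3 \<le> pi" and y: "y \<ge> sin a3" "rho y \<ge> -1"
  shows "sigma y \<ge> 0"
proof (cases "a0 + a3 = pi")
  case True
  then have "a3 = pi - a0" by simp
  then have a3: "cos a3 = - cos a0" "sin a3 = sin a0" by simp_all
  have "sin a0 * y \<le> sin a0 * sin a0"
    using y(2) sin_cos_squared_add[of a0] unfolding rho_def a3 by (simp add: power2_eq_square)
  then have "y \<le> sin a0" using sin_pos by simp
  then have "y = sin a0" using y(1) unfolding a3 by simp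
  then show ?thesis unfolding sigma_def a3 by simp
qed (use sigma_pos assms in fastforce)

text \<open>The expression is affine in \<open>r\<close>; at the two ends of the interval it equals
  \<open>cos a1 + cos a2\<close> and \<open>sin a2 * sin (a1 + a2)\<close>, both negative.\<close>

lemma cos_diff_ge_neg:
  assumes B: "a1 + a2 > pi" and r: "-1 \<le> r" "r \<le> cos (a1 + a2)"
  shows "cos a1 - r * cos a2 < 0"
proof -
  have "cos a1 < cos (pi - a2)" using B angle_bounds by (intro cos_monotone_0_pi) auto
  then have c: "cos a1 + cos a2 < 0" by simp
  show ?thesis
  proof (cases "cos a2 \<ge> 0")
    case True
    then have "- r * cos a2 \<le> 1 * cos a2" using r by (intro mult_right_mono) auto
    with c show ?thesis by simp
  next
    case False
    then have "cos (a1 + a2) * cos a2 \<le> r * cos a2" using r by (intro mult_right_mono_neg) auto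
    moreover have "cos a1 - cos (a1 + a2) * cos a2 = sin a2 * sin (a1 + a2)"
      using sin_cos_squared_add[of a2] unfolding cos_add sin_add by algebra
    moreover have "sin (a1 + a2) < 0" using B angle_bounds by (intro sin_lt_zero) auto
    ultimately show ?thesis using sin_pos by (smt (verit) mult_pos_neg)
  qed
qed

lemma four_angles_commute: "four_angles a0 a2 a1 a3"
  using angle_bounds by (simp add: four_angles_def)

end

text \<open>With \<open>P = y1 + y2\<close> and the completed square
  \<open>M = (1 - r) (y1 - y2) + s (c2 - c1)\<close>, the conic times \<open>2 (1 - r)\<close> is
  \<open>M^2 + (1 - r^2) P^2 + 2 t P + n\<close>. Here \<open>n\<close> is
  \<open>conic_weight\<close>, \<open>t\<close> is \<open>conic_shift\<close>, and
  \<open>conic_radius2\<close> is a quarter of the discriminant of the quadratic polynomial in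
  \<open>P\<close>.\<close>

definition conic_weight :: "real \<Rightarrow> real \<Rightarrow> real \<Rightarrow> real \<Rightarrow> real" where
  "conic_weight r s c1 c2 =
     (1 - r)\<^sup>2 * (c1 + c2)\<^sup>2 + (r\<^sup>2 + s\<^sup>2 - 1) * (2 * (1 - r) - (c1 - c2)\<^sup>2)"

definition conic_radius2 :: "real \<Rightarrow> real \<Rightarrow> real \<Rightarrow> real \<Rightarrow> real" where
  "conic_radius2 r s c1 c2 =
     2 * (1 - r) * (r\<^sup>2 + s\<^sup>2 - 1) * (r\<^sup>2 - 2 * r * c1 * c2 + c1\<^sup>2 + c2\<^sup>2 - 1)"

definition conic_shift :: "real \<Rightarrow> real \<Rightarrow> real \<Rightarrow> real \<Rightarrow> real" where
  "conic_shift r s c1 c2 = (1 - r) * s * (c1 + c2)"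

lemma conic_shift_radius:
  "(conic_shift r s c1 c2)\<^sup>2 - conic_radius2 r s c1 c2 = conic_weight r s c1 c2 * (1 - r\<^sup>2)"
  unfolding conic_weight_def conic_radius2_def conic_shift_def by algebra

text \<open>The projective coordinate \<open>1 / (y1 + y2)\<close> turns every slice, be it an ellipse, a parabola
  or a hyperbola, into (part of) a circle.\<close>
lemma conic_circle:
  "(conic_weight r s c1 c2 + conic_shift r s c1 c2 * (y1 + y2))\<^sup>2
     + conic_weight r s c1 c2 * ((1 - r) * (y1 - y2) + s * (c2 - c1))\<^sup>2
     - conic_radius2 r s c1 c2 * (y1 + y2)\<^sup>2
   = 2 * (1 - r) * conic_weight r s c1 c2 * slice_conic r s c1 c2 y1 y2"
proof -
  have 1: "conic_weight r s c1 c2 + 2 * conic_shift r s c1 c2 * (y1 + y2)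
      + (1 - r\<^sup>2) * (y1 + y2)\<^sup>2 + ((1 - r) * (y1 - y2) + s * (c2 - c1))\<^sup>2
      = 2 * (1 - r) * slice_conic r s c1 c2 y1 y2"
    unfolding conic_weight_def conic_shift_def slice_conic_def by algebra
  then show ?thesis using conic_shift_radius[of r s c1 c2] by algebra
qed

text \<open>On the slices with \<open>rho y \<ge> -1\<close>, \<open>A\<close> makes
  \<open>sigma y\<close> nonnegative, and positive if \<open>a1 + a2 > pi\<close>; this fixes the
  sign of the shift. Whenever \<open>A\<close> fails, the reflected angles satisfy it, unless
  \<open>a0 + a3\<close> and \<open>a1 + a2\<close> both equal \<open>pi\<close>.\<close>

locale plane_angles = four_angles +
  assumes A: "a0 + a3 < pi \<or> a0 + a3 = pi \<and> a1 + a2 < pi"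
begin

abbreviation "weight y \<equiv> conic_weight (rho y) (sigma y) (cos a1) (cos a2)"
abbreviation "radius2 y \<equiv> conic_radius2 (rho y) (sigma y) (cos a1) (cos a2)"
abbreviation "shift y \<equiv> conic_shift (rho y) (sigma y) (cos a1) (cos a2)"

text \<open>At the second argument of \<open>max\<close>, \<open>rho\<close> equals
  \<open>cos (a1 + a2)\<close>, the largest value that \<open>slice_conic_bound\<close> admits. So
  there are no solutions below \<open>low\<close>.\<close>

definition low :: real where "low = max (sin a3) ((cos a0 * cos a3 - cos (a1 + a2)) / sin a0)"

lemma low_le_iff: "low \<le> y \<longleftrightarrow> sin a3 \<le> y \<and> rho y \<le> cos (a1 + a2)"
  using sin_pos by (auto simp: low_def rho_def field_simps)

text \<open>Both summands are nonnegative, the bracket of the second being at least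
  \<open>(sin a1 + sin a2)^2\<close>. The first one vanishes only for \<open>a1 + a2 = pi\<close>;
  then \<open>low \<le> y\<close> forces \<open>rho y \<le> -1\<close>, which keeps \<open>y\<close>
  away from \<open>sin a3\<close> and makes the second one positive.\<close>

lemma weight_pos:
  assumes "low \<le> y"
  shows "weight y > 0"
proof -
  have y: "sin a3 \<le> y" "rho y \<le> cos (a1 + a2)" using assms by (auto simp: low_le_iff)
  have "(sin a1 + sin a2)\<^sup>2 = 2 * (1 - cos (a1 + a2)) - (cos a1 - cos a2)\<^sup>2"
    unfolding cos_add using sin_cos_squared_add[of a1] sin_cos_squared_add[of a2] by algebra
  also have "\<dots> \<le> 2 * (1 - rho y) - (cos a1 - cos a2)\<^sup>2" using y by simp
  finally have br: "2 * (1 - rho y) - (cos a1 - cos a2)\<^sup>2 > 0"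
    using sin_pos by (smt (verit) zero_less_power)
  have W: "(rho y)\<^sup>2 + (sigma y)\<^sup>2 - 1 \<ge> 0" using rho_sigma_ge y by simp
  show ?thesis
  proof (cases "cos a1 + cos a2 = 0")
    case False
    then have "(1 - rho y)\<^sup>2 * (cos a1 + cos a2)\<^sup>2 > 0" using rho_lt_1[OF y(1)] by simp
    then show ?thesis
      using mult_nonneg_nonneg[OF W less_imp_le[OF br]] unfolding conic_weight_def by linarith
  next
    case True
    then have "cos (pi - a2) = cos a1" unfolding cos_pi_minus by linarith
    then have "a1 = pi - a2" using cos_inj_pi[of "pi - a2" a1] angle_bounds by linarith
    then have "cos (a1 + a2) = -1" "a0 + a3 < pi" using A by auto
    moreover have "rho (sin a3) = cos (a0 + a3)" by (simp add: rho_def cos_add)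
    moreover have "cos (a0 + a3) > cos pi"
      using angle_bounds \<open>a0 + a3 < pi\<close> by (intro cos_monotone_0_pi) auto
    ultimately have "y \<noteq> sin a3" using y by auto
    then have "(rho y)\<^sup>2 + (sigma y)\<^sup>2 - 1 > 0" using rho_sigma_gt[of y] y by simp
    then show ?thesis using br by (simp add: conic_weight_def True)
  qed
qed

text \<open>From \<open>low\<close> on, every factor is nonnegative and increases with
  \<open>y\<close>, so the radius can replace the height as the parameter of the slices.\<close>

lemma radius2_eq:
  "radius2 y = 2 * (1 - rho y) * (y\<^sup>2 - (sin a3)\<^sup>2) *
     ((cos (a1 + a2) - rho y) * (cos (a1 - a2) - rho y))"
proof -
  have "(rho y)\<^sup>2 - 2 * rho y * cos a1 * cos a2 + (cos a1)\<^sup>2 + (cos a2)\<^sup>2 - 1 =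
     (cos (a1 + a2) - rho y) * (cos (a1 - a2) - rho y)"
    unfolding cos_add cos_diff
    using sin_cos_squared_add[of a1] sin_cos_squared_add[of a2] by algebra
  then show ?thesis unfolding conic_radius2_def rho_sigma by simp
qed

lemma cos_add_less_cos_diff: "cos (a1 + a2) < cos (a1 - a2)"
  using sin_pos by (simp add: cos_add cos_diff)

lemma rho_strict_antimono: "x < y \<Longrightarrow> rho y < rho x"
  using sin_pos by (simp add: rho_def)

lemma radius2_low: "radius2 low = 0"
proof -
  have "low = sin a3 \<or> rho low = cos (a1 + a2)"
    using sin_pos by (auto simp: low_def max_def rho_def)
  then show ?thesis unfolding radius2_eq by auto
qed

lemma radius2_strict_mono:
  assumes "low \<le> x" "x < y"
  shows "radius2 x < radius2 y"
proof -
  have x: "sin a3 \<le> x" "rho x \<le> cos (a1 + a2)" using assms by (auto simp: low_le_iff)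
  have r: "rho y < rho x" using assms rho_strict_antimono by simp
  have x2: "(sin a3)\<^sup>2 \<le> x\<^sup>2" "x\<^sup>2 < y\<^sup>2"
    using x assms sin_pos by (auto intro: power_mono power_strict_mono)
  have "radius2 x \<le> 2 * (1 - rho x) * (y\<^sup>2 - (sin a3)\<^sup>2) *
      ((cos (a1 + a2) - rho y) * (cos (a1 - a2) - rho y))"
    unfolding radius2_eq
    using x x2 r rho_lt_1[OF x(1)] cos_add_less_cos_diff by (intro mult_mono) auto
  also have "\<dots> < radius2 y"
    unfolding radius2_eq
    using x x2 r rho_lt_1[OF x(1)] cos_add_less_cos_diff by (intro mult_strict_right_mono) auto
  finally show ?thesis .
qed

lemma radius2_nonneg: "low \<le> y \<Longrightarrow> 0 \<le> radius2 y"
  using radius2_strict_mono[of low y] radius2_low by fastforce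

lemma continuous_rho [continuous_intros]: "continuous_on S f \<Longrightarrow> continuous_on S (\<lambda>x. rho (f x))"
  unfolding rho_def by (intro continuous_intros)

lemma continuous_sigma [continuous_intros]: "continuous_on S f \<Longrightarrow> continuous_on S (\<lambda>x. sigma (f x))"
  unfolding sigma_def by (intro continuous_intros)

lemma continuous_weight [continuous_intros]: "continuous_on S f \<Longrightarrow> continuous_on S (\<lambda>x. weight (f x))"
  unfolding conic_weight_def by (intro continuous_intros)

lemma continuous_shift [continuous_intros]: "continuous_on S f \<Longrightarrow> continuous_on S (\<lambda>x. shift (f x))"
  unfolding conic_shift_def by (intro continuous_intros)

lemma continuous_radius2 [continuous_intros]: "continuous_on S f \<Longrightarrow> continuous_on S (\<lambda>x. radius2 (f x))"
  unfolding conic_radius2_def by (intro continuous_intros)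

lemma radius2_unbounded: "\<exists>y \<ge> low. b \<le> radius2 y"
proof -
  have "filterlim (\<lambda>y. sin a0 * y) at_top at_top"
    using sin_pos(1) by (intro filterlim_tendsto_pos_mult_at_top[of _ "sin a0"] filterlim_ident) auto
  then have rho: "filterlim (\<lambda>y. c - rho y) at_top at_top" for c
    using filterlim_tendsto_add_at_top[OF tendsto_const, of "\<lambda>y. sin a0 * y" at_top "c - cos a0 * cos a3"]
    by (simp add: rho_def algebra_simps)
  have y2: "filterlim (\<lambda>y. y\<^sup>2 - (sin a3)\<^sup>2) at_top (at_top :: real filter)"
    by real_asymp
  have "filterlim (\<lambda>y. 2 * (1 - rho y)) at_top at_top"
    by (intro filterlim_tendsto_pos_mult_at_top[of _ 2] rho) auto
  then have "filterlim radius2 at_top at_top"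
    unfolding radius2_eq
    by (rule filterlim_at_top_mult_at_top[OF filterlim_at_top_mult_at_top[OF _ y2]
          filterlim_at_top_mult_at_top[OF rho rho]])
  then have "eventually (\<lambda>y. b \<le> radius2 y) at_top" by (simp add: filterlim_at_top)
  then show ?thesis
    by (metis (mono_tags, lifting) eventually_at_top_linorder max.cobounded1 max.cobounded2)
qed

lemma radius_image: "(\<lambda>y. sqrt (radius2 y)) ` {low..} = {0..}"
proof safe
  fix y assume "low \<le> y" then show "0 \<le> sqrt (radius2 y)" using radius2_nonneg by simp
next
  fix r :: real assume r: "0 \<le> r"
  obtain y where y: "low \<le> y" "r\<^sup>2 \<le> radius2 y" using radius2_unbounded by blast
  have "\<exists>x\<ge>low. x \<le> y \<and> radius2 x = r\<^sup>2"
    using y r by (intro IVT') (auto simp: radius2_low intro!: continuous_intros)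
  then obtain x where "x \<ge> low" "radius2 x = r\<^sup>2" by blast
  then have "r = sqrt (radius2 x)" using r by simp
  then show "r \<in> (\<lambda>y. sqrt (radius2 y)) ` {low..}" using \<open>x \<ge> low\<close> by blast
qed

lemma height_exists: "\<exists>g. homeomorphism {low..} {0..} (\<lambda>y. sqrt (radius2 y)) g"
proof -
  have "inj_on (\<lambda>y. sqrt (radius2 y)) {low..}"
    using radius2_strict_mono by (intro inj_onI) (metis atLeast_iff less_irrefl neqE real_sqrt_eq_iff)
  moreover have "continuous_on {low..} (\<lambda>y. sqrt (radius2 y))" by (intro continuous_intros)
  ultimately show ?thesis
    by (intro homeomorphism_into_1d[OF _ _ radius_image])
      (auto intro: convex_imp_path_connected)
qed

definition height :: "real \<Rightarrow> real" where
  "height = (SOME g. homeomorphism {low..} {0..} (\<lambda>y. sqrt (radius2 y)) g)"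

lemma homeomorphism_height: "homeomorphism {low..} {0..} (\<lambda>y. sqrt (radius2 y)) height"
  unfolding height_def using height_exists by (rule someI_ex)

lemma height: 
  "r \<ge> 0 \<Longrightarrow> low \<le> height r" "r \<ge> 0 \<Longrightarrow> sqrt (radius2 (height r)) = r"
  "low \<le> y \<Longrightarrow> height (sqrt (radius2 y)) = y"
  using homeomorphism_height by (auto simp: homeomorphism_def)

lemma continuous_height [continuous_intros]:
  "continuous_on S f \<Longrightarrow> (\<And>x. x \<in> S \<Longrightarrow> f x \<ge> 0) \<Longrightarrow> continuous_on S (\<lambda>x. height (f x))"
  using continuous_on_compose2[of "{0..}" height S f] homeomorphism_height
  by (auto simp: homeomorphism_def)

lemma inner_shift_nonneg:
  assumes "low \<le> y" "rho y \<ge> -1" "a1 + a2 \<le> pi"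
  shows "shift y \<ge> 0"
proof -
  have y: "sin a3 \<le> y" using assms(1) by (simp add: low_le_iff)
  have "cos (pi - a2) \<le> cos a1" using assms angle_bounds by (intro cos_monotone_0_pi_le) auto
  moreover have "sigma y \<ge> 0" using y assms(2) A by (intro sigma_nonneg) auto
  ultimately show ?thesis using rho_lt_1[OF y] by (simp add: conic_shift_def)
qed

lemma inner_shift_neg:
  assumes "low \<le> y" "rho y \<ge> -1" "a1 + a2 > pi"
  shows "shift y < 0"
proof -
  have y: "sin a3 \<le> y" using assms(1) by (simp add: low_le_iff)
  have "cos a1 < cos (pi - a2)" using assms angle_bounds by (intro cos_monotone_0_pi) auto
  moreover have "sigma y > 0" using y assms A by (intro sigma_pos) auto
  ultimately show ?thesis
    using rho_lt_1[OF y] by (simp add: conic_shift_def mult_less_0_iff zero_less_mult_iff)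
qed

text \<open>Three kinds of slices occur. For \<open>rho y3 < -1\<close> the strict inequality picks
  the right branch of a hyperbola. For \<open>rho y3 \<ge> -1\<close> and
  \<open>a1 + a2 > pi\<close> every point of the slice obeys both bounds. For
  \<open>rho y3 \<ge> -1\<close> and \<open>a1 + a2 \<le> pi\<close> no point of the slice has
  \<open>y1 + y2 > 0\<close>.\<close>

lemma gram_solutions_iff:
  "(y1, y2, y3) \<in> gram_solutions 1 a0 a1 a2 a3 \<longleftrightarrow>
     low \<le> y3 \<and> y1 + y2 > 0 \<and> slice_conic (rho y3) (sigma y3) (cos a1) (cos a2) y1 y2 = 0"
proof
  assume *: "(y1, y2, y3) \<in> gram_solutions 1 a0 a1 a2 a3"
  then have y: "sin a1 \<le> y1" "sin a2 \<le> y2" "sin a3 \<le> y3"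
    and Q: "slice_conic (rho y3) (sigma y3) (cos a1) (cos a2) y1 y2 = 0"
    by (auto simp: gram_solutions_def rho_def sigma_def)
  then show "low \<le> y3 \<and> y1 + y2 > 0 \<and> slice_conic (rho y3) (sigma y3) (cos a1) (cos a2) y1 y2 = 0"
    using slice_conic_bound[OF y(1,2) sin_pos(2,3) Q] sin_pos by (auto simp: low_le_iff)
next
  assume *: "low \<le> y3 \<and> y1 + y2 > 0 \<and> slice_conic (rho y3) (sigma y3) (cos a1) (cos a2) y1 y2 = 0"
  then have y3: "sin a3 \<le> y3" "rho y3 \<le> cos (a1 + a2)" and P: "y1 + y2 > 0" and low: "low \<le> y3"
    and Q: "slice_conic (rho y3) (sigma y3) (cos a1) (cos a2) y1 y2 = 0"
    by (auto simp: low_le_iff)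
  have "sin a1 \<le> y1 \<and> sin a2 \<le> y2"
  proof (cases "rho y3 < -1")
    case True
    then show ?thesis using slice_conic_outer[OF sin_pos(2,3) _ P Q] by simp
  next
    case False
    then have r: "rho y3 \<ge> -1" by simp
    then have r2: "(rho y3)\<^sup>2 \<le> 1" using rho_lt_1[OF y3(1)] by (simp add: abs_square_le_1 abs_le_iff)
    show ?thesis
    proof (cases "a1 + a2 > pi")
      case B: True
      then have \<sigma>: "sigma y3 > 0" using r y3 A by (intro sigma_pos) auto
      have c: "cos a1 - rho y3 * cos a2 < 0" "cos a2 - rho y3 * cos a1 < 0"
        using cos_diff_ge_neg[OF B r y3(2)] 
          four_angles.cos_diff_ge_neg[OF four_angles_commute _ r] B y3(2) by (auto simp: add.commute)
      have Q': "slice_conic (rho y3) (sigma y3) (cos a2) (cos a1) y2 y1 = 0"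
        using Q by (simp add: slice_conic_commute)
      show ?thesis
      proof (cases "y3 = sin a3")
        case False
        then have "(rho y3)\<^sup>2 + (sigma y3)\<^sup>2 > 1" using rho_sigma_gt y3 by simp
        then show ?thesis
          using slice_conic_inner[OF r2 \<sigma> _ c(1) sin_pos(3) Q]
            slice_conic_inner[OF r2 \<sigma> _ c(2) sin_pos(2) Q'] by simp
      next
        case True
        have W: "(rho y3)\<^sup>2 + (sigma y3)\<^sup>2 = 1" using rho_sigma[of y3] True by simp
        have rs: "rho y3 = cos (a0 + a3)" "sigma y3 = sin (a0 + a3)"
          by (simp_all add: True rho_def sigma_def cos_add sin_add)
        have A': "a0 + a3 < pi" using A B by auto
        have "\<not> a0 + a3 < 2 * pi - (a1 + a2)"
        proof
          assume "a0 + a3 < 2 * pi - (a1 + a2)"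
          then have "cos (2 * pi - (a1 + a2)) < cos (a0 + a3)"
            using B A' angle_bounds by (intro cos_monotone_0_pi) auto
          then show False using y3(2) rs by (simp add: cos_diff)
        qed
        then have S: "a0 + a3 \<ge> 2 * pi - (a1 + a2)" by simp
        \<comment> \<open>By \<open>slice_conic_point\<close>, both coordinates of the single point
          satisfy such a linear equation, with \<open>b\<close> and \<open>b'\<close> being
          \<open>a1\<close> and \<open>a2\<close> in either order.\<close>
        have *: "sin b \<le> y" if b: "0 < b" "b < pi" "0 < b'" "b' < pi" "b + b' = a1 + a2"
          and y: "sin (a0 + a3) * y = cos (a0 + a3) * cos b - cos b'" for b b' y
        proof -
          have "cos b' \<le> cos (2 * pi - (a0 + a3 + b))"
            using b S A' by (intro cos_monotone_0_pi_le) auto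
          also have "\<dots> = cos (a0 + a3) * cos b - sin (a0 + a3) * sin b"
            using cos_add[of "a0 + a3" b] by (simp add: cos_diff)
          finally have "sin (a0 + a3) * sin b \<le> sin (a0 + a3) * y" unfolding y by simp
          moreover have "sin (a0 + a3) > 0" using \<sigma> rs by simp
          ultimately show ?thesis by simp
        qed
        show ?thesis
          using slice_conic_point[OF W Q] slice_conic_point[OF W Q'] angle_bounds
            *[of a1 a2 y1] *[of a2 a1 y2] unfolding rs by auto
      qed
    next
      case False
      define n where "n = weight y3"
      have "n > 0" using weight_pos low by (simp add: n_def)
      have "shift y3 \<ge> 0" using inner_shift_nonneg[OF low r] False by simp
      have "n * (1 - (rho y3)\<^sup>2) \<ge> 0" using r2 \<open>n > 0\<close> by simp
      \<comment> \<open>This is \<open>conic_circle\<close> with the squared radius expanded by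
        \<open>conic_shift_radius\<close>. All summands are nonnegative and the first is
        positive.\<close>
      have "n\<^sup>2 + 2 * n * shift y3 * (y1 + y2) + n * (1 - (rho y3)\<^sup>2) * (y1 + y2)\<^sup>2 
          + n * ((1 - rho y3) * (y1 - y2) + sigma y3 * (cos a2 - cos a1))\<^sup>2 = 0"
        using conic_circle[of "rho y3" "sigma y3" "cos a1" "cos a2" y1 y2]
          conic_shift_radius[of "rho y3" "sigma y3" "cos a1" "cos a2"] Q
        unfolding n_def[symmetric] by algebra
      moreover have "n\<^sup>2 > 0" "2 * n * shift y3 * (y1 + y2) \<ge> 0"
        "n * (1 - (rho y3)\<^sup>2) * (y1 + y2)\<^sup>2 \<ge> 0"
        "n * ((1 - rho y3) * (y1 - y2) + sigma y3 * (cos a2 - cos a1))\<^sup>2 \<ge> 0"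
        using \<open>n > 0\<close> \<open>shift y3 \<ge> 0\<close> \<open>n * (1 - (rho y3)\<^sup>2) \<ge> 0\<close> P by auto
      ultimately have False by linarith
      then show ?thesis ..
    qed
  qed
  then show "(y1, y2, y3) \<in> gram_solutions 1 a0 a1 a2 a3"
    using y3 Q by (simp add: gram_solutions_def rho_def sigma_def)
qed

end

section \<open>The plane component\<close>

text \<open>In polar coordinates the condition reads \<open>up (r * cos t)\<close>. It is even in
  \<open>t\<close> and, as the cosine decreases on \<open>[0, pi]\<close>, passes from
  \<open>t\<close> to every angle of smaller absolute value. So the admissible angles form an
  interval.\<close>

lemma connected_arc:
  assumes up: "\<And>x y. up x \<Longrightarrow> x \<le> y \<Longrightarrow> up y"
  shows "connected {z. cmod z = r \<and> up (Re z)}"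
proof (cases "r \<ge> 0")
  case True
  define I where "I = {t \<in> {-pi..pi}. up (r * cos t)}"
  have "is_interval I"
    unfolding is_interval_1
  proof (intro ballI allI impI)
    fix a b x assume *: "a \<in> I" "b \<in> I" "a \<le> x \<and> x \<le> b"
    define m where "m = max \<bar>a\<bar> \<bar>b\<bar>"
    have m: "m \<le> pi" "\<bar>x\<bar> \<le> m" "up (r * cos m)" using * by (auto simp: m_def max_def I_def)
    have "cos m \<le> cos \<bar>x\<bar>" using m by (intro cos_monotone_0_pi_le) auto
    then have "r * cos m \<le> r * cos x" using True by (simp add: mult_left_mono)
    then show "x \<in> I" using up m * by (auto simp: I_def)
  qed
  then have "connected I" by (simp add: is_interval_connected_1)
  then have "connected ((\<lambda>t. r *\<^sub>R cis t) ` I)"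
    by (intro connected_continuous_image continuous_intros) auto
  moreover have "(\<lambda>t. r *\<^sub>R cis t) ` I = {z. cmod z = r \<and> up (Re z)}"
  proof safe
    fix t assume "t \<in> I" then show "cmod (r *\<^sub>R cis t) = r" "up (Re (r *\<^sub>R cis t))"
      using True by (auto simp: I_def)
  next
    fix z assume "up (Re z)" "r = cmod z"
    moreover have z: "z = cmod z *\<^sub>R cis (Arg z)"
      by (metis rcis_cmod_Arg rcis_def scaleR_conv_of_real)
    then have "Re z = cmod z * cos (Arg z)" by (metis cis.sel(1) scaleR_complex.sel(1))
    ultimately have "Arg z \<in> I" using Arg_bounded[of z] by (auto simp: I_def)
    then show "z \<in> (\<lambda>t. cmod z *\<^sub>R cis t) ` I" using z by blast
  qed
  ultimately show ?thesis by simp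
next
  case False
  then have e: "{z. cmod z = r \<and> up (Re z)} = {}" by auto
  show ?thesis unfolding e by (rule connected_empty)
qed

text \<open>Each nonempty arc contains the point of its circle on the nonnegative real axis. By
  \<open>ray\<close> these points form an interval, which joins the arcs.\<close>

lemma connected_arcs:
  assumes up: "\<And>r x y. up r x \<Longrightarrow> x \<le> y \<Longrightarrow> up r y"
    and ray: "\<And>r s. 0 \<le> r \<Longrightarrow> r \<le> s \<Longrightarrow> up r r \<Longrightarrow> up s s"
  shows "connected {z. up (cmod z) (Re z)}"
proof -
  define R where "R = complex_of_real ` {r. 0 \<le> r \<and> up r r}"
  define arc where "arc r = {z. cmod z = r \<and> up r (Re z)}" for r
  have "is_interval {r. 0 \<le> r \<and> up r r}"
    unfolding is_interval_1 using ray by (smt (verit) mem_Collect_eq)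
  then have R: "connected R"
    unfolding R_def by (intro connected_continuous_image continuous_intros) (simp add: is_interval_connected_1)
  have mem: "complex_of_real (cmod z) \<in> R \<inter> arc (cmod z)" if "up (cmod z) (Re z)" for z
    using up[OF that complex_Re_le_cmod] by (auto simp: R_def arc_def)
  have arc: "connected (arc r)" for r
    unfolding arc_def by (rule connected_arc) (rule up)
  have "connected (\<Union>z\<in>{z. up (cmod z) (Re z)}. arc (cmod z) \<union> R)"
  proof (cases "{z. up (cmod z) (Re z)} = {}")
    case False
    then obtain z where "up (cmod z) (Re z)" by blast
    then have "R \<noteq> {}" using mem by blast
    moreover have "connected (arc (cmod z) \<union> R)" if "up (cmod z) (Re z)" for z
      using mem[OF that] arc R by (intro connected_Un) auto
    ultimately show ?thesis by (intro connected_Union) auto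
  qed simp
  moreover have "(\<Union>z\<in>{z. up (cmod z) (Re z)}. arc (cmod z) \<union> R) = {z. up (cmod z) (Re z)}"
    by (fastforce simp: arc_def R_def)
  ultimately show ?thesis by simp
qed

section \<open>The region swept out by the arcs\<close>

context plane_angles
begin

text \<open>This decides whether the circle of a slice meets the half-plane
  \<open>Re z > shift y\<close>. By \<open>conic_shift_radius\<close> the squares compare according
  to the sign of \<open>1 - (rho y)\<^sup>2\<close>. The criterion persists as \<open>y\<close>
  grows, because \<open>rho\<close> decreases: this is the hypothesis \<open>ray\<close> of
  \<open>connected_arcs\<close>.\<close>

lemma shift_less_radius_iff:
  assumes "low \<le> y"
  shows "shift y < sqrt (radius2 y) \<longleftrightarrow> rho y < -1 \<or> a1 + a2 > pi"
proof (cases "rho y < -1")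
  case True
  then have "(rho y)\<^sup>2 > 1" using one_less_power[of "- rho y" 2] by simp
  then have "weight y * (1 - (rho y)\<^sup>2) < 0" using weight_pos[OF assms] by (simp add: mult_pos_neg)
  then have "(shift y)\<^sup>2 < radius2 y"
    using conic_shift_radius[of "rho y" "sigma y" "cos a1" "cos a2"] by simp
  then have "\<bar>shift y\<bar> < sqrt (radius2 y)" using real_less_rsqrt by fastforce
  then show ?thesis using True by simp
next
  case False
  then have r: "rho y \<ge> -1" by simp
  show ?thesis
  proof (cases "a1 + a2 > pi")
    case True
    then have "shift y < 0" using inner_shift_neg assms r by simp
    also have "\<dots> \<le> sqrt (radius2 y)" using radius2_nonneg[OF assms] by simp
    finally show ?thesis using True by simp
  next
    case B: False
    have "(rho y)\<^sup>2 \<le> 1" using r rho_lt_1[of y] assms by (simp add: abs_square_le_1 abs_le_iff low_le_iff)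
    then have "weight y * (1 - (rho y)\<^sup>2) \<ge> 0" using weight_pos[OF assms] by simp
    then have "radius2 y \<le> (shift y)\<^sup>2"
      using conic_shift_radius[of "rho y" "sigma y" "cos a1" "cos a2"] by simp
    moreover have "shift y \<ge> 0" using inner_shift_nonneg assms r B by simp
    ultimately have "sqrt (radius2 y) \<le> shift y" using real_le_lsqrt radius2_nonneg[OF assms] by blast
    then show ?thesis using B False by simp
  qed
qed

text \<open>The counterpart for the complement of the region, negated so that its arcs also open
  towards the positive real axis.\<close>

lemma minus_radius_le_shift_iff:
  assumes "low \<le> y"
  shows "- shift y \<le> sqrt (radius2 y) \<longleftrightarrow> rho y \<le> -1 \<or> a1 + a2 \<le> pi"
proof (cases "a1 + a2 \<le> pi \<and> rho y \<ge> -1")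
  case True
  then have "shift y \<ge> 0" using inner_shift_nonneg assms by simp
  moreover have "sqrt (radius2 y) \<ge> 0" using radius2_nonneg[OF assms] by simp
  ultimately have "- shift y \<le> sqrt (radius2 y)" by linarith
  then show ?thesis using True by simp
next
  case False
  note eq = conic_shift_radius[of "rho y" "sigma y" "cos a1" "cos a2"]
  show ?thesis
  proof (cases "rho y \<le> -1")
    case True
    then have "(rho y)\<^sup>2 \<ge> 1" using one_le_power[of "- rho y" 2] by simp
    then have "weight y * (1 - (rho y)\<^sup>2) \<le> 0" using weight_pos[OF assms] by (simp add: mult_le_0_iff)
    then have "(- shift y)\<^sup>2 \<le> radius2 y" using eq by simp
    then have "- shift y \<le> sqrt (radius2 y)" using real_le_rsqrt by blast
    then show ?thesis using True by simp
  next
    case r: False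
    then have neg: "shift y < 0" using inner_shift_neg assms False by simp
    have "(rho y)\<^sup>2 < 1" using r rho_lt_1[of y] assms by (simp add: abs_square_less_1 abs_less_iff low_le_iff)
    then have "weight y * (1 - (rho y)\<^sup>2) > 0" using weight_pos[OF assms] by simp
    then have "radius2 y < (- shift y)\<^sup>2" using eq by simp
    then have "sqrt (radius2 y) < - shift y" using neg real_less_lsqrt[of "- shift y"] by simp
    then show ?thesis using r False by simp
  qed
qed

lemma height_mono:
  assumes "0 \<le> r" "r \<le> s"
  shows "height r \<le> height s"
proof (rule ccontr)
  assume "\<not> ?thesis"
  then have "radius2 (height s) < radius2 (height r)"
    using assms height(1) by (intro radius2_strict_mono) auto
  then have "sqrt (radius2 (height s)) < sqrt (radius2 (height r))" by simp
  then show False using height(2) assms by simp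
qed

lemma rho_height_mono: "0 \<le> r \<Longrightarrow> r \<le> s \<Longrightarrow> rho (height s) \<le> rho (height r)"
  using height_mono[of r s] sin_pos by (simp add: rho_def)

text \<open>The real part of a chart value exceeds the shift by \<open>weight y / (y1 + y2)\<close>,
  so this inequality encodes \<open>y1 + y2 > 0\<close>.\<close>

definition region :: "complex set" where
  "region = {z. shift (height (cmod z)) < Re z}"

lemma open_region: "open region"
  unfolding region_def by (intro open_Collect_less continuous_intros) auto

lemma connected_region: "connected region"
  unfolding region_def
proof (rule connected_arcs)
  fix r s :: real assume r: "0 \<le> r" "r \<le> s" and "shift (height r) < r"
  then have "rho (height r) < -1 \<or> a1 + a2 > pi"
    using shift_less_radius_iff[of "height r"] height by auto
  then have "rho (height s) < -1 \<or> a1 + a2 > pi" using rho_height_mono[OF r] by auto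
  then show "shift (height s) < s"
    using shift_less_radius_iff[of "height s"] height[of s] r by auto
qed auto

lemma uminus_compl_region: "uminus ` (- region) = {z. - shift (height (cmod z)) \<le> Re z}"
proof safe
  fix z assume "- shift (height (cmod z)) \<le> Re z"
  then have "- z \<in> - region" by (simp add: region_def)
  then show "z \<in> uminus ` (- region)" by (metis add.inverse_inverse image_eqI)
qed (simp add: region_def)

lemma connected_compl_region: "connected (- region)"
proof -
  have "connected (uminus ` (- region))"
    unfolding uminus_compl_region
  proof (rule connected_arcs)
    fix r s :: real assume r: "0 \<le> r" "r \<le> s" and "- shift (height r) \<le> r"
    then have "rho (height r) \<le> -1 \<or> a1 + a2 \<le> pi"
      using minus_radius_le_shift_iff[of "height r"] height by auto
    then have "rho (height s) \<le> -1 \<or> a1 + a2 \<le> pi" using rho_height_mono[OF r] by auto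
    then show "- shift (height s) \<le> s"
      using minus_radius_le_shift_iff[of "height s"] height[of s] r by auto
  qed auto
  then have "connected (uminus ` uminus ` (- region))"
    by (rule connected_continuous_image[rotated]) (intro continuous_intros)
  then show ?thesis by (simp add: image_image)
qed

lemma eventually_rho: "\<exists>r0 > 0. \<forall>r \<ge> r0. rho (height r) < -1"
proof -
  \<comment> \<open>Chosen such that \<open>sin a0 * y \<ge> 4\<close> and hence
    \<open>rho y \<le> -3\<close>.\<close>
  define y where "y = max low (2 * (2 / sin a0))"
  have "rho y < -1"
  proof -
    have "sin a0 * y \<ge> 4" using sin_pos by (simp add: y_def max_def field_simps)
    moreover have "cos a0 * cos a3 \<le> 1"
      using abs_cos_le_one[of a0] abs_cos_le_one[of a3]
      by (metis abs_ge_zero abs_le_D1 abs_mult mult_le_one)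
    ultimately show ?thesis by (simp add: rho_def)
  qed
  moreover have low: "low \<le> y" by (simp add: y_def)
  moreover define r where "r = sqrt (radius2 y)"
  ultimately have r: "r \<ge> 0" "rho (height r) < -1"
    by (simp_all add: radius2_nonneg height(3))
  have "rho (height s) < -1" if "s \<ge> r + 1" for s
    using rho_height_mono[of r s] r that by linarith
  then show ?thesis using r by (intro exI[of _ "r + 1"]) simp
qed

lemma simply_connected_region: "simply_connected region"
proof -
  obtain r0 where r0: "r0 > 0" "\<And>r. r \<ge> r0 \<Longrightarrow> rho (height r) < -1" using eventually_rho by blast
  have "\<not> bounded (- region)"
  proof
    assume "bounded (- region)"
    then obtain b where b: "\<And>z. z \<in> - region \<Longrightarrow> cmod z \<le> b" by (auto simp: bounded_iff)
    define r where "r = max r0 (b + 1)"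
    have r: "r > b" "r \<ge> r0" "r \<ge> 0" using r0(1) by (auto simp: r_def)
    have "- shift (height r) \<le> r"
      using minus_radius_le_shift_iff[OF height(1)[OF r(3)]] r0(2)[OF r(2)] height(2)[OF r(3)] by auto
    then have "- of_real r \<in> - region" using r by (simp add: region_def)
    then have "r \<le> b" using b r by fastforce
    then show False using r by simp
  qed
  then show ?thesis
    using simply_connected_eq_empty_inside[OF open_region] connected_region
      inside_complement_unbounded_connected_empty[OF connected_compl_region] by blast
qed

lemma region_nonempty: "region \<noteq> {}"
proof -
  obtain r where r: "r > 0" "rho (height r) < -1" using eventually_rho by blast
  then have "shift (height r) < r"
    using shift_less_radius_iff[OF height(1)[of r]] height(2)[of r] by auto
  then have "of_real r \<in> region" using r by (simp add: region_def)
  then show ?thesis by blast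
qed

lemma region_plane: "region homeomorphic (UNIV :: complex set)"
proof -
  have "region homeomorphic ball (0::complex) 1"
    using simply_connected_eq_homeomorphic_to_disc[OF open_region] simply_connected_region region_nonempty by blast
  also have "ball (0::complex) 1 homeomorphic (UNIV :: complex set)"
    by (simp add: homeomorphic_ball_UNIV)
  finally show ?thesis .
qed

text \<open>This is \<open>conic_circle\<close> divided by \<open>(y1 + y2)^2\<close>: on solutions
  the value has modulus \<open>sqrt (radius2 y)\<close>. So the modulus recovers the height, then
  the real part recovers \<open>y1 + y2\<close> and the imaginary part
  \<open>y1 - y2\<close>.\<close>

definition chart :: "real \<times> real \<times> real \<Rightarrow> complex" where
  "chart = (\<lambda>(y1, y2, y). Complex (weight y / (y1 + y2) + shift y)
     (sqrt (weight y) * ((1 - rho y) * (y1 - y2) + sigma y * (cos a2 - cos a1)) / (y1 + y2)))"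

definition unchart_sum :: "complex \<Rightarrow> real" where
  "unchart_sum z = (let y = height (cmod z) in weight y / (Re z - shift y))"

definition unchart_diff :: "complex \<Rightarrow> real" where
  "unchart_diff z = (let y = height (cmod z) in
     (Im z * unchart_sum z / sqrt (weight y) - sigma y * (cos a2 - cos a1)) / (1 - rho y))"

definition unchart :: "complex \<Rightarrow> real \<times> real \<times> real" where
  "unchart z = ((unchart_sum z + unchart_diff z) / 2, (unchart_sum z - unchart_diff z) / 2, height (cmod z))"

lemma chart_mem:
  assumes "(y1, y2, y) \<in> gram_solutions 1 a0 a1 a2 a3"
  shows "chart (y1, y2, y) \<in> region" "unchart (chart (y1, y2, y)) = (y1, y2, y)"
proof -
  have y: "low \<le> y" and P: "y1 + y2 > 0" 
    and Q: "slice_conic (rho y) (sigma y) (cos a1) (cos a2) y1 y2 = 0"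
    using assms by (auto simp: gram_solutions_iff)
  define P where "P = y1 + y2"
  define M where "M = (1 - rho y) * (y1 - y2) + sigma y * (cos a2 - cos a1)"
  define n where "n = weight y"
  have n: "n > 0" using weight_pos y by (simp add: n_def)
  have P0: "P > 0" using P by (simp add: P_def)
  have ch: "chart (y1, y2, y) = Complex (n / P + shift y) (sqrt n * M / P)"
    by (simp add: chart_def P_def M_def n_def)
  have "(n + shift y * P)\<^sup>2 + n * M\<^sup>2 = radius2 y * P\<^sup>2"
    using conic_circle[of "rho y" "sigma y" "cos a1" "cos a2" y1 y2] Q
    by (simp add: P_def M_def n_def)
  moreover have "(n / P + shift y)\<^sup>2 + (sqrt n * M / P)\<^sup>2 = ((n + shift y * P)\<^sup>2 + n * M\<^sup>2) / P\<^sup>2"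
    using P0 n by (simp add: field_simps power_mult_distrib power_divide)
  ultimately have "(n / P + shift y)\<^sup>2 + (sqrt n * M / P)\<^sup>2 = radius2 y" using P0 by simp
  then have cm: "cmod (chart (y1, y2, y)) = sqrt (radius2 y)" by (simp add: ch cmod_def)
  then have h: "height (cmod (chart (y1, y2, y))) = y" using height(3) y by simp
  show "chart (y1, y2, y) \<in> region" unfolding region_def using h n P0 by (simp add: ch)
  have s: "unchart_sum (chart (y1, y2, y)) = P"
    using n P0 by (simp add: unchart_sum_def h) (simp add: ch n_def)
  have "1 - rho y \<noteq> 0" using rho_lt_1[of y] y by (simp add: low_le_iff)
  then have d: "unchart_diff (chart (y1, y2, y)) = y1 - y2"
    unfolding unchart_diff_def s h Let_def using n P0 by (simp add: ch n_def M_def)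
  show "unchart (chart (y1, y2, y)) = (y1, y2, y)"
    by (simp add: unchart_def s d h P_def)
qed

lemma unchart_mem:
  assumes "z \<in> region"
  shows "unchart z \<in> gram_solutions 1 a0 a1 a2 a3" "chart (unchart z) = z"
proof -
  define y where "y = height (cmod z)"
  define n where "n = weight y"
  define P where "P = unchart_sum z"
  define D where "D = unchart_diff z"
  have y: "low \<le> y" "radius2 y = (cmod z)\<^sup>2"
    using height[of "cmod z"] radius2_nonneg by (auto simp: y_def) (metis real_sqrt_pow2 radius2_nonneg height(1) norm_ge_zero)
  have n: "n > 0" using weight_pos y by (simp add: n_def)
  have zr: "Re z - shift y > 0" using assms by (simp add: region_def y_def)
  have P: "P = n / (Re z - shift y)" by (simp add: P_def unchart_sum_def n_def y_def Let_def)
  have P0: "P > 0" using n zr by (simp add: P)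
  have r: "1 - rho y > 0" using rho_lt_1[of y] y by (simp add: low_le_iff)
  have D: "(1 - rho y) * D + sigma y * (cos a2 - cos a1) = Im z * P / sqrt n"
    using r by (simp add: D_def unchart_diff_def n_def y_def P_def Let_def)
  have u: "unchart z = ((P + D) / 2, (P - D) / 2, y)"
    by (simp add: unchart_def P_def D_def y_def)
  have PD: "(P + D) / 2 + (P - D) / 2 = P" "(P + D) / 2 - (P - D) / 2 = D"
    by (simp_all add: field_simps)
  have Re: "n + shift y * P = Re z * P" using zr by (simp add: P field_simps)
  have "(Re z * P)\<^sup>2 + n * (Im z * P / sqrt n)\<^sup>2 - (cmod z)\<^sup>2 * P\<^sup>2 = 0"
    using n by (simp add: cmod_power2 power_mult_distrib power_divide algebra_simps)
  then have "2 * (1 - rho y) * n * slice_conic (rho y) (sigma y) (cos a1) (cos a2) ((P + D) / 2) ((P - D) / 2) = 0"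
    using conic_circle[of "rho y" "sigma y" "cos a1" "cos a2" "(P + D) / 2" "(P - D) / 2"]
    unfolding PD n_def[symmetric] Re D y(2) by simp
  then have "slice_conic (rho y) (sigma y) (cos a1) (cos a2) ((P + D) / 2) ((P - D) / 2) = 0"
    using r n by simp
  then show "unchart z \<in> gram_solutions 1 a0 a1 a2 a3"
    unfolding u gram_solutions_iff PD using y P0 by simp
  have "n / P + shift y = Re z" using n zr by (simp add: P)
  moreover have "sqrt n * (Im z * P / sqrt n) / P = Im z" using n P0 by simp
  ultimately show "chart (unchart z) = z"
    unfolding u chart_def prod.case PD n_def[symmetric] D by simp
qed

lemma homeomorphism_chart: "homeomorphism (gram_solutions 1 a0 a1 a2 a3) region chart unchart"
  unfolding homeomorphism_def
proof (intro conjI ballI)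
  have c: "chart x \<in> region" "unchart (chart x) = x" if "x \<in> gram_solutions 1 a0 a1 a2 a3" for x
    using that by (cases x; simp add: chart_mem)+
  show "unchart (chart x) = x" if "x \<in> gram_solutions 1 a0 a1 a2 a3" for x using c(2)[OF that] .
  show "chart (unchart z) = z" if "z \<in> region" for z using unchart_mem(2)[OF that] .
  show "chart ` gram_solutions 1 a0 a1 a2 a3 = region"
  proof (intro subset_antisym subsetI)
    fix z assume "z \<in> region"
    then show "z \<in> chart ` gram_solutions 1 a0 a1 a2 a3"
      by (intro image_eqI[of _ _ "unchart z"]) (simp_all add: unchart_mem)
  qed (use c(1) in blast)
  show "unchart ` region = gram_solutions 1 a0 a1 a2 a3"
  proof (intro subset_antisym subsetI)
    fix x assume "x \<in> gram_solutions 1 a0 a1 a2 a3"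
    then show "x \<in> unchart ` region"
      by (intro image_eqI[of _ _ "chart x"]) (simp_all add: c)
  qed (use unchart_mem(1) in blast)
  have "fst x + fst (snd x) \<noteq> 0" if "x \<in> gram_solutions 1 a0 a1 a2 a3" for x
    using that by (cases x) (auto simp: gram_solutions_iff)
  then show "continuous_on (gram_solutions 1 a0 a1 a2 a3) chart"
    unfolding chart_def case_prod_unfold by (intro continuous_intros) auto
  have nz: "Re z - shift (height (cmod z)) \<noteq> 0" "1 - rho (height (cmod z)) \<noteq> 0"
    "sqrt (weight (height (cmod z))) \<noteq> 0" if "z \<in> region" for z
    using that rho_lt_1[of "height (cmod z)"] height(1)[of "cmod z"] weight_pos[of "height (cmod z)"]
    by (auto simp: region_def low_le_iff)
  have s: "continuous_on region unchart_sum"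
    unfolding unchart_sum_def Let_def using nz by (intro continuous_intros) auto
  have d: "continuous_on region unchart_diff"
    unfolding unchart_diff_def Let_def using nz s by (intro continuous_intros) auto
  show "continuous_on region unchart"
    unfolding unchart_def using s d by (intro continuous_intros) auto
qed

lemma gram_solutions_plane: "gram_solutions 1 a0 a1 a2 a3 homeomorphic (UNIV :: complex set)"
  using homeomorphism_chart region_plane by (metis homeomorphic_def homeomorphic_trans)

end

section \<open>Solutions with half trace below -1\<close>

lemma (in four_angles) outer_solution:
  assumes y: "sin a3 \<le> y" "rho y < -1"
  shows "\<exists>y1 y2. (y1, y2, y) \<in> gram_solutions 1 a0 a1 a2 a3"
proof -
  define n where "n = conic_weight (rho y) (sigma y) (cos a1) (cos a2)"
  define t where "t = conic_shift (rho y) (sigma y) (cos a1) (cos a2)"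
  define R where "R = sqrt (conic_radius2 (rho y) (sigma y) (cos a1) (cos a2))"
  have r2: "(rho y)\<^sup>2 > 1" using one_less_power[of "- rho y" 2] y by simp
  have "\<bar>cos a1 - cos a2\<bar> \<le> 2"
    using cos_le_one[of a1] cos_le_one[of a2] cos_ge_minus_one[of a1] cos_ge_minus_one[of a2] by linarith
  then have "(cos a1 - cos a2)\<^sup>2 \<le> 2\<^sup>2" by (intro abs_le_square_iff[THEN iffD1]) auto
  then have "2 * (1 - rho y) - (cos a1 - cos a2)\<^sup>2 > 0" using y by simp
  moreover have "(rho y)\<^sup>2 + (sigma y)\<^sup>2 - 1 > 0" using r2 by (smt (verit) zero_le_power2)
  ultimately have n: "n > 0" by (simp add: n_def conic_weight_def add_nonneg_pos)
  have "n * (1 - (rho y)\<^sup>2) < 0" using n r2 by (simp add: mult_pos_neg)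
  then have t2: "t\<^sup>2 < conic_radius2 (rho y) (sigma y) (cos a1) (cos a2)"
    using conic_shift_radius[of "rho y" "sigma y" "cos a1" "cos a2"] by (simp add: n_def t_def)
  then have "\<bar>t\<bar> < R" unfolding R_def using real_less_rsqrt by fastforce
  then have t: "R - t > 0" by simp
  have R2: "R\<^sup>2 = conic_radius2 (rho y) (sigma y) (cos a1) (cos a2)"
    unfolding R_def using t2 by (smt (verit) real_sqrt_pow2 zero_le_power2)
  \<comment> \<open>The witness is the point whose chart value is the positive real
    \<open>R\<close>: \<open>P\<close> solves \<open>n / P + t = R\<close>, and \<open>M\<close>,
    the intended \<open>y1 - y2\<close>, makes the imaginary part vanish.\<close>
  define P where "P = n / (R - t)"
  define M where "M = - sigma y * (cos a2 - cos a1) / (1 - rho y)"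
  have PM: "(P + M) / 2 + (P - M) / 2 = P" "(P + M) / 2 - (P - M) / 2 = M"
    by (simp_all add: field_simps)
  have P0: "P > 0" using n t by (simp add: P_def)
  have nP: "n + t * P = R * P" using t by (simp add: P_def field_simps)
  have M0: "(1 - rho y) * M + sigma y * (cos a2 - cos a1) = 0" using y by (simp add: M_def field_simps)
  have "2 * (1 - rho y) * n *
      slice_conic (rho y) (sigma y) (cos a1) (cos a2) ((P + M) / 2) ((P - M) / 2) = 0"
    using conic_circle[of "rho y" "sigma y" "cos a1" "cos a2" "(P + M) / 2" "(P - M) / 2"]
    unfolding PM M0 n_def[symmetric] t_def[symmetric] R2[symmetric] nP by (simp add: power_mult_distrib)
  then have Q: "slice_conic (rho y) (sigma y) (cos a1) (cos a2) ((P + M) / 2) ((P - M) / 2) = 0"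
    using n y by simp
  have "sin a1 \<le> (P + M) / 2 \<and> sin a2 \<le> (P - M) / 2"
    using slice_conic_outer[OF sin_pos(2,3) y(2) _ Q] P0 by (simp add: PM)
  then have "((P + M) / 2, (P - M) / 2, y) \<in> gram_solutions 1 a0 a1 a2 a3"
    using Q y by (simp add: gram_solutions_def rho_def sigma_def)
  then show ?thesis by blast
qed

lemma (in four_angles) hyperbolic_solution:
  "\<exists>y1 y2 y. (y1, y2, y) \<in> gram_solutions 1 a0 a1 a2 a3 \<and> rho y < -1"
proof -
  define y where "y = max (sin a3) (4 / sin a0)"
  have "sin a0 * y \<ge> 4" using sin_pos by (simp add: y_def max_def field_simps)
  moreover have "cos a0 * cos a3 \<le> 1"
    using abs_cos_le_one[of a0] abs_cos_le_one[of a3]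
    by (metis abs_ge_zero abs_le_D1 abs_mult mult_le_one)
  ultimately have "rho y < -1" by (simp add: rho_def)
  moreover have "sin a3 \<le> y" by (simp add: y_def)
  ultimately show ?thesis using outer_solution by blast
qed

section \<open>All quadruples of angles by symmetry\<close>

lemma gram_solutions_homeomorphic_swap13:
  "gram_solutions 1 a0 a1 a2 a3 homeomorphic gram_solutions 1 a0 a3 a2 a1"
proof -
  have "homeomorphism (gram_solutions 1 a0 a1 a2 a3) (gram_solutions 1 a0 a3 a2 a1)
     (\<lambda>(x, y, z). (z, y, x)) (\<lambda>(x, y, z). (z, y, x))"
    using gram_solutions_swap13[of 1 _ _ _ a0 a1 a2 a3] gram_solutions_swap13[of 1 _ _ _ a0 a3 a2 a1]
    by (intro homeomorphismI) (auto simp: case_prod_unfold intro!: continuous_intros)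
  then show ?thesis by (auto simp: homeomorphic_def)
qed

lemma gram_solutions_homeomorphic_swap12:
  "gram_solutions 1 a0 a1 a2 a3 homeomorphic gram_solutions 1 a0 a2 a1 a3"
proof -
  have "homeomorphism (gram_solutions 1 a0 a1 a2 a3) (gram_solutions 1 a0 a2 a1 a3)
     (\<lambda>(x, y, z). (y, x, z)) (\<lambda>(x, y, z). (y, x, z))"
    using gram_solutions_swap12[of _ _ _ 1 a0 a1 a2 a3] gram_solutions_swap12[of _ _ _ 1 a0 a2 a1 a3]
    by (intro homeomorphismI) (auto simp: case_prod_unfold intro!: continuous_intros)
  then show ?thesis by (auto simp: homeomorphic_def)
qed

text \<open>With \<open>y\<^sub>j = cosh d\<^sub>j\<close> the equation says that one of the \<open>d\<^sub>j\<close> is the sum of the other two.\<close>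
lemma gram_solutions_right_angles:
  "gram_solutions 1 (pi/2) (pi/2) (pi/2) (pi/2) homeomorphic (UNIV :: complex set)"
proof -
  let ?G = "gram_solutions 1 (pi/2) (pi/2) (pi/2) (pi/2)"
  have G: "(x, y, z) \<in> ?G \<longleftrightarrow> 1 \<le> x \<and> 1 \<le> y \<and> 1 \<le> z \<and> x\<^sup>2 + y\<^sup>2 + z\<^sup>2 - 2 * x * y * z = 1" for x y z
    by (auto simp: gram_solutions_def slice_conic_def algebra_simps)
  \<comment> \<open>If \<open>X\<close>, \<open>Y\<close>, \<open>Z\<close> are the arguments of the
    hyperbolic cosines and one of them is the sum of the other two, then \<open>X - Z\<close> and
    \<open>Y - Z\<close> determine \<open>Z\<close>. With \<open>z\<close> having these differences
    as real and imaginary part, \<open>Z\<close> is \<open>- Re z - Im z\<close>,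
    \<open>Re z - Im z\<close> or \<open>Im z - Re z\<close>; \<open>C z\<close> is the one that
    makes all three nonnegative.\<close>
  define C where "C z = 2 * max 0 (max (Re z) (Im z)) - Re z - Im z" for z
  define f where "f z = (cosh (C z + Re z), cosh (C z + Im z), cosh (C z))" for z
  define g :: "real \<times> real \<times> real \<Rightarrow> complex"
    where "g = (\<lambda>(x, y, z). Complex (arcosh x - arcosh z) (arcosh y - arcosh z))"
  have sum: "(cosh A)\<^sup>2 + (cosh B)\<^sup>2 + (cosh D)\<^sup>2 - 2 * cosh A * cosh B * cosh D = 1"
    if "D = A + B \<or> A = B + D \<or> B = A + D" for A B D :: real
  proof -
    have *: "(cosh A)\<^sup>2 + (cosh B)\<^sup>2 + (cosh D)\<^sup>2 - 2 * cosh A * cosh B * cosh D = 1"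
      if "D = A + B" for A B D :: real
      using cosh_square_eq[of A] cosh_square_eq[of B] unfolding that cosh_add by algebra
    show ?thesis
      using that *[of D A B] *[of A B D] *[of B A D] by (elim disjE) (simp_all add: algebra_simps)
  qed
  have C: "C z \<ge> 0" "C z + Re z \<ge> 0" "C z + Im z \<ge> 0" for z by (auto simp: C_def)
  have fG: "f z \<in> ?G" for z
  proof -
    have "C z = (C z + Re z) + (C z + Im z) \<or> C z + Re z = (C z + Im z) + C z \<or>
       C z + Im z = (C z + Re z) + C z"
      by (auto simp: C_def max_def)
    from sum[OF this]
    have "(cosh (C z + Re z))\<^sup>2 + (cosh (C z + Im z))\<^sup>2 + (cosh (C z))\<^sup>2
        - 2 * cosh (C z + Re z) * cosh (C z + Im z) * cosh (C z) = 1" .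
    then show ?thesis by (simp add: f_def G cosh_real_ge_1)
  qed
  have gf: "g (f z) = z" for z
    using C[of z] by (simp add: f_def g_def arcosh_cosh_real)
  have fg: "f (g p) = p" if "p \<in> ?G" for p
  proof -
    obtain x y z where p: "p = (x, y, z)" by (cases p)
    define X Y Z where "X = arcosh x" and "Y = arcosh y" and "Z = arcosh z"
    have G': "1 \<le> x" "1 \<le> y" "1 \<le> z" "x\<^sup>2 + y\<^sup>2 + z\<^sup>2 - 2 * x * y * z = 1"
      using that by (auto simp: G p)
    have xyz: "x = cosh X" "y = cosh Y" "z = cosh Z" and pos: "X \<ge> 0" "Y \<ge> 0" "Z \<ge> 0"
      using G' by (auto simp: X_def Y_def Z_def cosh_arcosh_real)
    have "(cosh Z - cosh X * cosh Y)\<^sup>2 = (sinh X * sinh Y)\<^sup>2"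
      using G'(4) cosh_square_eq[of X] cosh_square_eq[of Y] unfolding xyz by algebra
    then have "cosh Z = cosh (X + Y) \<or> cosh Z = cosh (X - Y)"
      by (auto simp: power2_eq_iff cosh_add cosh_diff)
    then have "cosh Z = cosh (X + Y) \<or> cosh Z = cosh \<bar>X - Y\<bar>" by simp
    then have "Z = X + Y \<or> Z = \<bar>X - Y\<bar>"
      using pos by (metis abs_ge_zero add_nonneg_nonneg arcosh_cosh_real)
    then have "C (Complex (X - Z) (Y - Z)) = Z" using pos by (auto simp: C_def max_def abs_if)
    moreover have "g p = Complex (X - Z) (Y - Z)" by (simp add: p g_def X_def Y_def Z_def)
    ultimately show ?thesis by (simp add: f_def p xyz)
  qed
  have "homeomorphism UNIV ?G f g"
  proof (rule homeomorphismI)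
    show "continuous_on UNIV f" unfolding f_def C_def by (intro continuous_intros)
    show "continuous_on ?G g" unfolding g_def case_prod_unfold
      by (intro continuous_on_Complex continuous_on_diff
          continuous_on_compose2[OF continuous_on_arcosh[OF order_refl]] continuous_intros)
        (auto simp: G)
  qed (use fG gf fg in auto)
  then show ?thesis using homeomorphic_def homeomorphic_sym by blast
qed

text \<open>Reflection settles a pairing of the indices unless both of its sums equal
  \<open>pi\<close>. If that happens for all three pairings, every angle is
  \<open>pi/2\<close>.\<close>

lemma gram_solutions_plane:
  assumes "four_angles a0 a1 a2 a3"
  shows "gram_solutions 1 a0 a1 a2 a3 homeomorphic (UNIV :: complex set)"
proof -
  have base: "gram_solutions 1 a0 b1 b2 b3 homeomorphic (UNIV :: complex set)"
    if f: "four_angles a0 b1 b2 b3" and ne: "\<not> (a0 + b3 = pi \<and> b1 + b2 = pi)" for b1 b2 b3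
  proof (cases "a0 + b3 < pi \<or> a0 + b3 = pi \<and> b1 + b2 < pi")
    case True
    then interpret plane_angles a0 b1 b2 b3
      using f by (simp add: plane_angles_def plane_angles_axioms_def)
    show ?thesis by (rule gram_solutions_plane)
  next
    case False
    interpret plane_angles "pi - a0" "pi - b1" "pi - b2" "pi - b3"
      using f ne False by (auto simp: plane_angles_def plane_angles_axioms_def four_angles_def)
    show ?thesis using gram_solutions_plane by (simp only: gram_solutions_reflect)
  qed
  have f: "four_angles a0 a3 a2 a1" "four_angles a0 a3 a1 a2" using assms by (auto simp: four_angles_def)
  consider "\<not> (a0 + a3 = pi \<and> a1 + a2 = pi)" | "\<not> (a0 + a1 = pi \<and> a3 + a2 = pi)"
    | "\<not> (a0 + a2 = pi \<and> a3 + a1 = pi)" | "a0 = pi/2" "a1 = pi/2" "a2 = pi/2" "a3 = pi/2"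
    by argo
  then show ?thesis
  proof cases
    case 1 then show ?thesis using base assms by blast
  next
    case 2
    then show ?thesis using base[OF f(1)] gram_solutions_homeomorphic_swap13 homeomorphic_trans by blast
  next
    case 3
    then show ?thesis
      using base[OF f(2)] gram_solutions_homeomorphic_swap13[of a0 a2 a1 a3]
        gram_solutions_homeomorphic_swap12[of a0 a1 a2 a3] homeomorphic_trans by blast
  next
    case 4
    show ?thesis unfolding 4 by (rule gram_solutions_right_angles)
  qed
qed

section \<open>Bounds and emptiness for the sign -1\<close>

lemma (in four_angles) gram_solutions_minus_rho:
  assumes "(y1, y2, y) \<in> gram_solutions (- 1) a0 a1 a2 a3"
  shows "- cos (a1 + a2) \<le> rho y" "rho y \<le> cos (a0 + a3)"
proof -
  have y: "sin a1 \<le> y1" "sin a2 \<le> y2" "sin a3 \<le> y"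
    and Q: "slice_conic (- rho y) (- sigma y) (cos a1) (cos a2) y1 y2 = 0"
    using assms by (auto simp: gram_solutions_def rho_def sigma_def)
  show "- cos (a1 + a2) \<le> rho y" using slice_conic_bound[OF y(1,2) sin_pos(2,3) Q] by simp
  show "rho y \<le> cos (a0 + a3)" using rho_le y by simp
qed

lemma (in four_angles) gram_solutions_minus_abs_rho:
  assumes "(y1, y2, y) \<in> gram_solutions (- 1) a0 a1 a2 a3"
  shows "\<bar>rho y\<bar> < 1"
  using gram_solutions_minus_rho[OF assms] cos_lt_1 by linarith

text \<open>A solution needs \<open>cos A + cos B \<ge> 0\<close> for the sums \<open>A\<close>,
  \<open>B\<close> of each pairing of the angles. As \<open>pi < A + B < 3 pi\<close>, the product
  formula makes this negative once \<open>|A - B| < pi\<close>. Some pairing qualifies: of two such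
  differences \<open>A - B\<close>, the sum and the difference are twice a difference of two angles,
  hence below \<open>2 pi\<close> in absolute value, so both cannot reach \<open>pi\<close>.\<close>

lemma gram_solutions_minus_empty:
  assumes f: "four_angles a0 a1 a2 a3"
    and S: "pi < a0 + a1 + a2 + a3" "a0 + a1 + a2 + a3 < 3 * pi"
  shows "gram_solutions (- 1) a0 a1 a2 a3 = {}"
proof -
  have base: "p \<notin> gram_solutions (- 1) a0 b1 b2 b3"
    if f: "four_angles a0 b1 b2 b3" and S: "pi < a0 + b3 + (b1 + b2)" "a0 + b3 + (b1 + b2) < 3 * pi"
      and d: "\<bar>a0 + b3 - (b1 + b2)\<bar> < pi" for p b1 b2 b3
  proof -
    define A B where "A = a0 + b3" and "B = b1 + b2"
    have AB: "pi < A + B" "A + B < 3 * pi" "A - B < pi" "B - A < pi"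
      using S d unfolding A_def B_def by linarith+
    have "cos ((A + B) / 2 - pi) > 0" "cos ((A - B) / 2) > 0"
      by (rule cos_gt_zero_pi; use AB in \<open>simp add: field_simps\<close>)+
    moreover have "cos A + cos B = 2 * cos ((A + B) / 2) * cos ((A - B) / 2)"
      by (rule cos_plus_cos)
    ultimately have "cos A + cos B < 0" by (simp add: mult_neg_pos)
    then show ?thesis
      using four_angles.gram_solutions_minus_rho[OF f] unfolding A_def[symmetric] B_def[symmetric]
      by (cases p) fastforce
  qed
  have f': "four_angles a0 a3 a2 a1" "four_angles a0 a3 a1 a2" using f by (auto simp: four_angles_def)
  have "\<bar>a0 + a3 - (a1 + a2)\<bar> < pi \<or> \<bar>a0 + a1 - (a3 + a2)\<bar> < pi \<or> \<bar>a0 + a2 - (a3 + a1)\<bar> < pi"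
    using f unfolding four_angles_def by linarith
  then show ?thesis
  proof (elim disjE)
    assume "\<bar>a0 + a3 - (a1 + a2)\<bar> < pi"
    then show ?thesis using base[OF f] S by auto
  next
    assume "\<bar>a0 + a1 - (a3 + a2)\<bar> < pi"
    then have "p \<notin> gram_solutions (- 1) a0 a3 a2 a1" for p using base[OF f'(1)] S by auto
    then show ?thesis using gram_solutions_swap13[of "- 1" _ _ _ a0 a1 a2 a3] by auto
  next
    assume "\<bar>a0 + a2 - (a3 + a1)\<bar> < pi"
    then have "p \<notin> gram_solutions (- 1) a0 a3 a1 a2" for p using base[OF f'(2)] S by auto
    then show ?thesis
      using gram_solutions_swap13[of "- 1" _ _ _ a0 a2 a1 a3] gram_solutions_swap12[of _ _ _ "- 1" a0 a1 a2 a3]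
      by auto
  qed
qed

section \<open>The spherical component\<close>

text \<open>For \<open>|r| < 1\<close> the slice is an ellipse.\<close>
lemma conic_ellipse:
  "((1 - r\<^sup>2) * y2 + s * (c1 - r * c2))\<^sup>2 + (1 - r\<^sup>2) * (y1 + r * y2 + s * c2)\<^sup>2
     - (r\<^sup>2 + s\<^sup>2 - 1) * (r\<^sup>2 - 2 * r * c1 * c2 + c1\<^sup>2 + c2\<^sup>2 - 1)
   = (1 - r\<^sup>2) * slice_conic r s c1 c2 y1 y2"
  unfolding slice_conic_def by algebra

text \<open>For this angle sum the two bounds of \<open>gram_solutions_minus_rho\<close> coincide
  and force \<open>y3 = sin a3\<close>; permuting the indices fixes the other heights as
  well.\<close>

lemma gram_solutions_point:
  assumes f: "four_angles a0 a1 a2 a3" and S: "a0 + a1 + a2 + a3 = pi"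
  shows "gram_solutions (- 1) a0 a1 a2 a3 = {(sin a1, sin a2, sin a3)}"
proof -
  have height: "y = sin b3" if "(y1, y2, y) \<in> gram_solutions (- 1) a0 b1 b2 b3"
    and f: "four_angles a0 b1 b2 b3" and S: "a0 + b3 = pi - (b1 + b2)" for y1 y2 y b1 b2 b3
  proof -
    interpret four_angles a0 b1 b2 b3 by fact
    have "cos (a0 + b3) = - cos (b1 + b2)" unfolding S cos_pi_minus ..
    then have "rho y = cos (a0 + b3)" using gram_solutions_minus_rho[OF that(1)] by simp
    then show ?thesis using sin_pos by (simp add: rho_def cos_add)
  qed
  have f': "four_angles a0 a3 a2 a1" "four_angles a0 a3 a1 a2" using f by (auto simp: four_angles_def)
  have "p = (sin a1, sin a2, sin a3)" if "p \<in> gram_solutions (- 1) a0 a1 a2 a3" for p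
  proof -
    obtain y1 y2 y where p: "p = (y1, y2, y)" by (cases p)
    have m: "(y1, y2, y) \<in> gram_solutions (- 1) a0 a1 a2 a3" using that p by simp
    have m1: "(y, y2, y1) \<in> gram_solutions (- 1) a0 a3 a2 a1"
      using m gram_solutions_swap13[of "- 1"] by simp
    have m2: "(y, y1, y2) \<in> gram_solutions (- 1) a0 a3 a1 a2"
      using m gram_solutions_swap13[of "- 1" y2 y1 y a0 a2 a1 a3] gram_solutions_swap12[of y1 y2 y "- 1" a0 a1 a2 a3]
      by simp
    show ?thesis
      using height[OF m f] height[OF m1 f'(1)] height[OF m2 f'(2)] S by (simp add: p)
  qed
  moreover have "(sin a1, sin a2, sin a3) \<in> gram_solutions (- 1) a0 a1 a2 a3"
  proof -
    have 1: "cos (a0 + a3) * cos (a1 + a2) - sin (a0 + a3) * sin (a1 + a2) = -1"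
      using S cos_add[of "a0 + a3" "a1 + a2"] by (simp add: add_ac)
    have "slice_conic (- cos (a0 + a3)) (- sin (a0 + a3)) (cos a1) (cos a2) (sin a1) (sin a2) = 
        2 + 2 * (cos (a0 + a3) * cos (a1 + a2) - sin (a0 + a3) * sin (a1 + a2))"
      unfolding slice_conic_def cos_add[of a1 a2] sin_add[of a1 a2]
      using sin_cos_squared_add[of a1] sin_cos_squared_add[of a2] sin_cos_squared_add[of "a0 + a3"]
      by algebra
    then show ?thesis using 1 by (simp add: gram_solutions_def cos_add sin_add algebra_simps)
  qed
  ultimately show ?thesis by blast
qed

locale sphere_angles = four_angles +
  assumes S: "a0 + a1 + a2 + a3 < pi"
begin

text \<open>The height at which \<open>rho\<close> reaches its lower bound
  \<open>- cos (a1 + a2)\<close>. The numbers \<open>mid\<close> and \<open>half\<close> normalise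
  the range from \<open>sin a3\<close> to \<open>high\<close> to \<open>[-1, 1]\<close>.\<close>

definition high :: real where "high = (cos a0 * cos a3 + cos (a1 + a2)) / sin a0"
definition mid :: real where "mid = (high + sin a3) / 2"
definition half :: real where "half = (high - sin a3) / 2"

lemma high_ge_iff: "y \<le> high \<longleftrightarrow> - cos (a1 + a2) \<le> rho y"
  using sin_pos by (auto simp: high_def rho_def field_simps)

lemma rho_high: "cos (a1 + a2) + rho y = sin a0 * (high - y)"
  using sin_pos by (simp add: high_def rho_def field_simps)

lemma half_pos: "half > 0"
proof -
  have "cos (pi - (a1 + a2)) < cos (a0 + a3)"
    using S angle_bounds by (intro cos_monotone_0_pi) auto
  then have "0 < cos (a1 + a2) + rho (sin a3)"
    unfolding cos_pi_minus by (simp add: rho_def cos_add[of a0 a3])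
  then show ?thesis using sin_pos by (simp add: rho_high half_def zero_less_mult_iff)
qed

lemma abs_rho:
  assumes "sin a3 \<le> y" "y \<le> high"
  shows "\<bar>rho y\<bar> < 1" "(rho y)\<^sup>2 < 1" "sigma y > 0"
proof -
  show *: "\<bar>rho y\<bar> < 1" using rho_lt_1[OF assms(1)] assms(2) cos_lt_1 unfolding high_ge_iff by linarith
  then show "(rho y)\<^sup>2 < 1" by (simp add: abs_square_less_1)
  show "sigma y > 0" using * assms S angle_bounds by (intro sigma_pos) auto
qed

text \<open>Here the bounds on \<open>y1\<close> and \<open>y2\<close> are automatic. By
  \<open>slice_conic_minus\<close> the slice can be read with \<open>sigma y > 0\<close> and with
  the angles \<open>pi - a1\<close> and \<open>pi - a2\<close>, whose sum exceeds \<open>pi\<close>;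
  so the lemmas on inner slices apply to all of it.\<close>

lemma gram_solutions_minus_iff:
  "(y1, y2, y) \<in> gram_solutions (- 1) a0 a1 a2 a3 \<longleftrightarrow> sin a3 \<le> y \<and> y \<le> high \<and>
     slice_conic (- rho y) (- sigma y) (cos a1) (cos a2) y1 y2 = 0"
proof
  assume m: "(y1, y2, y) \<in> gram_solutions (- 1) a0 a1 a2 a3"
  then show "sin a3 \<le> y \<and> y \<le> high \<and>
     slice_conic (- rho y) (- sigma y) (cos a1) (cos a2) y1 y2 = 0"
    using gram_solutions_minus_rho[OF m] unfolding high_ge_iff
    by (auto simp: gram_solutions_def rho_def sigma_def)
next
  assume *: "sin a3 \<le> y \<and> y \<le> high \<and>
     slice_conic (- rho y) (- sigma y) (cos a1) (cos a2) y1 y2 = 0"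
  then have y: "sin a3 \<le> y" "y \<le> high"
    and Q: "slice_conic (- rho y) (- sigma y) (cos a1) (cos a2) y1 y2 = 0" by auto
  interpret refl: four_angles "pi - a0" "pi - a1" "pi - a2" "pi - a3"
    using angle_bounds by unfold_locales auto
  interpret refl': four_angles "pi - a0" "pi - a2" "pi - a1" "pi - a3"
    using angle_bounds by unfold_locales auto
  have Q1: "slice_conic (- rho y) (sigma y) (cos (pi - a1)) (cos (pi - a2)) y1 y2 = 0"
    using Q slice_conic_minus[of "- rho y" "- sigma y" "cos a1" "cos a2" y1 y2] by simp
  then have Q2: "slice_conic (- rho y) (sigma y) (cos (pi - a2)) (cos (pi - a1)) y2 y1 = 0"
    using slice_conic_commute by metis
  have r: "- 1 \<le> - rho y" "- rho y \<le> cos (a1 + a2)" "(- rho y)\<^sup>2 \<le> 1"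
    using abs_rho[OF y] y(2) unfolding high_ge_iff by auto
  have B: "cos (pi - a1 + (pi - a2)) = cos (a1 + a2)" "cos (pi - a2 + (pi - a1)) = cos (a1 + a2)"
    using cos_2pi_minus[of "a1 + a2"] by (simp_all add: algebra_simps)
  have c: "cos (pi - a1) - (- rho y) * cos (pi - a2) < 0" "cos (pi - a2) - (- rho y) * cos (pi - a1) < 0"
    using refl.cos_diff_ge_neg[OF _ r(1)] refl'.cos_diff_ge_neg[OF _ r(1)] r(2) S angle_bounds
    unfolding B by linarith+
  have "sin a1 \<le> y1 \<and> sin a2 \<le> y2"
  proof (cases "y = sin a3")
    case False
    then have W: "(- rho y)\<^sup>2 + (sigma y)\<^sup>2 > 1" using rho_sigma_gt y by simp
    show ?thesis
      using slice_conic_inner[OF r(3) abs_rho(3)[OF y] W c(1) _ Q1]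
        slice_conic_inner[OF r(3) abs_rho(3)[OF y] W c(2) _ Q2] sin_pos by simp
  next
    case True
    have W: "(- rho y)\<^sup>2 + (sigma y)\<^sup>2 = 1" using rho_sigma[of y] True by simp
    have rs: "rho y = cos (a0 + a3)" "sigma y = sin (a0 + a3)"
      by (simp_all add: True rho_def sigma_def cos_add sin_add)
    have *: "sin b \<le> z" if b: "0 < b" "0 < b'" "b + b' = a1 + a2"
      and z: "sin (a0 + a3) * z = cos (a0 + a3) * cos b + cos b'" for b b' z
    proof -
      have "cos (pi - (a0 + a3 + b)) \<le> cos b'"
        using b S angle_bounds by (intro cos_monotone_0_pi_le) auto
      then have "sin (a0 + a3) * sin b \<le> sin (a0 + a3) * z"
        unfolding z cos_pi_minus cos_add[of "a0 + a3" b] by simp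
      moreover have "sin (a0 + a3) > 0" using abs_rho(3)[OF y] rs by simp
      ultimately show ?thesis by simp
    qed
    show ?thesis
      using slice_conic_point[OF W Q1] slice_conic_point[OF W Q2] angle_bounds
        *[of a1 a2 y1] *[of a2 a1 y2] unfolding rs by auto
  qed
  then show "(y1, y2, y) \<in> gram_solutions (- 1) a0 a1 a2 a3"
    using y Q by (simp add: gram_solutions_def rho_def sigma_def)
qed

text \<open>The constant in \<open>conic_ellipse\<close> is the square of this factor, which stays
  positive on the closed range of heights, times \<open>1 - ((y - mid) / half)^2\<close>. Dividing
  by \<open>stretch\<close> therefore yields the equation of the unit sphere, poles
  included.\<close>

definition stretch :: "real \<Rightarrow> real" where
  "stretch y = half * sqrt ((y + sin a3) * sin a0 * (cos (a1 - a2) + rho y))"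

lemma stretch_pos:
  assumes "sin a3 \<le> y" "y \<le> high"
  shows "stretch y > 0"
proof -
  have "cos (a1 + a2) < cos (a1 - a2)" using sin_pos by (simp add: cos_add cos_diff)
  then show ?thesis
    using assms sin_pos half_pos unfolding high_ge_iff
    by (auto simp: stretch_def intro!: mult_pos_pos)
qed

lemma stretch:
  assumes "sin a3 \<le> y" "y \<le> high"
  shows "((rho y)\<^sup>2 + (sigma y)\<^sup>2 - 1) *
      ((rho y)\<^sup>2 + 2 * rho y * cos a1 * cos a2 + (cos a1)\<^sup>2 + (cos a2)\<^sup>2 - 1) =
     (stretch y)\<^sup>2 * (1 - ((y - mid) / half)\<^sup>2)"
proof -
  have 1: "(rho y)\<^sup>2 + 2 * rho y * cos a1 * cos a2 + (cos a1)\<^sup>2 + (cos a2)\<^sup>2 - 1 =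
      (cos (a1 + a2) + rho y) * (cos (a1 - a2) + rho y)"
    unfolding cos_add cos_diff
    using sin_cos_squared_add[of a1] sin_cos_squared_add[of a2] by algebra
  have "cos (a1 + a2) < cos (a1 - a2)" using sin_pos by (simp add: cos_add cos_diff)
  then have "(stretch y)\<^sup>2 = half\<^sup>2 * ((y + sin a3) * sin a0 * (cos (a1 - a2) + rho y))"
    using assms sin_pos unfolding stretch_def high_ge_iff by (simp add: power_mult_distrib)
  moreover have "half\<^sup>2 * (1 - ((y - mid) / half)\<^sup>2) = half\<^sup>2 - (y - mid)\<^sup>2"
    using half_pos by (simp add: power_divide right_diff_distrib)
  moreover have "half\<^sup>2 - (y - mid)\<^sup>2 = (y - sin a3) * (high - y)"
    unfolding half_def mid_def by (simp add: power2_eq_square field_simps)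
  ultimately have "(stretch y)\<^sup>2 * (1 - ((y - mid) / half)\<^sup>2) =
      ((y + sin a3) * sin a0 * (cos (a1 - a2) + rho y)) * ((y - sin a3) * (high - y))"
    by (simp add: mult_ac)
  then show ?thesis unfolding 1 rho_sigma rho_high by (simp add: power2_eq_square algebra_simps)
qed

definition centre :: "real \<Rightarrow> real" where "centre y = sigma y * (cos a1 + rho y * cos a2)"

text \<open>The two squares of \<open>conic_ellipse\<close>, taken at \<open>- rho y\<close> and
  \<open>- sigma y\<close> and scaled by \<open>stretch\<close>, together with the normalised
  height.\<close>

definition globe :: "real \<times> real \<times> real \<Rightarrow> real \<times> real \<times> real" where
  "globe = (\<lambda>(y1, y2, y). (((1 - (rho y)\<^sup>2) * y2 - centre y) / stretch y,
     sqrt (1 - (rho y)\<^sup>2) * (y1 - rho y * y2 - sigma y * cos a2) / stretch y, (y - mid) / half))"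

definition unglobe :: "real \<times> real \<times> real \<Rightarrow> real \<times> real \<times> real" where
  "unglobe = (\<lambda>(u, v, w). let y = mid + half * w;
     y2 = (u * stretch y + centre y) / (1 - (rho y)\<^sup>2)
     in (v * stretch y / sqrt (1 - (rho y)\<^sup>2) + rho y * y2 + sigma y * cos a2, y2, y))"

lemma mem_sphere_triple: "(u, v, w) \<in> sphere (0 :: real \<times> real \<times> real) 1 \<longleftrightarrow> u\<^sup>2 + v\<^sup>2 + w\<^sup>2 = 1"
  by (simp add: norm_Pair add_nonneg_nonneg add.assoc)

lemma slice_globe:
  assumes y: "sin a3 \<le> y" "y \<le> high" and g: "globe (y1, y2, y) = (u, v, w)"
  shows "(1 - (rho y)\<^sup>2) * slice_conic (- rho y) (- sigma y) (cos a1) (cos a2) y1 y2 =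
     (stretch y)\<^sup>2 * (u\<^sup>2 + v\<^sup>2 + w\<^sup>2 - 1)"
proof -
  have s: "stretch y \<noteq> 0" using stretch_pos[OF y] by simp
  have r: "1 - (rho y)\<^sup>2 > 0" using abs_rho(2)[OF y] by simp
  have u: "(1 - (rho y)\<^sup>2) * y2 - centre y = stretch y * u"
    and v: "sqrt (1 - (rho y)\<^sup>2) * (y1 - rho y * y2 - sigma y * cos a2) = stretch y * v"
    and w: "(y - mid) / half = w"
    using g s by (auto simp: globe_def)
  have v2: "(1 - (rho y)\<^sup>2) * (y1 - rho y * y2 - sigma y * cos a2)\<^sup>2 = (stretch y * v)\<^sup>2"
    unfolding v[symmetric] using r by (simp add: power_mult_distrib)
  show ?thesis
    using conic_ellipse[of "- rho y" y2 "- sigma y" "cos a1" "cos a2" y1] u v2 stretch[OF y]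
    unfolding w centre_def by algebra
qed

lemma homeomorphism_globe:
  "homeomorphism (gram_solutions (- 1) a0 a1 a2 a3) (sphere 0 1) globe unglobe"
proof -
  let ?G = "gram_solutions (- 1) a0 a1 a2 a3"
  have range: "sin a3 \<le> y \<and> y \<le> high" if "(y1, y2, y) \<in> ?G" for y1 y2 y
    using that by (simp add: gram_solutions_minus_iff)
  have w: "sin a3 \<le> mid + half * w \<and> mid + half * w \<le> high" if "u\<^sup>2 + v\<^sup>2 + w\<^sup>2 = 1" for u v w :: real
  proof -
    have "w\<^sup>2 \<le> 1" using that by (smt (verit) zero_le_power2)
    then have "\<bar>w\<bar> \<le> 1" by (simp add: abs_square_le_1)
    then have "w \<le> 1" "- 1 \<le> w" by auto
    then have "half * w \<le> half * 1" "half * (-1) \<le> half * w"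
      using half_pos mult_left_mono[of w 1 half] mult_left_mono[of "- 1" w half] by simp_all
    then show ?thesis by (simp add: half_def mid_def field_simps)
  qed
  have gu: "globe (unglobe p) = p \<and> unglobe p \<in> ?G" if "p \<in> sphere 0 1" for p
  proof -
    obtain u v t where p: "p = (u, v, t)" by (cases p)
    have uvt: "u\<^sup>2 + v\<^sup>2 + t\<^sup>2 = 1" using that unfolding p mem_sphere_triple .
    define y where "y = mid + half * t"
    have y: "sin a3 \<le> y" "y \<le> high" using w[OF uvt] by (auto simp: y_def)
    define y2 where "y2 = (u * stretch y + centre y) / (1 - (rho y)\<^sup>2)"
    define y1 where "y1 = v * stretch y / sqrt (1 - (rho y)\<^sup>2) + rho y * y2 + sigma y * cos a2"
    have un: "unglobe p = (y1, y2, y)" by (simp add: p unglobe_def y_def y2_def y1_def Let_def)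
    have s: "stretch y > 0" using stretch_pos[OF y] .
    have r: "1 - (rho y)\<^sup>2 > 0" using abs_rho(2)[OF y] by simp
    have g: "globe (y1, y2, y) = (u, v, t)"
      unfolding globe_def using s r half_pos by (simp add: y1_def) (simp add: y2_def y_def)
    then have "slice_conic (- rho y) (- sigma y) (cos a1) (cos a2) y1 y2 = 0"
      using slice_globe[OF y g] uvt r by simp
    then show ?thesis unfolding un using g y by (simp add: gram_solutions_minus_iff p)
  qed
  have ug: "unglobe (globe p) = p \<and> globe p \<in> sphere 0 1" if "p \<in> ?G" for p
  proof -
    obtain y1 y2 y where p: "p = (y1, y2, y)" by (cases p)
    obtain u v t where g: "globe (y1, y2, y) = (u, v, t)" by (cases "globe (y1, y2, y)")
    have y: "sin a3 \<le> y" "y \<le> high" using that range p by auto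
    have s: "stretch y > 0" using stretch_pos[OF y] .
    have r: "1 - (rho y)\<^sup>2 > 0" using abs_rho(2)[OF y] by simp
    have "u\<^sup>2 + v\<^sup>2 + t\<^sup>2 = 1"
      using slice_globe[OF y g] that s unfolding p gram_solutions_minus_iff by simp
    then have 1: "globe p \<in> sphere 0 1" unfolding p g mem_sphere_triple .
    have "mid + half * ((y - mid) / half) = y" using half_pos by simp
    then have "unglobe (globe (y1, y2, y)) = (y1, y2, y)"
      unfolding globe_def unglobe_def prod.case Let_def using s r by simp
    then show ?thesis using 1 p by simp
  qed
  have rng: "sin a3 \<le> snd (snd p)" "snd (snd p) \<le> high" if "p \<in> ?G" for p
    using range that by (cases p; auto)+
  have cs: "continuous_on T (\<lambda>x. stretch (f x))" if "continuous_on T f" for T and f :: "real \<times> real \<times> real \<Rightarrow> real"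
    unfolding stretch_def rho_def using that by (intro continuous_intros)
  show ?thesis
  proof (rule homeomorphismI)
    have "stretch (snd (snd p)) \<noteq> 0" if "p \<in> ?G" for p using stretch_pos rng[OF that] by fastforce
    then show "continuous_on ?G globe"
      unfolding globe_def case_prod_unfold centre_def rho_def sigma_def
      using half_pos by (intro continuous_intros cs) auto
    have "1 - (rho (mid + half * snd (snd p)))\<^sup>2 > 0" if "p \<in> sphere 0 1" for p :: "real \<times> real \<times> real"
    proof -
      obtain u v t where p: "p = (u, v, t)" by (cases p)
      show ?thesis using abs_rho(2)[of "mid + half * t"] w[of u v t] that unfolding p mem_sphere_triple by simp
    qed
    then have r: "1 - (rho (mid + half * snd (snd p)))\<^sup>2 \<noteq> 0" if "p \<in> sphere 0 1" for p :: "real \<times> real \<times> real"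
      using that by fastforce
    then have "sqrt (1 - (rho (mid + half * snd (snd p)))\<^sup>2) \<noteq> 0" if "p \<in> sphere 0 1" for p :: "real \<times> real \<times> real"
      using that by simp
    then show "continuous_on (sphere 0 1) unglobe"
      using r unfolding unglobe_def case_prod_unfold Let_def centre_def rho_def sigma_def
      by (intro continuous_intros cs) auto
  qed (use gu ug in auto)
qed

end

lemma gram_solutions_sphere:
  assumes f: "four_angles a0 a1 a2 a3"
    and S: "a0 + a1 + a2 + a3 < pi \<or> 3 * pi < a0 + a1 + a2 + a3"
  shows "gram_solutions (- 1) a0 a1 a2 a3 homeomorphic sphere (0 :: real ^ 3) 1"
proof -
  have sph: "gram_solutions (- 1) b0 b1 b2 b3 homeomorphic sphere (0 :: real ^ 3) 1"
    if "sphere_angles b0 b1 b2 b3" for b0 b1 b2 b3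
  proof -
    have "gram_solutions (- 1) b0 b1 b2 b3 homeomorphic sphere (0 :: real \<times> real \<times> real) 1"
      using sphere_angles.homeomorphism_globe[OF that] by (auto simp: homeomorphic_def)
    also have "sphere (0 :: real \<times> real \<times> real) 1 homeomorphic sphere (0 :: real ^ 3) 1"
      by (intro homeomorphic_spheres_gen) auto
    finally show ?thesis .
  qed
  show ?thesis
  proof (cases "a0 + a1 + a2 + a3 < pi")
    case True
    then show ?thesis using f by (intro sph) (simp add: sphere_angles_def sphere_angles_axioms_def)
  next
    case False
    then have "sphere_angles (pi - a0) (pi - a1) (pi - a2) (pi - a3)"
      using f S by (auto simp: sphere_angles_def sphere_angles_axioms_def four_angles_def)
    then show ?thesis using sph by (metis gram_solutions_reflect)
  qed
qed

lemma gram_solutions_singleton: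
  assumes f: "four_angles a0 a1 a2 a3"
    and S: "a0 + a1 + a2 + a3 = pi \<or> a0 + a1 + a2 + a3 = 3 * pi"
  shows "gram_solutions (- 1) a0 a1 a2 a3 = {(sin a1, sin a2, sin a3)}"
proof (cases "a0 + a1 + a2 + a3 = pi")
  case True
  then show ?thesis using gram_solutions_point f by blast
next
  case False
  then have "four_angles (pi - a0) (pi - a1) (pi - a2) (pi - a3)"
    "pi - a0 + (pi - a1) + (pi - a2) + (pi - a3) = pi"
    using f S by (auto simp: four_angles_def)
  then show ?thesis using gram_solutions_point by (metis gram_solutions_reflect sin_pi_minus)
qed

section \<open>Vectors of the hermitian plane\<close>

locale hermitian_plane =
  fixes h :: "cvec \<Rightarrow> cvec \<Rightarrow> complex" and e f :: cvec
  assumes herm: "hermitian_form h" and ee: "h e e = 1" and ff: "h f f = -1" and ef: "h e f = 0"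
begin

lemmas h_simps = hermitian_form_simps[OF herm]

lemma h_cnj: "h y x = cnj (h x y)"
  using herm unfolding hermitian_form_def by blast

lemma fe: "h f e = 0"
  using h_cnj[of f e] ef by simp

lemma h_minus: "h (x - y) z = h x z - h y z" "h x (y - z) = h x y - h x z"
proof -
  have *: "h (- x) z = - h x z" for x z using h_simps(2)[of "-1" x z] by simp
  show 1: "h (x - y) z = h x z - h y z" for x y z using h_simps(1)[of x "- y" z] by (simp add: *)
  show "h x (y - z) = h x y - h x z" using 1[of y z x] by (metis h_cnj complex_cnj_diff)
qed

lemma h_zero: "h 0 z = 0" "h z 0 = 0"
  using h_minus(1)[of 0 0 z] h_minus(2)[of z 0 0] by simp_all

lemma h_self_real: "h x x = of_real (Re (h x x))"
  using h_cnj[of x x] by (metis Reals_cnj_iff of_real_Re)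

lemma expand: "x = h x e *s e - h x f *s f"
proof -
  have ind: "vec.independent {e, f}"
  proof (rule vec.independent_if_scalars_zero)
    fix g :: "cvec \<Rightarrow> complex" and x assume s: "(\<Sum>x\<in>{e, f}. g x *s x) = 0" and x: "x \<in> {e, f}"
    have "e \<noteq> f" using ee ef by auto
    then have s: "g e *s e + g f *s f = 0" using s by simp
    have "h (g e *s e + g f *s f) e = g e" "h (g e *s e + g f *s f) f = - g f"
      by (simp_all add: h_simps ee ff ef fe)
    then have "g e = 0" "g f = 0" unfolding s h_zero by simp_all
    then show "g x = 0" using x by auto
  qed simp
  have "e \<noteq> f" using ee ef by auto
  then have "card {e, f} = vec.dim (UNIV :: cvec set)" by (simp add: card_cart_basis)
  then have "UNIV \<subseteq> vec.span {e, f}"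
    using vec.card_ge_dim_independent[OF _ ind, of UNIV] by simp
  then have "x \<in> vec.span {e, f}" by blast
  then obtain a b where "x - a *s e = b *s f"
    by (auto simp: vec.span_breakdown_eq vec.span_singleton)
  then have x: "x = a *s e + b *s f" by (simp add: algebra_simps)
  have "h x e = a" "h x f = - b" by (simp_all add: x h_simps ee ff ef fe)
  then show ?thesis by (simp add: x vec_eq_iff)
qed

lemma h_coords: "h x y = h x e * cnj (h y e) - h x f * cnj (h y f)"
  using expand[of x] h_minus(1)[of "h x e *s e" "h x f *s f" y]
  by (simp add: h_simps h_cnj[of e y] h_cnj[of f y])

lemma h_self: "Re (h x x) = (cmod (h x e))\<^sup>2 - (cmod (h x f))\<^sup>2"
  by (subst h_coords, simp add: cmod_power2) (simp add: power2_eq_square)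

lemma eq_iff_coords: "x = y \<longleftrightarrow> h x e = h y e \<and> h x f = h y f"
  using expand[of x] expand[of y] by metis

lemma orthonormal_completion:
  assumes "h p p = 1"
  obtains q where "hermitian_plane h p q"
proof -
  \<comment> \<open>The coordinates of \<open>p\<close>, swapped and conjugated, give a vector
    orthogonal to \<open>p\<close> and of opposite norm.\<close>
  define q where "q = cnj (h p f) *s e - cnj (h p e) *s f"
  have q: "h q e = cnj (h p f)" "h q f = cnj (h p e)"
    by (simp_all add: q_def h_minus h_simps ee ff ef fe)
  have "h p p = h p e * cnj (h p e) - h p f * cnj (h p f)" by (rule h_coords)
  then have "h q q = -1" using assms by (subst h_coords) (simp add: q, algebra)
  moreover have "h p q = 0" by (subst h_coords) (simp add: q)
  ultimately show thesis using that assms herm by (simp add: hermitian_plane_def)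
qed

text \<open>Up to sign the determinant in the basis \<open>e\<close>, \<open>f\<close>. Its
  invariance is the part of membership in SU that \<open>h\<close> does not detect.\<close>

definition wedge :: "cvec \<Rightarrow> cvec \<Rightarrow> complex" where
  "wedge x y = h x e * h y f - h x f * h y e"

text \<open>Three vectors of a plane are dependent, so their 3x3 Gram determinant vanishes.\<close>

lemma gram_det:
  "h x x * h y y * h z z + h y x * h z y * h x z + cnj (h y x * h z y * h x z) =
   h x x * (h z y * cnj (h z y)) + h y y * (h x z * cnj (h x z)) + h z z * (h y x * cnj (h y x))"
  unfolding h_coords[of x x] h_coords[of y y] h_coords[of z z] h_coords[of y x] h_coords[of z y] h_coords[of x z]
  by (simp add: algebra_simps)

text \<open>The inequality is reversed because the signature is (1,1): the excess is
  \<open>(cmod (wedge x y))\<^sup>2\<close>.\<close>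

lemma cauchy_schwarz:
  assumes "Re (h x x) > 0" "Re (h y y) > 0"
  shows "Re (h x x) * Re (h y y) \<le> (cmod (h x y))\<^sup>2"
proof -
  have "h x y * cnj (h x y) - h x x * h y y = wedge x y * cnj (wedge x y)"
    unfolding h_coords[of x y] h_coords[of x x] h_coords[of y y] wedge_def by (simp add: algebra_simps)
  then have "complex_of_real ((cmod (h x y))\<^sup>2 - Re (h x x) * Re (h y y)) = of_real ((cmod (wedge x y))\<^sup>2)"
    unfolding of_real_diff of_real_mult h_self_real[symmetric] complex_norm_square .
  then have "(cmod (h x y))\<^sup>2 - Re (h x x) * Re (h y y) = (cmod (wedge x y))\<^sup>2"
    using of_real_eq_iff by blast
  then show ?thesis by (smt (verit) zero_le_power2)
qed

lemma h_nonzero: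
  assumes "Re (h x x) > 0" "Re (h y y) > 0"
  shows "h x y \<noteq> 0"
proof
  assume "h x y = 0"
  then have "Re (h x x) * Re (h y y) \<le> 0" using cauchy_schwarz[OF assms] by simp
  then show False using mult_pos_pos[OF assms] by linarith
qed

lemma h_self_nonzero: "Re (h x x) > 0 \<Longrightarrow> h x x \<noteq> 0" "Re (h x x) > 0 \<Longrightarrow> x \<noteq> 0"
  by (auto simp: h_zero)

lemma unit_cnj: "cmod k = 1 \<Longrightarrow> k * cnj k = 1"
  by (simp add: complex_norm_square[symmetric])

lemma h_rot:
  assumes "Re (h c c) > 0" "cmod k = 1"
  shows "h (rot h c k x) (rot h c k y) = h x y"
proof -
  define a b where "a = h x c / h c c" and "b = h y c / h c c"
  have k: "k * cnj k = 1" using unit_cnj assms by simp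
  have a: "h x c = a * h c c" "h c x = cnj a * h c c" and b: "h y c = b * h c c" "h c y = cnj b * h c c"
    using h_self_nonzero assms h_cnj[of c x] h_cnj[of c y] h_cnj[of c c] by (auto simp: a_def b_def)
  have "h (rot h c k x) (rot h c k y) =
    (cnj k - k) * a * cnj ((cnj k - k) * b) * h c c + (cnj k - k) * a * cnj k * h c y
     + k * cnj ((cnj k - k) * b) * h x c + k * cnj k * h x y"
    unfolding rot_def a_def[symmetric] b_def[symmetric] h_simps by (simp add: algebra_simps)
  then show ?thesis
    using k unfolding a b complex_cnj_mult complex_cnj_diff complex_cnj_cnj by algebra
qed

text \<open>The rotation multiplies \<open>c\<close> by \<open>cnj k\<close> and the orthogonal
  complement of \<open>c\<close> by \<open>k\<close>, so its determinant is 1.\<close>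

lemma wedge_rot:
  assumes "Re (h c c) > 0" "cmod k = 1"
  shows "wedge (rot h c k x) (rot h c k y) = wedge x y"
proof -
  have k: "k * cnj k = 1" using unit_cnj assms by simp
  have cc: "h c c \<noteq> 0" using h_self_nonzero assms by simp
  have "wedge (rot h c k x) (rot h c k y) * h c c =
     k\<^sup>2 * wedge x y * h c c + k * (cnj k - k) * (h x c * wedge c y + h y c * wedge x c)"
    using cc by (simp add: rot_def wedge_def h_simps field_simps power2_eq_square)
  also have "h x c * wedge c y + h y c * wedge x c = h c c * wedge x y"
    unfolding h_coords[of x c] h_coords[of y c] h_coords[of c c] wedge_def by (simp add: algebra_simps)
  also have "k\<^sup>2 * wedge x y * h c c + k * (cnj k - k) * (h c c * wedge x y) = wedge x y * h c c"
    using k by algebra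
  finally show ?thesis using cc by simp
qed

lemma rot_self: "Re (h c c) > 0 \<Longrightarrow> rot h c k c = cnj k *s c"
  using h_self_nonzero by (simp add: rot_def vec_eq_iff algebra_simps)

lemma rot_scale: "rot h c k (s *s x) = s *s rot h c k x"
  by (simp add: rot_def h_simps vec_eq_iff algebra_simps)

lemma h_rot_self:
  assumes "Re (h c c) > 0" "Re (h x x) > 0" "cmod k = 1"
  shows "h (rot h c k x) x = (of_real (ta h c x) * (cnj k - k) + k) * h x x"
    "ta h c (rot h c k x) = ta h c x" "ta h c x \<ge> 1"
proof -
  have "h c x * h x c = of_real ((cmod (h x c))\<^sup>2)"
    unfolding h_cnj[of c x] complex_norm_square by (rule mult.commute)
  then have cx: "h c x * h x c / (h c c * h x x) = of_real ((cmod (h x c))\<^sup>2 / (Re (h c c) * Re (h x x)))"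
    unfolding of_real_divide of_real_mult h_self_real[symmetric] by simp
  then have ta: "of_real (ta h c x) = h c x * h x c / (h c c * h x x)"
    "ta h c x = (cmod (h x c))\<^sup>2 / (Re (h c c) * Re (h x x))"
    by (simp_all add: ta_def)
  show "ta h c x \<ge> 1"
    using cauchy_schwarz[of x c] assms unfolding ta(2) by (simp add: mult.commute)
  have nz: "h c c \<noteq> 0" "h x x \<noteq> 0" using assms h_self_nonzero by auto
  show "h (rot h c k x) x = (of_real (ta h c x) * (cnj k - k) + k) * h x x"
    unfolding ta(1) using nz by (simp add: rot_def h_simps field_simps)
  have "h (rot h c k x) (rot h c k c) = h x c" using h_rot assms by simp
  then have 1: "k * h (rot h c k x) c = h x c" using rot_self assms by (simp add: h_simps)
  then have 2: "cnj k * h c (rot h c k x) = h c x"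
    by (metis h_cnj complex_cnj_mult)
  have "h c x * h x c = (k * cnj k) * (h c (rot h c k x) * h (rot h c k x) c)"
    unfolding 1[symmetric] 2[symmetric] by simp
  then show "ta h c (rot h c k x) = ta h c x"
    using unit_cnj assms h_rot by (simp add: ta_def)
qed

text \<open>A rotation about \<open>c\<close> sends \<open>x\<close> to \<open>k *s x\<close> plus a
  multiple of \<open>c\<close>, which leaves only the line of \<open>y - k *s x\<close> for the
  centre. The prescribed \<open>h y x\<close> makes the coefficient of this vector equal to
  1.\<close>

lemma rot_centre:
  assumes xy: "h x x = 1" "h y y = 1" and k: "cmod k = 1" "cnj k \<noteq> k"
    and u: "h y x = of_real t * (cnj k - k) + k" and t: "t \<ge> 1"
  shows "Re (h (y - k *s x) (y - k *s x)) > 0" "rot h (y - k *s x) k x = y" "ta h (y - k *s x) x = t"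
proof -
  define v where "v = y - k *s x"
  have kk: "k * cnj k = 1" using unit_cnj k by simp
  have u': "h x y = of_real t * (k - cnj k) + cnj k" using h_cnj[of x y] u by simp
  have k2: "(k - cnj k)\<^sup>2 = - of_real ((2 * Im k)\<^sup>2)"
    by (simp add: complex_eq_iff power2_eq_square)
  have Im: "Im k \<noteq> 0" using k(2) by (auto simp: complex_eq_iff)
  have "h v v = - of_real t * (k - cnj k)\<^sup>2"
    unfolding v_def using kk by (simp add: h_minus h_simps xy u u', algebra)
  then have vv: "h v v = of_real (t * (2 * Im k)\<^sup>2)" by (simp add: k2)
  then have pos: "Re (h v v) > 0" using t Im by simp
  have xv: "h x v = of_real t * (k - cnj k)"
    unfolding v_def by (simp add: h_minus h_simps xy u')
  have hv: "h v v = - of_real t * (k - cnj k)\<^sup>2" by fact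
  have t0: "complex_of_real t \<noteq> 0" "k - cnj k \<noteq> 0" using t k by auto
  have "(cnj k - k) * (h x v / h v v) = - (k - cnj k) * (of_real t * (k - cnj k) / (- of_real t * (k - cnj k)\<^sup>2))"
    unfolding xv hv by simp
  also have "\<dots> = 1"
  proof -
    have "- m * (a * m / (- a * m\<^sup>2)) = 1" if "a \<noteq> 0" "m \<noteq> 0" for a m :: complex
      using that by (simp add: field_simps power2_eq_square)
    then show ?thesis using t0 by blast
  qed
  finally have "(cnj k - k) * (h x v / h v v) = 1" .
  then have "rot h v k x = v + k *s x" by (simp add: rot_def)
  then show "rot h (y - k *s x) k x = y" by (simp add: v_def)
  have "h v x * h x v = - of_real t * of_real t * (k - cnj k)\<^sup>2"
    unfolding h_cnj[of v x] xv by (simp add: power2_eq_square algebra_simps)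
  then have "h v x * h x v / (h v v * h x x) = of_real t"
    unfolding hv xy using t0 by simp
  then show "ta h (y - k *s x) x = t" by (simp add: ta_def v_def)
  show "Re (h (y - k *s x) (y - k *s x)) > 0" using pos by (simp add: v_def)
qed

lemma line_scale: "s \<noteq> 0 \<Longrightarrow> line (s *s v) = line v"
proof (rule set_eqI)
  fix x assume s: "s \<noteq> 0"
  show "x \<in> line (s *s v) \<longleftrightarrow> x \<in> line v"
  proof
    assume "x \<in> line v"
    then obtain a where "x = a *s v" by (auto simp: line_def vec.span_singleton)
    then have "x = (a / s) *s (s *s v)" using s by simp
    then show "x \<in> line (s *s v)" unfolding line_def vec.span_singleton by blast
  qed (auto simp: line_def vec.span_singleton)
qed

lemma centre_line:
  assumes "Re (h v v) > 0" "Re (h x x) > 0" "cnj k \<noteq> k"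
  shows "line (rot h v k x - k *s x) = line v"
  using assms h_nonzero h_self_nonzero by (simp add: rot_def line_scale)

text \<open>The isometry sends \<open>p\<close> to \<open>p'\<close> and the orthogonal complement
  of the one to that of the other. The Gram data leave only a phase \<open>z\<close> free there, and
  equality of the mixed products makes the same \<open>z\<close> work for both remaining
  vectors.\<close>

lemma unitary_ext:
  assumes gram: "h p p = 1" "h p' p' = 1" "h p1 p = h p1' p'" "h p2 p = h p2' p'"
    "h p1 p1 = h p1' p1'" "h p2 p2 = h p2' p2'" "h p2 p1 = h p2' p1'"
  obtains g where "unitary h g" "g p = p'" "g p1 = p1'" "g p2 = p2'"
proof -
  obtain q where q: "hermitian_plane h p q" using orthonormal_completion gram by blast
  obtain q' where q': "hermitian_plane h p' q'" using orthonormal_completion gram by blast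
  interpret P: hermitian_plane h p q by fact
  interpret P': hermitian_plane h p' q' by fact
  define a1 a2 b1 b2 where "a1 = h p1 q" and "a2 = h p2 q" and "b1 = h p1' q'" and "b2 = h p2' q'"
  have 1: "a1 * cnj a1 = b1 * cnj b1" "a2 * cnj a2 = b2 * cnj b2" "a2 * cnj a1 = b2 * cnj b1"
    using gram P.h_coords[of p1 p1] P'.h_coords[of p1' p1'] P.h_coords[of p2 p2] P'.h_coords[of p2' p2']
      P.h_coords[of p2 p1] P'.h_coords[of p2' p1']
    by (auto simp: a1_def a2_def b1_def b2_def)
  have n: "cmod a1 = cmod b1" "cmod a2 = cmod b2"
    using 1 by (metis complex_norm_square norm_ge_zero of_real_eq_iff power2_eq_imp_eq)+
  obtain z where z: "cmod z = 1" "b1 = z * a1" "b2 = z * a2"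
  proof (cases "a1 = 0")
    case False
    then have "b1 \<noteq> 0" using n by auto
    have "cnj a1 * (b2 * a1 - b1 * a2) = 0" using 1 by algebra
    then have "b2 = b1 / a1 * a2" using False by (simp add: field_simps)
    then show thesis using that[of "b1 / a1"] False \<open>b1 \<noteq> 0\<close> n by (simp add: norm_divide)
  next
    case a1: True
    then have b1: "b1 = 0" using n by simp
    show thesis
    proof (cases "a2 = 0")
      case True then show thesis using that[of 1] a1 b1 n by simp
    next
      case False
      then have "b2 \<noteq> 0" using n by auto
      with False show thesis using that[of "b2 / a2"] a1 b1 n by (simp add: norm_divide)
    qed
  qed
  have zz: "z * cnj z = 1" using unit_cnj z by simp
  define g where "g x = h x p *s p' - (z * h x q) *s q'" for x
  define g' where "g' x = h x p' *s p - (cnj z * h x q') *s q" for x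
  have gp: "h (g x) p' = h x p" "h (g x) q' = z * h x q" for x
    by (simp_all add: g_def P'.h_minus h_simps P'.ee P'.ff P'.ef P'.fe)
  have gp': "h (g' x) p = h x p'" "h (g' x) q = cnj z * h x q'" for x
    by (simp_all add: g'_def h_minus h_simps P.ee P.ff P.ef P.fe)
  have "g' (g x) = x" "g (g' x) = x" for x
    using zz by (simp_all add: P.eq_iff_coords[of "g' (g x)"] P'.eq_iff_coords[of "g (g' x)"] gp gp' mult_ac)
  then have "bij g" by (metis bijI')
  moreover have "Vector_Spaces.linear (*s) (*s) g"
    by unfold_locales (simp_all add: g_def h_simps vec_eq_iff algebra_simps)
  moreover have "h (g x) (g y) = h x y" for x y
    using zz unfolding P'.h_coords[of "g x" "g y"] P.h_coords[of x y] gp complex_cnj_mult by algebra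
  ultimately have "unitary h g" by (simp add: unitary_def)
  moreover have "g p = p'" "g p1 = p1'" "g p2 = p2'"
    using gram z by (simp_all add: P'.eq_iff_coords gp P.ee P.ef P'.ee P'.ef a1_def a2_def b1_def b2_def)
  ultimately show thesis using that by blast
qed

end

section \<open>From a hexagon to its parameters\<close>

text \<open>By \<open>h_rot_self\<close>, the product of \<open>rot h c k x\<close> with a unit
  vector \<open>x\<close> for which \<open>ta h c x = t\<close>.\<close>

definition vertex_u :: "complex \<Rightarrow> real \<Rightarrow> complex" where
  "vertex_u k t = of_real t * (cnj k - k) + k"

lemma Re_of_real_mult: "Re (of_real d * z) = d * Re z"
  by simp

lemma vertex_u_cnj: "vertex_u (cnj k) t = cnj (vertex_u k t)"
  by (simp add: vertex_u_def)

lemma u_coeff_eq: "u_coeff a j t = vertex_u (cis (a j)) t"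
  by (simp add: u_coeff_def vertex_u_def)

definition signed_solutions :: "real \<Rightarrow> (4 \<Rightarrow> real) \<Rightarrow> (real \<times> real \<times> real) set" where
  "signed_solutions d a = {(t1, t2, t3). t1 \<ge> 1 \<and> t2 \<ge> 1 \<and> t3 \<ge> 1 \<and>
     1 + 2 * d * Re (cnj (cis (a 0)) * u_coeff a 1 t1 * u_coeff a 2 t2 * u_coeff a 3 t3) =
       (cmod (u_coeff a 1 t1))\<^sup>2 + (cmod (u_coeff a 2 t2))\<^sup>2 + (cmod (u_coeff a 3 t3))\<^sup>2}"

lemma signed_solutions_eq:
  "E1_solutions a = signed_solutions 1 a" "E0_solutions a = signed_solutions (- 1) a"
  by (auto simp: E1_solutions_def E0_solutions_def signed_solutions_def)

abbreviation both_solutions :: "(4 \<Rightarrow> real) \<Rightarrow> (real \<times> real \<times> real) set" where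
  "both_solutions a \<equiv> signed_solutions 1 a \<union> signed_solutions (- 1) a"

text \<open>Inverting all rotations exchanges the two types of hexagons.\<close>
definition turn :: "hexagon_type \<Rightarrow> (4 \<Rightarrow> real) \<Rightarrow> 4 \<Rightarrow> complex" where
  "turn T a j = (case T of First \<Rightarrow> cis (a j) | Second \<Rightarrow> cnj (cis (a j)))"

lemma cmod_turn: "cmod (turn T a j) = 1"
  by (simp add: turn_def split: hexagon_type.split)

lemma turn_nonreal: "0 < a j \<Longrightarrow> a j < pi \<Longrightarrow> cnj (turn T a j) \<noteq> turn T a j"
  using sin_gt_zero[of "a j"] by (auto simp: turn_def complex_eq_iff split: hexagon_type.split)

lemma signed_solutions_turn:
  "(t1, t2, t3) \<in> signed_solutions d a \<longleftrightarrow> t1 \<ge> 1 \<and> t2 \<ge> 1 \<and> t3 \<ge> 1 \<and>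
     1 + 2 * d * Re (cnj (turn T a 0) * vertex_u (turn T a 1) t1 * vertex_u (turn T a 2) t2 * vertex_u (turn T a 3) t3) =
       (cmod (vertex_u (turn T a 1) t1))\<^sup>2 + (cmod (vertex_u (turn T a 2) t2))\<^sup>2 + (cmod (vertex_u (turn T a 3) t3))\<^sup>2"
proof (cases T)
  case First
  then show ?thesis by (simp add: signed_solutions_def turn_def u_coeff_eq)
next
  case Second
  have "Re (cnj (cnj x) * cnj y1 * cnj y2 * cnj y3) = Re (cnj x * y1 * y2 * y3)" for x y1 y2 y3
    by (metis complex_cnj_cnj complex_cnj_mult cnj.sel(1))
  then show ?thesis
    by (simp only: Second signed_solutions_def turn_def u_coeff_eq vertex_u_cnj hexagon_type.case
        complex_mod_cnj mem_Collect_eq prod.case)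
qed

lemma trivial_in_PU_inverse:
  assumes "trivial_in_PU g" "\<And>v. g (g' v) = v"
  shows "trivial_in_PU g'"
proof -
  obtain l where l: "cmod l = 1" "\<And>v. g v = l *s v" using assms(1) by (auto simp: trivial_in_PU_def)
  then have "g' v = inverse l *s v" for v
    using assms(2)[of v] by (metis l(2) norm_zero left_inverse vector_smult_assoc vector_smult_lid zero_neq_one)
  then show ?thesis using l(1) unfolding trivial_in_PU_def by (metis inverse_1 norm_inverse)
qed

context hermitian_plane
begin

lemma BV_unit:
  assumes "L \<in> BV h"
  obtains v where "L = line v" "h v v = 1"
proof -
  obtain w where w: "L = line w" "Re (h w w) > 0" using assms by (auto simp: BV_def)
  define s where "s = complex_of_real (1 / sqrt (Re (h w w)))"
  have s: "s \<noteq> 0" using w by (simp add: s_def)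
  have "h (s *s w) (s *s w) = s * cnj s * of_real (Re (h w w))"
    using h_self_real[of w] by (simp add: h_simps)
  also have "\<dots> = of_real ((1 / sqrt (Re (h w w)))\<^sup>2 * Re (h w w))"
    unfolding s_def by (simp only: of_real_mult power2_eq_square complex_cnj_complex_of_real)
  also have "\<dots> = 1" using w by (simp add: power_divide)
  finally show thesis using that[of "s *s w"] w s by (simp add: line_scale)
qed

lemma BV_line: "Re (h v v) > 0 \<Longrightarrow> line v \<in> BV h"
  using h_self_nonzero by (auto simp: BV_def)

lemma prot_line: "Re (h v v) > 0 \<Longrightarrow> prot h (line v) k = rot h v k"
  using rot_rep_line[OF herm] h_self_nonzero by blast

lemma prot_cnj:
  assumes "L \<in> BV h" "cmod k = 1"
  shows "prot h L k (prot h L (cnj k) p) = p"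
proof -
  obtain v where v: "L = line v" "h v v = 1" using assms BV_unit by blast
  then show ?thesis using rot_rot_cnj[OF herm _ assms(2), of v] by (simp add: prot_line)
qed

lemma quads_iff:
  "c \<in> quads h a T \<longleftrightarrow> (\<forall>j. c j \<in> BV h) \<and> trivial_in_PU (prot h (c 3) (turn T a 3) \<circ>
     prot h (c 2) (turn T a 2) \<circ> prot h (c 1) (turn T a 1) \<circ> prot h (c 0) (turn T a 0))"
proof (cases T)
  case First then show ?thesis by (simp add: quads_def turn_def)
next
  case Second
  have "trivial_in_PU (vertex_rot h a c 0 \<circ> vertex_rot h a c 1 \<circ> vertex_rot h a c 2 \<circ> vertex_rot h a c 3) \<longleftrightarrow>
     trivial_in_PU (prot h (c 3) (turn T a 3) \<circ>
     prot h (c 2) (turn T a 2) \<circ> prot h (c 1) (turn T a 1) \<circ> prot h (c 0) (turn T a 0))"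
    if "\<forall>j. c j \<in> BV h"
    using that prot_cnj[of "c _" "cis (a _)"] prot_cnj[of "c _" "cnj (cis (a _))"]
    by (intro iffI; elim trivial_in_PU_inverse) (simp_all add: turn_def Second)
  then show ?thesis unfolding Second by (auto simp: quads_def)
qed

lemma vertex_t_eq:
  assumes "\<And>j. c j \<in> BV h"
  shows "vertex_t h a T c = (let p1 = prot h (c 1) (turn T a 1) ` c 0; p2 = prot h (c 2) (turn T a 2) ` p1
     in (pta h (c 1) p1, pta h (c 2) p2, pta h (c 3) (c 0)))"
  using assms by (cases T) (simp_all add: turn_def Let_def inv_prot[OF herm])

lemma unit_pos: "h v v = 1 \<Longrightarrow> Re (h v v) > 0"
  by simp

lemma rot_image_line: "rot h c k ` line v = line (rot h c k v)"
  using linear_image_line[OF linear_rot[OF herm]] .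

lemma vertex_t_lines:
  assumes "Re (h p p) > 0" "Re (h v1 v1) > 0" "Re (h v2 v2) > 0" "Re (h v3 v3) > 0"
    and "c 0 = line p" "c 1 = line v1" "c 2 = line v2" "c 3 = line v3"
    and c: "\<And>j. c j \<in> BV h"
  shows "vertex_t h a T c = (ta h v1 (rot h v1 (turn T a 1) p),
     ta h v2 (rot h v2 (turn T a 2) (rot h v1 (turn T a 1) p)), ta h v3 p)"
proof -
  define p1 where "p1 = rot h v1 (turn T a 1) p"
  define p2 where "p2 = rot h v2 (turn T a 2) p1"
  have "h p1 p1 = h p p" "h p2 p2 = h p p" using assms by (simp_all add: p1_def p2_def h_rot cmod_turn)
  then have "p \<noteq> 0" "p1 \<noteq> 0" "p2 \<noteq> 0" "v1 \<noteq> 0" "v2 \<noteq> 0" "v3 \<noteq> 0"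
    using assms h_self_nonzero by (auto simp: h_zero)
  then show ?thesis
    unfolding vertex_t_eq[OF c] using assms(1-8)
    by (simp add: Let_def prot_line rot_image_line ta_rep_line[OF herm] flip: p1_def p2_def)
qed

lemma ta_scale:
  assumes z: "z * cnj z = 1"
  shows "ta h v (z *s x) = ta h v x"
proof -
  have "(cnj z * a) * (z * b) / (w * (cnj z * (z * u))) = a * b / (w * u)" for a b w u :: complex
  proof -
    have "(cnj z * a) * (z * b) = (z * cnj z) * (a * b)" "w * (cnj z * (z * u)) = (z * cnj z) * (w * u)"
      by (simp_all add: mult_ac)
    then show ?thesis by (simp only: z mult_1_left)
  qed
  then show ?thesis by (simp only: ta_def h_simps)
qed

text \<open>Rotations preserve \<open>wedge\<close>, so \<open>l\<^sup>2 = 1\<close>. As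
  \<open>p\<close> is an eigenvector of the first rotation with eigenvalue \<open>cnj k0\<close>,
  this factor can be moved to the other side.\<close>

lemma monodromy:
  assumes pos: "h p p = 1" "Re (h v1 v1) > 0" "Re (h v2 v2) > 0" "Re (h v3 v3) > 0"
    and k: "cmod k0 = 1" "cmod k1 = 1" "cmod k2 = 1" "cmod k3 = 1"
    and l: "\<And>x. rot h v3 k3 (rot h v2 k2 (rot h v1 k1 (rot h p k0 x))) = l *s x"
  shows "l = 1 \<or> l = -1" "rot h v3 k3 (rot h v2 k2 (rot h v1 k1 p)) = (l * k0) *s p"
proof -
  have "wedge (l *s e) (l *s f) = wedge e f"
    using pos k unfolding l[symmetric] by (simp add: wedge_rot)
  then have "l\<^sup>2 = 1" by (simp add: wedge_def h_simps ee ff ef fe power2_eq_square)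
  then show "l = 1 \<or> l = -1" by (simp add: power2_eq_1_iff)
  have "cnj k0 *s rot h v3 k3 (rot h v2 k2 (rot h v1 k1 p)) = l *s p"
    using l[of p] rot_self[of p k0] pos by (simp add: rot_scale)
  then have "k0 *s (cnj k0 *s rot h v3 k3 (rot h v2 k2 (rot h v1 k1 p))) = k0 *s (l *s p)" by simp
  then show "rot h v3 k3 (rot h v2 k2 (rot h v1 k1 p)) = (l * k0) *s p"
    using unit_cnj[OF k(1)] by (simp add: mult.commute)
qed

text \<open>Here \<open>p = p\<^sub>3\<close>, and \<open>d\<close> is the sign of the lift of the relation to SU.\<close>
lemma hexagon_data:
  assumes c: "c \<in> quads h a T" and a: "\<And>j. 0 < a j \<and> a j < pi"
    and t: "vertex_t h a T c = (t1, t2, t3)"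
  obtains p p1 p2 d where "d = 1 \<or> d = -1" "h p p = 1" "h p1 p1 = 1" "h p2 p2 = 1"
    "c 0 = line p" "c 1 = line (p1 - turn T a 1 *s p)" "c 2 = line (p2 - turn T a 2 *s p1)"
    "c 3 = line ((of_real d * turn T a 0) *s p - turn T a 3 *s p2)"
    "h p1 p = vertex_u (turn T a 1) t1" "h p2 p1 = vertex_u (turn T a 2) t2"
    "h p p2 = of_real d * cnj (turn T a 0) * vertex_u (turn T a 3) t3"
    "(t1, t2, t3) \<in> signed_solutions d a"
proof -
  define K where "K = turn T a"
  have K: "cmod (K j) = 1" "cnj (K j) \<noteq> K j" for j
    using turn_nonreal a by (auto simp: K_def cmod_turn)
  have BV: "c j \<in> BV h" for j using c by (simp add: quads_iff)
  obtain p where p: "c 0 = line p" "h p p = 1" using BV_unit[OF BV] by metis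
  obtain v1 where v1: "c 1 = line v1" "h v1 v1 = 1" using BV_unit[OF BV] by metis
  obtain v2 where v2: "c 2 = line v2" "h v2 v2 = 1" using BV_unit[OF BV] by metis
  obtain v3 where v3: "c 3 = line v3" "h v3 v3 = 1" using BV_unit[OF BV] by metis
  have pos: "Re (h v1 v1) > 0" "Re (h v2 v2) > 0" "Re (h v3 v3) > 0" using v1 v2 v3 by simp_all
  obtain l where "\<And>x. rot h v3 (K 3) (rot h v2 (K 2) (rot h v1 (K 1) (rot h p (K 0) x))) = l *s x"
    using c p v1 v2 v3 by (auto simp: quads_iff trivial_in_PU_def prot_line K_def)
  note mono = monodromy[OF p(2) pos K(1) K(1) K(1) K(1) this]
  define p1 where "p1 = rot h v1 (K 1) p"
  define p2 where "p2 = rot h v2 (K 2) p1"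
  obtain d :: real where d: "d = 1 \<or> d = -1" "l = of_real d" using mono(1) by force
  have r3: "rot h v3 (K 3) p2 = (of_real d * K 0) *s p" using mono(2) by (simp add: p2_def p1_def d)
  have n: "h p1 p1 = 1" "h p2 p2 = 1" using pos p K by (simp_all add: p1_def p2_def h_rot)
  have "vertex_t h a T c = (ta h v1 p1, ta h v2 p2, ta h v3 p)"
    using vertex_t_lines[OF unit_pos[OF p(2)] pos p(1) v1(1) v2(1) v3(1) BV] by (simp add: p1_def p2_def K_def)
  then have ts: "t1 = ta h v1 p1" "t2 = ta h v2 p2" "t3 = ta h v3 p" using t by simp_all
  have dK: "(of_real d * K 0) * cnj (of_real d * K 0) = 1"
    using d(1) unit_cnj[OF K(1)[of 0]] by auto
  have pp: "Re (h p p) > 0" "Re (h p1 p1) > 0" "Re (h p2 p2) > 0" using p n by simp_all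
  \<comment> \<open>The parameter \<open>t3\<close> is measured at \<open>p\<close>, which up to a
    unimodular factor is the image of \<open>p2\<close> under the last rotation; so it may be
    measured at \<open>p2\<close> instead.\<close>
  have "ta h v3 ((of_real d * K 0) *s p) = ta h v3 p" using dK by (rule ta_scale)
  then have t3: "ta h v3 p2 = t3" using h_rot_self(2)[OF pos(3) pp(3) K(1)] r3 ts by metis
  have g1: "h p1 p = vertex_u (K 1) t1"
    using h_rot_self(1,2)[OF pos(1) pp(1) K(1)[of 1]] p by (simp add: vertex_u_def ts p1_def)
  have g2: "h p2 p1 = vertex_u (K 2) t2"
    using h_rot_self(1,2)[OF pos(2) pp(2) K(1)[of 2]] n by (simp add: vertex_u_def ts p2_def)
  have "h ((of_real d * K 0) *s p) p2 = vertex_u (K 3) t3"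
    using h_rot_self(1)[OF pos(3) pp(3) K(1)[of 3]] n r3 t3 by (simp add: vertex_u_def)
  then have "(of_real d * cnj (K 0)) * (of_real d * K 0 * h p p2) = of_real d * cnj (K 0) * vertex_u (K 3) t3"
    by (simp add: h_simps)
  then have g3: "h p p2 = of_real d * cnj (K 0) * vertex_u (K 3) t3"
    using dK by (metis (no_types, lifting) complex_cnj_complex_of_real complex_cnj_mult mult.assoc mult.commute mult_1)
  have ge: "t1 \<ge> 1" "t2 \<ge> 1" "t3 \<ge> 1"
    using h_rot_self(3)[OF pos(1) pp(2)] h_rot_self(3)[OF pos(2) pp(3)] h_rot_self(3)[OF pos(3) pp(1)]
      K(1) by (auto simp: ts)
  have dd: "cmod (of_real d * cnj (K 0)) = 1" using d K by (auto simp: norm_mult)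
  define w where "w = of_real d * (cnj (K 0) * vertex_u (K 1) t1 * vertex_u (K 2) t2 * vertex_u (K 3) t3)"
  have "1 + w + cnj w = of_real ((cmod (vertex_u (K 2) t2))\<^sup>2) + of_real ((cmod (vertex_u (K 3) t3))\<^sup>2)
      + of_real ((cmod (vertex_u (K 1) t1))\<^sup>2)"
    using gram_det[of p p1 p2] unfolding complex_norm_square[symmetric] p n g1 g2 g3
    by (simp add: norm_mult d K w_def mult_ac) (use d K in \<open>auto simp: norm_mult\<close>)
  then have "Re (1 + w + cnj w) = Re (of_real ((cmod (vertex_u (K 2) t2))\<^sup>2) + of_real ((cmod (vertex_u (K 3) t3))\<^sup>2)
      + of_real ((cmod (vertex_u (K 1) t1))\<^sup>2))" by simp
  then have "1 + 2 * Re w = (cmod (vertex_u (K 1) t1))\<^sup>2 + (cmod (vertex_u (K 2) t2))\<^sup>2 + (cmod (vertex_u (K 3) t3))\<^sup>2"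
    by (simp only: plus_complex.sel cnj.sel Re_complex_of_real one_complex.sel)
  moreover have "Re w = d * Re (cnj (K 0) * vertex_u (K 1) t1 * vertex_u (K 2) t2 * vertex_u (K 3) t3)"
    using Re_of_real_mult unfolding w_def .
  ultimately have sol: "(t1, t2, t3) \<in> signed_solutions d a"
    unfolding signed_solutions_turn[of _ _ _ _ _ T] using ge by (simp add: K_def mult.assoc)
  have lines: "line (p1 - K 1 *s p) = line v1" "line (p2 - K 2 *s p1) = line v2"
    "line ((of_real d * K 0) *s p - K 3 *s p2) = line v3"
    using centre_line[OF pos(1) pp(1) K(2)[of 1]] centre_line[OF pos(2) pp(2) K(2)[of 2]]
      centre_line[OF pos(3) pp(3) K(2)[of 3]] unfolding r3 by (simp_all add: p1_def p2_def)
  show thesis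
    using that[OF d(1) p(2) n p(1), unfolded K_def[symmetric], OF _ _ _ g1 g2 g3 sol] lines v1 v2 v3 by simp
qed

end

section \<open>From parameters to a hexagon\<close>

lemma index_cases: "(j :: 4) = 0 \<or> j = 1 \<or> j = 2 \<or> j = 3"
  using exhaust_4[of j] by auto

lemma cmod_vertex_u:
  assumes "cmod k = 1"
  shows "(cmod (vertex_u k t))\<^sup>2 = 1 + 4 * (Im k)\<^sup>2 * (t * (t - 1))"
proof -
  have "(Re k)\<^sup>2 + (Im k)\<^sup>2 = 1" using assms cmod_power2[of k] by simp
  then show ?thesis unfolding cmod_power2 vertex_u_def by simp algebra
qed

lemma cmod_vertex_u_ge: "cmod k = 1 \<Longrightarrow> t \<ge> 1 \<Longrightarrow> (cmod (vertex_u k t))\<^sup>2 \<ge> 1"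
  by (simp add: cmod_vertex_u)

text \<open>A common solution would make the three squared moduli add up to 1, although each of them
  is at least 1.\<close>

lemma signed_solutions_disjoint: "signed_solutions 1 a \<inter> signed_solutions (- 1) a = {}"
proof -
  have False if "t \<in> signed_solutions 1 a" "t \<in> signed_solutions (- 1) a" for t
  proof -
    obtain t1 t2 t3 where t: "t = (t1, t2, t3)" by (cases t)
    have "t1 \<ge> 1" "t2 \<ge> 1" "t3 \<ge> 1" and
      eq: "(cmod (u_coeff a 1 t1))\<^sup>2 + (cmod (u_coeff a 2 t2))\<^sup>2 + (cmod (u_coeff a 3 t3))\<^sup>2 = 1"
      using that unfolding t signed_solutions_def by auto
    then have "(cmod (u_coeff a 1 t1))\<^sup>2 \<ge> 1" "(cmod (u_coeff a 2 t2))\<^sup>2 \<ge> 1" "(cmod (u_coeff a 3 t3))\<^sup>2 \<ge> 1"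
      unfolding u_coeff_eq by (simp_all add: cmod_vertex_u_ge)
    then show False using eq by linarith
  qed
  then show ?thesis by blast
qed

text \<open>The squared modulus of the \<open>f\<close>-component of a vector of norm 1 whose
  \<open>e\<close>-component is \<open>vertex_u k t\<close>.\<close>

definition distort :: "complex \<Rightarrow> real \<Rightarrow> real" where
  "distort k t = (cmod (vertex_u k t))\<^sup>2 - 1"

text \<open>Triples \<open>(t, z, d)\<close> of a solution \<open>t\<close> for the sign \<open>d\<close> and a relative phase \<open>z\<close> of the
  \<open>f\<close>-components of \<open>p\<^sub>1\<close> and \<open>p\<^sub>2\<close>; the phase is free only where one of these components vanishes.
  As \<open>z\<close> and \<open>d\<close> range over compact sets, forgetting them is a closed map.\<close>
definition phases :: "hexagon_type \<Rightarrow> (4 \<Rightarrow> real) \<Rightarrow> ((real \<times> real \<times> real) \<times> complex \<times> real) set" where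
  "phases T a = {((t1, t2, t3), z, d). (d = 1 \<or> d = -1) \<and> cmod z = 1 \<and> (t1, t2, t3) \<in> signed_solutions d a \<and>
     of_real (sqrt (distort (turn T a 1) t1) * sqrt (distort (turn T a 3) t3)) * z =
       cnj (of_real d * cnj (turn T a 0) * vertex_u (turn T a 3) t3 * vertex_u (turn T a 1) t1) - vertex_u (turn T a 2) t2}"

text \<open>The equation for the sign \<open>d\<close> says that \<open>cnj m - u2\<close> has
  modulus \<open>r\<close>, the product of the two \<open>f\<close>-components. Its quotient by
  \<open>r\<close> is the phase; for \<open>r = 0\<close> the value 1 is an arbitrary
  choice.\<close>

lemma phase_exists:
  assumes d: "d = 1 \<or> d = -1" and t: "(t1, t2, t3) \<in> signed_solutions d a"
  shows "\<exists>z. ((t1, t2, t3), z, d) \<in> phases T a"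
proof -
  define K where "K = turn T a"
  define u1 u2 u3 where "u1 = vertex_u (K 1) t1" and "u2 = vertex_u (K 2) t2" and "u3 = vertex_u (K 3) t3"
  define m where "m = of_real d * cnj (K 0) * u3 * u1"
  have t': "t1 \<ge> 1" "t3 \<ge> 1" and eq: "1 + 2 * d * Re (cnj (K 0) * u1 * u2 * u3) = (cmod u1)\<^sup>2 + (cmod u2)\<^sup>2 + (cmod u3)\<^sup>2"
    using t unfolding signed_solutions_turn[of _ _ _ _ _ T] by (simp_all add: K_def u1_def u2_def u3_def)
  have w: "distort (K 1) t1 \<ge> 0" "distort (K 3) t3 \<ge> 0"
    using t' by (simp_all add: distort_def cmod_vertex_u_ge cmod_turn K_def)
  define r where "r = sqrt (distort (K 1) t1) * sqrt (distort (K 3) t3)"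
  have r: "r \<ge> 0" "r\<^sup>2 = ((cmod u1)\<^sup>2 - 1) * ((cmod u3)\<^sup>2 - 1)"
    using w by (simp_all add: r_def power_mult_distrib) (simp add: distort_def u1_def u3_def)
  have cm: "(cmod m)\<^sup>2 = (cmod u1)\<^sup>2 * (cmod u3)\<^sup>2"
    using d by (auto simp: m_def K_def norm_mult cmod_turn power_mult_distrib)
  have "Re (m * u2) = Re (of_real d * (cnj (K 0) * u1 * u2 * u3))" by (simp only: m_def mult_ac)
  then have Re: "Re (m * u2) = d * Re (cnj (K 0) * u1 * u2 * u3)" by (simp only: Re_of_real_mult)
  have "(cmod (cnj m - u2))\<^sup>2 = (cmod m)\<^sup>2 + (cmod u2)\<^sup>2 - 2 * Re (m * u2)"
    unfolding cmod_power2 by simp algebra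
  also have "\<dots> = r\<^sup>2" unfolding cm Re r using eq by (simp add: algebra_simps)
  finally have n: "cmod (cnj m - u2) = r" using r by (simp add: power2_eq_imp_eq)
  define z where "z = (if r = 0 then 1 else (cnj m - u2) / of_real r)"
  have "cmod z = 1" "of_real r * z = cnj m - u2" using n r by (auto simp: z_def norm_divide)
  then have "((t1, t2, t3), z, d) \<in> phases T a"
    using d t by (simp add: phases_def r_def m_def K_def u1_def u2_def u3_def)
  then show ?thesis ..
qed

lemma closed_phases: "closed (phases T a)"
proof -
  have eq: "phases T a = {x. (snd (snd x) = 1 \<or> snd (snd x) = -1) \<and> cmod (fst (snd x)) = 1 \<and>
     (1 \<le> fst (fst x) \<and> 1 \<le> fst (snd (fst x)) \<and> 1 \<le> snd (snd (fst x)) \<and>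
     1 + 2 * snd (snd x) * Re (cnj (cis (a 0)) * u_coeff a 1 (fst (fst x)) * u_coeff a 2 (fst (snd (fst x)))
        * u_coeff a 3 (snd (snd (fst x)))) =
     (cmod (u_coeff a 1 (fst (fst x))))\<^sup>2 + (cmod (u_coeff a 2 (fst (snd (fst x)))))\<^sup>2 +
        (cmod (u_coeff a 3 (snd (snd (fst x)))))\<^sup>2) \<and>
     of_real (sqrt (distort (turn T a 1) (fst (fst x))) * sqrt (distort (turn T a 3) (snd (snd (fst x))))) * fst (snd x) =
       cnj (of_real (snd (snd x)) * cnj (turn T a 0) * vertex_u (turn T a 3) (snd (snd (fst x))) * vertex_u (turn T a 1) (fst (fst x)))
       - vertex_u (turn T a 2) (fst (snd (fst x)))}"
    by (auto simp: phases_def signed_solutions_def)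
  show ?thesis unfolding eq u_coeff_def vertex_u_def distort_def
    by (intro closed_Collect_conj closed_Collect_disj closed_Collect_eq closed_Collect_le continuous_intros)
qed

lemma fst_phases: "fst ` phases T a = both_solutions a"
proof (intro subset_antisym subsetI)
  fix t assume "t \<in> fst ` phases T a"
  then show "t \<in> both_solutions a" by (auto simp: phases_def)
next
  fix t assume "t \<in> both_solutions a"
  then obtain d t1 t2 t3 where "d = 1 \<or> d = -1" "t = (t1, t2, t3)" "(t1, t2, t3) \<in> signed_solutions d a"
    by (cases t) auto
  then show "t \<in> fst ` phases T a" using phase_exists by (metis fst_conv imageI)
qed

lemma quotient_map_phases:
  "quotient_map (top_of_set (phases T a)) (top_of_set (both_solutions a)) fst"
proof (rule continuous_closed_imp_quotient_map)
  have sub: "phases T a \<subseteq> (both_solutions a) \<times> (sphere 0 1 \<times> {1, -1})"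
    by (auto simp: phases_def)
  show "continuous_map (top_of_set (phases T a)) (top_of_set (both_solutions a)) fst"
  proof -
    have "fst \<in> phases T a \<rightarrow> both_solutions a"
      using fst_phases[of T a] by blast
    then show ?thesis by (simp add: continuous_on_fst)
  qed
  show "fst ` topspace (top_of_set (phases T a)) = topspace (top_of_set (both_solutions a))"
    by (simp add: fst_phases)
  show "closed_map (top_of_set (phases T a)) (top_of_set (both_solutions a)) fst"
    unfolding closed_map_def
  proof (intro allI impI)
    fix C assume C: "closedin (top_of_set (phases T a)) C"
    have "closed C" by (rule closedin_closed_trans[OF C closed_phases])
    moreover have "C \<subseteq> phases T a" by (rule closedin_imp_subset[OF C])
    ultimately have "closedin (top_of_set ((both_solutions a) \<times> (sphere 0 1 \<times> {1, -1}))) C"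
      using sub by (intro closed_subset) auto
    then show "closedin (top_of_set (both_solutions a)) (fst ` C)"
      by (rule Starlike.closed_map_fst[rotated]) (intro compact_Times compact_sphere finite_imp_compact; simp)
  qed
qed

context hermitian_plane
begin

text \<open>Equal parameters entail equal signs \<open>d\<close>, since the two solution sets are
  disjoint, and hence equal Gram matrices. The isometry from \<open>unitary_ext\<close> carries
  centres to centres because these are linear expressions in the three vectors.\<close>

lemma orbit_unique:
  assumes a: "\<And>j. 0 < a j \<and> a j < pi" and c: "c \<in> quads h a T" "c' \<in> quads h a T"
    and t: "vertex_t h a T c = vertex_t h a T c'"
  shows "c' \<in> orbit h c"
proof -
  obtain t1 t2 t3 where ts: "vertex_t h a T c = (t1, t2, t3)" using prod_cases3 by blast
  then have ts': "vertex_t h a T c' = (t1, t2, t3)" using t by simp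
  obtain p p1 p2 d where 1: "d = 1 \<or> d = -1" "h p p = 1" "h p1 p1 = 1" "h p2 p2 = 1"
    "c 0 = line p" "c 1 = line (p1 - turn T a 1 *s p)" "c 2 = line (p2 - turn T a 2 *s p1)"
    "c 3 = line ((of_real d * turn T a 0) *s p - turn T a 3 *s p2)"
    "h p1 p = vertex_u (turn T a 1) t1" "h p2 p1 = vertex_u (turn T a 2) t2"
    "h p p2 = of_real d * cnj (turn T a 0) * vertex_u (turn T a 3) t3"
    "(t1, t2, t3) \<in> signed_solutions d a"
    by (rule hexagon_data[OF c(1) a ts])
  obtain p' p1' p2' d' where 2: "d' = 1 \<or> d' = -1" "h p' p' = 1" "h p1' p1' = 1" "h p2' p2' = 1"
    "c' 0 = line p'" "c' 1 = line (p1' - turn T a 1 *s p')" "c' 2 = line (p2' - turn T a 2 *s p1')"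
    "c' 3 = line ((of_real d' * turn T a 0) *s p' - turn T a 3 *s p2')"
    "h p1' p' = vertex_u (turn T a 1) t1" "h p2' p1' = vertex_u (turn T a 2) t2"
    "h p' p2' = of_real d' * cnj (turn T a 0) * vertex_u (turn T a 3) t3"
    "(t1, t2, t3) \<in> signed_solutions d' a"
    by (rule hexagon_data[OF c(2) a ts'])
  have dd: "d' = d" using 1(1,12) 2(1,12) signed_solutions_disjoint by blast
  have "h p2 p = h p2' p'" using h_cnj[of p2 p] h_cnj[of p2' p'] 1(11) 2(11) dd by simp
  then obtain g where g: "unitary h g" "g p = p'" "g p1 = p1'" "g p2 = p2'"
    using unitary_ext[of p p' p1 p1' p2 p2'] 1 2 by metis
  interpret g: Vector_Spaces.linear "(*s)" "(*s)" g using g(1) by (simp add: unitary_def)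
  have img: "g ` line x = line (g x)" for x by (intro linear_image_line g.linear_axioms)
  have "c' j = g ` c j" for j
    using index_cases[of j] 1(5-8) 2(5-8) by (elim disjE) (simp_all add: img g.diff g.scale g(2-4) dd)
  then show ?thesis using g(1) unfolding orbit_def by (auto simp: fun_eq_iff)
qed

text \<open>A normal form up to isometry: \<open>p\<close> is \<open>e\<close>, and
  \<open>p1\<close> has a nonnegative real \<open>f\<close>-component. The phase \<open>z\<close>
  then accounts for the product of \<open>p2\<close> with \<open>p1\<close>.\<close>

definition lift_p1 :: "hexagon_type \<Rightarrow> (4 \<Rightarrow> real) \<Rightarrow> (real \<times> real \<times> real) \<times> complex \<times> real \<Rightarrow> cvec" where
  "lift_p1 T a = (\<lambda>((t1, t2, t3), z, d).
     vertex_u (turn T a 1) t1 *s e + of_real (sqrt (distort (turn T a 1) t1)) *s f)"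

definition lift_p2 :: "hexagon_type \<Rightarrow> (4 \<Rightarrow> real) \<Rightarrow> (real \<times> real \<times> real) \<times> complex \<times> real \<Rightarrow> cvec" where
  "lift_p2 T a = (\<lambda>((t1, t2, t3), z, d).
     cnj (of_real d * cnj (turn T a 0) * vertex_u (turn T a 3) t3) *s e
       + (of_real (sqrt (distort (turn T a 3) t3)) * z) *s f)"

definition lift_centre :: "hexagon_type \<Rightarrow> (4 \<Rightarrow> real) \<Rightarrow> (real \<times> real \<times> real) \<times> complex \<times> real \<Rightarrow> 4 \<Rightarrow> cvec" where
  "lift_centre T a x j = (if j = 0 then e else if j = 1 then lift_p1 T a x - turn T a 1 *s e
     else if j = 2 then lift_p2 T a x - turn T a 2 *s lift_p1 T a x
     else (of_real (snd (snd x)) * turn T a 0) *s e - turn T a 3 *s lift_p2 T a x)"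

text \<open>By \<open>rot_centre\<close> the three rotations carry \<open>e\<close> to
  \<open>p1\<close>, \<open>p2\<close> and \<open>d k0 e\<close> in turn. So the product
  \<open>G\<close> of all four has \<open>e\<close> as an eigenvector with eigenvalue
  \<open>d\<close>, and the invariance of \<open>h\<close> and \<open>wedge\<close> leaves only
  \<open>G = d\<close>.\<close>

lemma lift_centre:
  assumes a: "\<And>j. 0 < a j \<and> a j < pi" and x: "x \<in> phases T a"
  shows "Re (h (lift_centre T a x j) (lift_centre T a x j)) > 0"
    "(\<lambda>j. line (lift_centre T a x j)) \<in> quads h a T"
    "vertex_t h a T (\<lambda>j. line (lift_centre T a x j)) = fst x"
proof -
  obtain t1 t2 t3 z d where xx: "x = ((t1, t2, t3), z, d)" by (metis prod.collapse)
  define K where "K = turn T a"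
  define u1 u2 u3 where "u1 = vertex_u (K 1) t1" and "u2 = vertex_u (K 2) t2" and "u3 = vertex_u (K 3) t3"
  have d: "d = 1 \<or> d = -1" and z: "cmod z = 1" and sol: "(t1, t2, t3) \<in> signed_solutions d a"
    and con: "of_real (sqrt (distort (K 1) t1) * sqrt (distort (K 3) t3)) * z
       = cnj (of_real d * cnj (K 0) * u3 * u1) - u2"
    using x by (auto simp: phases_def xx K_def u1_def u2_def u3_def)
  have t: "t1 \<ge> 1" "t2 \<ge> 1" "t3 \<ge> 1" using sol by (auto simp: signed_solutions_def)
  have K: "cmod (K j) = 1" "cnj (K j) \<noteq> K j" for j
    using turn_nonreal a by (auto simp: K_def cmod_turn)
  define p1 where "p1 = lift_p1 T a x"
  define p2 where "p2 = lift_p2 T a x"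
  have p1: "p1 = u1 *s e + of_real (sqrt (distort (K 1) t1)) *s f"
    by (simp add: p1_def lift_p1_def xx u1_def K_def)
  have p2: "p2 = cnj (of_real d * cnj (K 0) * u3) *s e + (of_real (sqrt (distort (K 3) t3)) * z) *s f"
    by (simp add: p2_def lift_p2_def xx u3_def K_def)
  have w: "distort (K 1) t1 \<ge> 0" "distort (K 3) t3 \<ge> 0"
    using t by (simp_all add: distort_def cmod_vertex_u_ge K)
  have zz: "z * cnj z = 1" using unit_cnj z by blast
  have dK: "(of_real d * K 0) * cnj (of_real d * K 0) = 1"
    using d unit_cnj[OF K(1)[of 0]] by auto
  have sq: "complex_of_real (sqrt r) * complex_of_real (sqrt r) = of_real r" if "r \<ge> 0" for r
    using that by (simp flip: of_real_mult)
  have "h p1 p1 = u1 * cnj u1 - of_real (sqrt (distort (K 1) t1)) * of_real (sqrt (distort (K 1) t1))"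
    by (simp add: p1 h_simps ee ff ef fe)
  then have n1: "h p1 p1 = 1"
    unfolding sq[OF w(1)] complex_norm_square[symmetric] by (simp add: distort_def u1_def)
  have "h p2 p2 = ((of_real d * K 0) * cnj (of_real d * K 0)) * (u3 * cnj u3)
      - (of_real (sqrt (distort (K 3) t3)) * of_real (sqrt (distort (K 3) t3))) * (z * cnj z)"
    by (simp add: p2 h_simps ee ff ef fe mult_ac)
  then have n2: "h p2 p2 = 1"
    unfolding sq[OF w(2)] zz dK unfolding complex_norm_square[symmetric] by (simp add: distort_def u3_def)
  have g1: "h p1 e = u1" by (simp add: p1 h_simps ee fe)
  have "h p2 p1 = cnj (of_real d * cnj (K 0) * u3 * u1)
      - of_real (sqrt (distort (K 1) t1) * sqrt (distort (K 3) t3)) * z"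
    by (simp add: p1 p2 h_simps ee ff ef fe mult_ac)
  then have g2: "h p2 p1 = u2" unfolding con by simp
  have "h e p2 = of_real d * cnj (K 0) * u3" by (simp add: p2 h_simps ee ef)
  then have "h ((of_real d * K 0) *s e) p2 = ((of_real d * K 0) * cnj (of_real d * K 0)) * u3"
    by (simp add: h_simps mult_ac)
  then have g3: "h ((of_real d * K 0) *s e) p2 = u3" unfolding dK by simp
  have n3: "h ((of_real d * K 0) *s e) ((of_real d * K 0) *s e) = 1"
  proof -
    have "h (y *s e) (y *s e) = y * cnj y" for y by (simp add: h_simps ee)
    then show ?thesis using dK by (rule trans)
  qed
  define v1 where "v1 = p1 - K 1 *s e"
  define v2 where "v2 = p2 - K 2 *s p1"
  define v3 where "v3 = (of_real d * K 0) *s e - K 3 *s p2"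
  note c1 = rot_centre[OF ee n1 K[of 1] g1[unfolded u1_def vertex_u_def] t(1), folded v1_def]
  note c2 = rot_centre[OF n1 n2 K[of 2] g2[unfolded u2_def vertex_u_def] t(2), folded v2_def]
  note c3 = rot_centre[OF n2 n3 K[of 3] g3[unfolded u3_def vertex_u_def] t(3), folded v3_def]
  have lc: "lift_centre T a x 0 = e" "lift_centre T a x 1 = v1" "lift_centre T a x 2 = v2" "lift_centre T a x 3 = v3"
    by (simp_all add: lift_centre_def v1_def v2_def v3_def p1_def p2_def K_def xx)
  have posj: "Re (h (lift_centre T a x j) (lift_centre T a x j)) > 0" for j
    using index_cases[of j] lc c1(1) c2(1) c3(1) ee by auto
  then show "Re (h (lift_centre T a x j) (lift_centre T a x j)) > 0" .
  have BV: "line (lift_centre T a x j) \<in> BV h" for j using posj by (rule BV_line)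
  define G where "G y = rot h v3 (K 3) (rot h v2 (K 2) (rot h v1 (K 1) (rot h e (K 0) y)))" for y
  have Ge: "G e = of_real d *s e"
  proof -
    have "cnj (K 0) * (of_real d * K 0) = of_real d" using unit_cnj[OF K(1)[of 0]] by (simp add: mult_ac)
    then show ?thesis unfolding G_def using rot_self[of e "K 0"] ee c1(2) c2(2) c3(2) by (simp add: rot_scale)
  qed
  have Re_e: "Re (h e e) > 0" using ee by simp
  have Gh: "h (G x) (G y) = h x y" for x y unfolding G_def using c1(1) c2(1) c3(1) Re_e K by (simp add: h_rot)
  have Gw: "wedge (G x) (G y) = wedge x y" for x y unfolding G_def using c1(1) c2(1) c3(1) Re_e K by (simp add: wedge_rot)
  have d2: "complex_of_real d * of_real d = 1" using d by auto
  have "G y = of_real d *s y" for y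
  proof -
    have "of_real d * h (G y) e = h y e" using Gh[of y e] by (simp add: Ge h_simps)
    moreover have "of_real d * h (G y) f = h y f" using Gw[of e y] by (simp add: Ge wedge_def h_simps ee ef)
    ultimately show ?thesis
      using d2 by (simp add: eq_iff_coords[of "G y"] h_simps) (metis mult.assoc mult_1)
  qed
  then have "trivial_in_PU G" unfolding trivial_in_PU_def using d by (intro exI[of _ "of_real d"]) auto
  moreover have "G = prot h (line (lift_centre T a x 3)) (turn T a 3) \<circ> prot h (line (lift_centre T a x 2)) (turn T a 2)
     \<circ> prot h (line (lift_centre T a x 1)) (turn T a 1) \<circ> prot h (line (lift_centre T a x 0)) (turn T a 0)"
    using c1(1) c2(1) c3(1) Re_e by (simp add: prot_line lc G_def K_def fun_eq_iff)
  ultimately show "(\<lambda>j. line (lift_centre T a x j)) \<in> quads h a T" using BV by (simp add: quads_iff)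
  have "ta h v3 ((of_real d * K 0) *s e) = t3"
    using c3 h_rot_self(2)[OF c3(1) unit_pos[OF n2] K(1)[of 3]] by simp
  then have "ta h v3 e = t3" using ta_scale[OF dK] by simp
  moreover have "ta h v1 p1 = t1" using c1 h_rot_self(2)[OF c1(1) Re_e K(1)[of 1]] by simp
  moreover have "ta h v2 p2 = t2" using c2 h_rot_self(2)[OF c2(1) unit_pos[OF n1] K(1)[of 2]] by simp
  ultimately show "vertex_t h a T (\<lambda>j. line (lift_centre T a x j)) = fst x"
    using vertex_t_lines[OF Re_e c1(1) c2(1) c3(1), of "\<lambda>j. line (lift_centre T a x j)" a T] BV c1(2) c2(2) lc
    by (simp add: xx flip: K_def)
qed

end

section \<open>Topology of the space of hexagons\<close>

lemma continuous_on_vector_scalar_mult [continuous_intros]: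
  fixes F :: "'a :: topological_space \<Rightarrow> complex" and G :: "'a \<Rightarrow> cvec"
  assumes "continuous_on S F" "continuous_on S G"
  shows "continuous_on S (\<lambda>x. F x *s G x)"
  unfolding vector_scalar_mult_def using assms by (intro continuous_intros)

lemma clopen_connected_component:
  assumes "openin X C" "closedin X C" "connectedin X C" "C \<noteq> {}"
  shows "C \<in> connected_components_of X"
proof -
  have "X \<noteq> trivial_topology" using assms openin_subset by fastforce
  then obtain D where D: "D \<in> connected_components_of X" "C \<subseteq> D"
    using exists_connected_component_of_superset assms(3) by blast
  have "D \<subseteq> C"
    using connectedin_clopen_cases[OF connectedin_connected_components_of[OF D(1)] assms(2,1)] D(2) assms(4)
    by (auto simp: disjnt_def)
  then show ?thesis using D by simp
qed

context hermitian_plane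
begin

lemma continuous_h [continuous_intros]:
  fixes F G :: "'a :: topological_space \<Rightarrow> cvec"
  assumes "continuous_on S F" "continuous_on S G"
  shows "continuous_on S (\<lambda>x. h (F x) (G x))"
proof -
  have 1: "h v w = v $ 1 * h (axis 1 1) w + v $ 2 * h (axis 2 1) w" for v w
  proof -
    have "v = (v $ 1) *s axis 1 1 + (v $ 2) *s axis 2 1"
      by (simp add: vec_eq_iff forall_2 axis_def)
    then have "h v w = h ((v $ 1) *s axis 1 1 + (v $ 2) *s axis 2 1) w" by simp
    then show ?thesis by (simp only: h_simps)
  qed
  have lin: "continuous_on S (\<lambda>x. h (F x) w)" if "continuous_on S F" for F :: "'a \<Rightarrow> cvec" and w
  proof -
    have "continuous_on S (\<lambda>x. F x $ 1 * h (axis 1 1) w + F x $ 2 * h (axis 2 1) w)"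
      using that by (intro continuous_intros)
    then show ?thesis by (rule continuous_on_eq) (rule 1[symmetric])
  qed
  have "continuous_on S (\<lambda>x. h (F x) e * cnj (h (G x) e) - h (F x) f * cnj (h (G x) f))"
    by (intro continuous_intros lin assms)
  then show ?thesis by (rule continuous_on_eq) (rule h_coords[symmetric])
qed

lemma continuous_rot [continuous_intros]:
  fixes F G :: "'a :: topological_space \<Rightarrow> cvec"
  assumes "continuous_on S F" "continuous_on S G" "\<And>x. x \<in> S \<Longrightarrow> h (F x) (F x) \<noteq> 0"
  shows "continuous_on S (\<lambda>x. rot h (F x) k (G x))"
  unfolding rot_def using assms by (intro continuous_intros) auto

lemma continuous_ta [continuous_intros]:
  fixes F G :: "'a :: topological_space \<Rightarrow> cvec"
  assumes "continuous_on S F" "continuous_on S G" "\<And>x. x \<in> S \<Longrightarrow> h (F x) (F x) \<noteq> 0"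
    "\<And>x. x \<in> S \<Longrightarrow> h (G x) (G x) \<noteq> 0"
  shows "continuous_on S (\<lambda>x. ta h (F x) (G x))"
  unfolding ta_def using assms by (intro continuous_intros) auto

lemma line_eq_iff:
  assumes "v \<noteq> 0"
  shows "line v = line w \<longleftrightarrow> (\<exists>s. s \<noteq> 0 \<and> v = s *s w)"
proof
  assume "line v = line w"
  then have "v \<in> line w" by (metis line_def vec.span_base singletonI)
  then show "\<exists>s. s \<noteq> 0 \<and> v = s *s w" using assms by (auto simp: line_def vec.span_singleton)
qed (auto simp: line_scale)

lemma line_mem_BV:
  assumes "v \<noteq> 0"
  shows "line v \<in> BV h \<longleftrightarrow> Re (h v v) > 0"
proof
  assume "line v \<in> BV h"
  then obtain w where w: "line v = line w" "Re (h w w) > 0" by (auto simp: BV_def)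
  then obtain s where s: "s \<noteq> 0" "v = s *s w" using line_eq_iff assms by blast
  have "h v v = (s * cnj s) * of_real (Re (h w w))"
    using h_self_real[of w] by (simp add: s h_simps)
  then have "h v v = of_real ((cmod s)\<^sup>2 * Re (h w w))"
    unfolding complex_norm_square[symmetric] by simp
  then show "Re (h v v) > 0" using w s by simp
qed (rule BV_line)

lemma openin_BV: "openin projective_line (BV h)"
proof -
  have "{x \<in> topspace (top_of_set (- {0})). line x \<in> BV h} = {x. 0 < Re (h x x)}"
    using line_mem_BV h_self_nonzero(2) by auto
  moreover have "openin (top_of_set (- {0})) {x. 0 < Re (h x x)}"
    using h_self_nonzero(2) by (intro open_subset open_Collect_less continuous_intros) auto
  moreover have "BV h \<subseteq> line ` topspace (top_of_set (- {0}))" by (auto simp: BV_def)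
  ultimately show ?thesis unfolding projective_line_def openin_quotient_topology by simp
qed

text \<open>\<open>rep\<close> is an arbitrary choice and need not be continuous. Scaling the
  \<open>e\<close>-component to 1 is continuous on \<open>BV h\<close>, since no positive vector is
  orthogonal to \<open>e\<close>.\<close>

definition affine_rep :: "point \<Rightarrow> cvec" where
  "affine_rep L = inverse (h (rep L) e) *s rep L"

lemma h_e_nonzero: "Re (h v v) > 0 \<Longrightarrow> h v e \<noteq> 0"
  using h_nonzero[of v e] ee by simp

lemma affine_rep_line:
  assumes "Re (h v v) > 0"
  shows "affine_rep (line v) = inverse (h v e) *s v"
proof -
  obtain s where "s \<noteq> 0" "rep (line v) = s *s v" by (rule rep_line[OF h_self_nonzero(2)[OF assms]])
  then show ?thesis using h_e_nonzero[OF assms] by (simp add: affine_rep_def h_simps)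
qed

lemma affine_rep:
  assumes "L \<in> BV h"
  shows "Re (h (affine_rep L) (affine_rep L)) > 0" "L = line (affine_rep L)"
proof -
  obtain v where v: "L = line v" "h v v = 1" using BV_unit assms by blast
  have s: "inverse (h v e) \<noteq> 0" using h_e_nonzero v by simp
  show "L = line (affine_rep L)" using affine_rep_line v s by (simp add: line_scale)
  then have "line (affine_rep L) \<in> BV h" using assms by simp
  moreover have "affine_rep L \<noteq> 0" using affine_rep_line v s h_self_nonzero(2)[of v] by auto
  ultimately show "Re (h (affine_rep L) (affine_rep L)) > 0" using line_mem_BV by blast
qed

lemma continuous_affine_rep: "continuous_map (subtopology projective_line (BV h)) euclidean affine_rep"
proof (rule continuous_compose_quotient_map)
  let ?U = "{x. Re (h x x) > 0}"
  have eq: "{x \<in> topspace (top_of_set (- {0})). line x \<in> BV h} = ?U"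
    using line_mem_BV h_self_nonzero(2) by auto
  show "quotient_map (subtopology (top_of_set (- {0})) ?U) (subtopology projective_line (BV h)) line"
    using openin_BV unfolding projective_line_def
    by (intro quotient_map_restriction[OF quotient_map_quotient_topology eq]) simp
  have sub: "- {0} \<inter> ?U = ?U" using h_self_nonzero(2) by auto
  have "continuous_on ?U (\<lambda>v. inverse (h v e) *s v)"
    using h_e_nonzero by (intro continuous_intros) auto
  then have "continuous_on ?U (affine_rep \<circ> line)"
    by (rule continuous_on_cong[THEN iffD1, rotated 2]) (auto simp: affine_rep_line)
  then show "continuous_map (subtopology (top_of_set (- {0})) ?U) euclidean (affine_rep \<circ> line)"
    by (simp add: subtopology_subtopology sub)
qed

abbreviation quad_space :: "(4 \<Rightarrow> real) \<Rightarrow> hexagon_type \<Rightarrow> quad topology" where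
  "quad_space a T \<equiv> subtopology (product_topology (\<lambda>_. projective_line) UNIV) (quads h a T)"

lemma quads_BV: "c \<in> quads h a T \<Longrightarrow> c j \<in> BV h"
  by (simp add: quads_def)

lemma topspace_quad_space: "topspace (quad_space a T) = quads h a T"
proof -
  have "BV h \<subseteq> topspace projective_line" using openin_BV by (rule openin_subset)
  then have "quads h a T \<subseteq> PiE UNIV (\<lambda>_. topspace projective_line)" using quads_BV by fastforce
  then show ?thesis by (simp add: topspace_subtopology Int_absorb1)
qed

lemma continuous_vertex_t: "continuous_map (quad_space a T) euclidean (vertex_t h a T)"
proof -
  let ?w = "\<lambda>(c :: quad) j. affine_rep (c j)"
  let ?D = "{(v0, v1, v2, v3). Re (h v0 v0) > 0 \<and> Re (h v1 v1) > 0 \<and> Re (h v2 v2) > 0 \<and> Re (h v3 v3) > 0}"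
  let ?F = "\<lambda>(p, v1, v2, v3). (ta h v1 (rot h v1 (turn T a 1) p),
     ta h v2 (rot h v2 (turn T a 2) (rot h v1 (turn T a 1) p)), ta h v3 p)"
  have w: "continuous_map (quad_space a T) euclidean (\<lambda>c. ?w c j)" for j
  proof -
    have "continuous_map (quad_space a T) (subtopology projective_line (BV h)) (\<lambda>c. c j)"
      using quads_BV
      by (intro continuous_map_into_subtopology continuous_map_from_subtopology continuous_map_product_projection)
        (auto simp: topspace_quad_space)
    then show ?thesis using continuous_map_compose[OF _ continuous_affine_rep] by (fastforce simp: o_def)
  qed
  have "continuous_map (quad_space a T) (prod_topology euclidean (prod_topology euclidean (prod_topology euclidean euclidean)))
     (\<lambda>c. (?w c 0, ?w c 1, ?w c 2, ?w c 3))"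
    by (intro continuous_map_pairedI w)
  then have "continuous_map (quad_space a T) (top_of_set ?D) (\<lambda>c. (?w c 0, ?w c 1, ?w c 2, ?w c 3))"
    using affine_rep(1) quads_BV
    by (intro continuous_map_into_subtopology) (auto simp: topspace_quad_space)
  moreover have "continuous_on ?D ?F"
    unfolding case_prod_unfold using h_self_nonzero(1)
    by (intro continuous_intros) (auto simp: h_rot cmod_turn)
  ultimately have "continuous_map (quad_space a T) euclidean (?F \<circ> (\<lambda>c. (?w c 0, ?w c 1, ?w c 2, ?w c 3)))"
    by (intro continuous_map_compose) auto
  then show ?thesis
  proof (rule continuous_map_eq)
    fix c assume "c \<in> topspace (quad_space a T)"
    then have c: "c j \<in> BV h" for j using quads_BV topspace_quad_space by blast
    show "(?F \<circ> (\<lambda>c. (?w c 0, ?w c 1, ?w c 2, ?w c 3))) c = vertex_t h a T c"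
      using vertex_t_lines[OF affine_rep(1)[OF c[of 0]] affine_rep(1)[OF c[of 1]] affine_rep(1)[OF c[of 2]]
          affine_rep(1)[OF c[of 3]] affine_rep(2)[OF c] affine_rep(2)[OF c] affine_rep(2)[OF c] affine_rep(2)[OF c] c]
      by simp
  qed
qed

lemma continuous_lift:
  assumes a: "\<And>j. 0 < a j \<and> a j < pi"
  shows "continuous_map (top_of_set (phases T a)) (quad_space a T) (\<lambda>x j. line (lift_centre T a x j))"
proof (intro continuous_map_into_subtopology)
  have p: "continuous_on (phases T a) (lift_p1 T a)" "continuous_on (phases T a) (lift_p2 T a)"
    unfolding lift_p1_def lift_p2_def case_prod_unfold vertex_u_def distort_def
    by (intro continuous_intros)+
  have "continuous_on (phases T a) (\<lambda>x. lift_centre T a x j)" for j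
    using index_cases[of j] p by (elim disjE) (auto simp: lift_centre_def intro!: continuous_intros)
  then have 1: "continuous_map (top_of_set (phases T a)) (top_of_set (- {0})) (\<lambda>x. lift_centre T a x j)" for j
    using lift_centre(1)[OF a] h_self_nonzero(2) by (force simp: continuous_map_in_subtopology)
  have 2: "continuous_map (top_of_set (- {0})) projective_line line"
    unfolding projective_line_def by (intro quotient_imp_continuous_map quotient_map_quotient_topology)
  show "continuous_map (top_of_set (phases T a)) (product_topology (\<lambda>_. projective_line) UNIV)
     (\<lambda>x j. line (lift_centre T a x j))"
    unfolding continuous_map_componentwise_UNIV
    using continuous_map_compose[OF 1 2] by (simp add: o_def)
qed (use lift_centre(2)[OF a] in auto)

lemma vertex_t_mem:
  assumes a: "\<And>j. 0 < a j \<and> a j < pi" and c: "c \<in> quads h a T"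
  shows "vertex_t h a T c \<in> both_solutions a"
proof -
  obtain t1 t2 t3 where t: "vertex_t h a T c = (t1, t2, t3)" using prod_cases3 by blast
  show ?thesis by (rule hexagon_data[OF c a t]) (auto simp: t)
qed

text \<open>Composed with the lift it becomes the map forgetting phases, which is already known to
  be a quotient map; this avoids a continuous section.\<close>

lemma quotient_map_vertex_t:
  assumes a: "\<And>j. 0 < a j \<and> a j < pi"
  shows "quotient_map (quad_space a T) (top_of_set (both_solutions a)) (vertex_t h a T)"
proof (rule quotient_map_from_composition)
  show "continuous_map (top_of_set (phases T a)) (quad_space a T) (\<lambda>x j. line (lift_centre T a x j))"
    by (rule continuous_lift[OF a])
  show "continuous_map (quad_space a T) (top_of_set (both_solutions a)) (vertex_t h a T)"
    using continuous_vertex_t vertex_t_mem[OF a]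
    by (intro continuous_map_into_subtopology) (auto simp: topspace_quad_space)
  show "quotient_map (top_of_set (phases T a)) (top_of_set (both_solutions a))
     (vertex_t h a T \<circ> (\<lambda>x j. line (lift_centre T a x j)))"
    by (rule quotient_map_eq[OF quotient_map_phases]) (simp add: lift_centre(3)[OF a])
qed

section \<open>Orbits and the homeomorphism onto the parameters\<close>

lemma unitary_id: "unitary h (\<lambda>x. x)"
  using vec.linear_id by (simp add: unitary_def bij_def id_def)

lemma orbit_self: "c \<in> orbit h c"
  unfolding orbit_def using unitary_id by force

lemma unitary_comp: "unitary h g \<Longrightarrow> unitary h g' \<Longrightarrow> unitary h (g \<circ> g')"
  unfolding unitary_def by (auto intro: bij_comp Vector_Spaces.linear_compose)

lemma orbit_trans: "d \<in> orbit h c \<Longrightarrow> orbit h d \<subseteq> orbit h c"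
proof
  fix x assume "d \<in> orbit h c" "x \<in> orbit h d"
  then obtain g g' where "unitary h g" "unitary h g'" "d = (\<lambda>j. g ` c j)" "x = (\<lambda>j. g' ` d j)"
    by (auto simp: orbit_def)
  then have "unitary h (g' \<circ> g)" "x = (\<lambda>j. (g' \<circ> g) ` c j)" by (auto simp: unitary_comp image_comp)
  then show "x \<in> orbit h c" unfolding orbit_def by blast
qed

lemma hexagon_t_orbit:
  assumes "c \<in> quads h a T"
  shows "hexagon_t h a (T, orbit h c) = vertex_t h a T c"
proof -
  have "(SOME d. d \<in> orbit h c) \<in> orbit h c" by (rule someI[of "\<lambda>d. d \<in> orbit h c", OF orbit_self])
  then show ?thesis using vertex_t_orbit[OF herm quads_BV[OF assms]] by simp
qed

abbreviation hexagon_type_space :: "(4 \<Rightarrow> real) \<Rightarrow> hexagon_type \<Rightarrow> quad set topology" where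
  "hexagon_type_space a T \<equiv> quotient_topology (quad_space a T) (orbit h)"

lemma hexagon_space_eq: "hexagon_space h a = sum_topology (hexagon_type_space a) UNIV"
  by (simp add: hexagon_space_def)

text \<open>The fibres of the quotient map \<open>vertex_t\<close> are the orbits, and an injective
  quotient map is a homeomorphism.\<close>

lemma homeomorphic_map_hexagon_type:
  assumes a: "\<And>j. 0 < a j \<and> a j < pi"
  shows "homeomorphic_map (hexagon_type_space a T)
     (top_of_set (both_solutions a)) (\<lambda>P. hexagon_t h a (T, P))"
proof -
  have q: "quotient_map (quad_space a T) (top_of_set (both_solutions a))
     ((\<lambda>P. hexagon_t h a (T, P)) \<circ> orbit h)"
    by (rule quotient_map_eq[OF quotient_map_vertex_t[OF a]]) (simp only: topspace_quad_space hexagon_t_orbit o_apply)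
  then have "quotient_map (hexagon_type_space a T) (top_of_set (both_solutions a))
     (\<lambda>P. hexagon_t h a (T, P))"
    using quotient_map_compose_eq[OF quotient_map_quotient_topology] by blast
  moreover have "inj_on (\<lambda>P. hexagon_t h a (T, P)) (topspace (hexagon_type_space a T))"
  proof (rule inj_onI)
    fix P Q assume PQ: "P \<in> topspace (hexagon_type_space a T)" "Q \<in> topspace (hexagon_type_space a T)"
      and eq: "hexagon_t h a (T, P) = hexagon_t h a (T, Q)"
    obtain c d where cd: "c \<in> quads h a T" "d \<in> quads h a T" "P = orbit h c" "Q = orbit h d"
      using PQ unfolding topspace_quotient_topology topspace_quad_space by blast
    then have "vertex_t h a T c = vertex_t h a T d" using eq by (simp only: hexagon_t_orbit)
    then have "d \<in> orbit h c" "c \<in> orbit h d"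
      using orbit_unique[OF a cd(1,2)] orbit_unique[OF a cd(2,1)] by simp_all
    then show "P = Q" using orbit_trans cd by blast
  qed
  ultimately show ?thesis by (simp add: homeomorphic_map_def)
qed

lemma hexagons_over_eq:
  "hexagons_over h a T E = {T} \<times> {P \<in> topspace (hexagon_type_space a T). hexagon_t h a (T, P) \<in> E}"
  by (auto simp: hexagons_over_def hexagon_space_eq)

lemma embedding_type: "embedding_map (hexagon_type_space a T) (hexagon_space h a) (Pair T)"
  unfolding hexagon_space_eq by (rule embedding_map_component_injection) simp

lemma homeomorphic_map_hexagons_over:
  assumes a: "\<And>j. 0 < a j \<and> a j < pi" and E: "E \<subseteq> both_solutions a"
  shows "homeomorphic_map (subtopology (hexagon_space h a) (hexagons_over h a T E)) (top_of_set E) (hexagon_t h a)"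
proof -
  let ?E = "both_solutions a"
  let ?Y = "subtopology (hexagon_space h a) (Pair T ` topspace (hexagon_type_space a T))"
  have p: "homeomorphic_map (hexagon_type_space a T) ?Y (Pair T)"
    using embedding_type unfolding embedding_map_def .
  then obtain g where g: "homeomorphic_maps (hexagon_type_space a T) ?Y (Pair T) g"
    using homeomorphic_map_maps by blast
  then have "homeomorphic_map ?Y (hexagon_type_space a T) g"
    by (metis homeomorphic_map_maps homeomorphic_maps_sym)
  then have "homeomorphic_map ?Y (top_of_set ?E) ((\<lambda>P. hexagon_t h a (T, P)) \<circ> g)"
    by (rule homeomorphic_map_compose[OF _ homeomorphic_map_hexagon_type[OF a]])
  then have Y: "homeomorphic_map ?Y (top_of_set ?E) (hexagon_t h a)"
  proof (rule homeomorphic_map_eq)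
    fix x assume "x \<in> topspace ?Y"
    then have "Pair T (g x) = x" using g by (simp add: homeomorphic_maps_def)
    then show "((\<lambda>P. hexagon_t h a (T, P)) \<circ> g) x = hexagon_t h a x" by (simp del: hexagon_t.simps)
  qed
  have "homeomorphic_map (subtopology ?Y (hexagons_over h a T E)) (subtopology (top_of_set ?E) E) (hexagon_t h a)"
  proof (rule homeomorphic_map_subtopologies_alt[OF Y])
    fix x assume "x \<in> topspace ?Y" "hexagon_t h a x \<in> topspace (top_of_set ?E)"
    then show "hexagon_t h a x \<in> E \<longleftrightarrow> x \<in> hexagons_over h a T E"
      by (auto simp: hexagons_over_eq)
  qed
  moreover have "Pair T ` topspace (hexagon_type_space a T) \<inter> hexagons_over h a T E = hexagons_over h a T E"
    by (auto simp: hexagons_over_eq)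
  ultimately show ?thesis using E by (simp add: subtopology_subtopology Int_absorb1)
qed

lemma closed_signed_solutions: "closed (signed_solutions d a)"
proof -
  have eq: "signed_solutions d a = {x. 1 \<le> fst x \<and> 1 \<le> fst (snd x) \<and> 1 \<le> snd (snd x) \<and>
     1 + 2 * d * Re (cnj (cis (a 0)) * u_coeff a 1 (fst x) * u_coeff a 2 (fst (snd x)) * u_coeff a 3 (snd (snd x))) =
     (cmod (u_coeff a 1 (fst x)))\<^sup>2 + (cmod (u_coeff a 2 (fst (snd x))))\<^sup>2 + (cmod (u_coeff a 3 (snd (snd x))))\<^sup>2}"
    by (auto simp: signed_solutions_def)
  show ?thesis unfolding eq u_coeff_def
    by (intro closed_Collect_conj closed_Collect_eq closed_Collect_le continuous_intros)
qed

lemma closedin_hexagons_over: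
  assumes a: "\<And>j. 0 < a j \<and> a j < pi" and d: "d = 1 \<or> d = -1"
  shows "closedin (hexagon_space h a) (hexagons_over h a T (signed_solutions d a))"
proof -
  have c: "continuous_map (hexagon_type_space a T) euclidean (\<lambda>P. hexagon_t h a (T, P))"
    using homeomorphic_imp_continuous_map[OF homeomorphic_map_hexagon_type[OF a]]
    by (simp add: continuous_map_in_subtopology)
  have "closedin (hexagon_type_space a T) {P \<in> topspace (hexagon_type_space a T). hexagon_t h a (T, P) \<in> signed_solutions d a}"
    using closedin_continuous_map_preimage[OF c] closed_signed_solutions by auto
  then show ?thesis
    unfolding hexagon_space_eq closedin_sum_topology hexagons_over_eq
    by (auto simp: Collect_conj_eq split: if_splits)
qed

end

section \<open>The isometry \<open>R\<^sub>0 R\<^sub>3\<close>\<close>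

context hermitian_plane
begin

text \<open>The minus sign compensates \<open>h f f = -1\<close>: the products of
  \<open>e - z *s f\<close> with \<open>e\<close> and \<open>f\<close> are 1 and \<open>z\<close>.
  In this coordinate the absolute is the unit circle.\<close>

lemma line_eq_iff_slope:
  "line (e - z *s f) = line (e - z' *s f) \<longleftrightarrow> z = z'"
proof
  assume *: "line (e - z *s f) = line (e - z' *s f)"
  have x: "h (e - z *s f) e = 1" "h (e - z *s f) f = z" for z
    by (simp_all add: h_minus h_simps ee ff ef fe)
  then have "e - z *s f \<noteq> 0" by (metis h_zero(1) zero_neq_one)
  then obtain s where s: "e - z *s f = s *s (e - z' *s f)" using * line_eq_iff by blast
  have "h (e - z *s f) y = s * h (e - z' *s f) y" for y by (simp only: s h_simps)
  then show "z = z'" using x by (metis mult_1 mult_1_right)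
qed simp

text \<open>The quadratic has discriminant \<open>4 ((Re A)\<^sup>2 - 1)\<close>, so the trace decides the kind of the isometry.\<close>
lemma fixes_line_iff:
  assumes lin: "Vector_Spaces.linear (*s) (*s) g"
    and ge: "\<And>x. h (g x) e = A * h x e + B * h x f" and gf: "\<And>x. h (g x) f = cnj B * h x e + cnj A * h x f"
    and det: "A * cnj A - B * cnj B = 1"
  shows "g ` line (e - z *s f) = line (e - z *s f) \<longleftrightarrow> B * z\<^sup>2 + (A - cnj A) * z - cnj B = 0"
proof -
  define x where "x = e - z *s f"
  have x: "h x e = 1" "h x f = z"
    by (simp_all add: x_def h_minus h_simps ee ff ef fe)
  have gx: "h (g x) e = A + B * z" "h (g x) f = cnj B + cnj A * z" by (simp_all add: ge gf x)
  have nz: "g x \<noteq> 0"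
  proof
    assume "g x = 0"
    then have "A + B * z = 0" "cnj B + cnj A * z = 0" using gx by (simp_all add: h_zero)
    then show False using det by algebra
  qed
  have "g ` line x = line x \<longleftrightarrow> line (g x) = line x" by (simp add: linear_image_line[OF lin])
  also have "\<dots> \<longleftrightarrow> (\<exists>s. s \<noteq> 0 \<and> g x = s *s x)" by (rule line_eq_iff[OF nz])
  also have "\<dots> \<longleftrightarrow> cnj B + cnj A * z = (A + B * z) * z"
  proof
    assume "\<exists>s. s \<noteq> 0 \<and> g x = s *s x"
    then obtain s where "g x = s *s x" by blast
    then have "h (g x) e = s" "h (g x) f = s * z" by (simp_all only: h_simps x mult_1_right)
    then show "cnj B + cnj A * z = (A + B * z) * z" unfolding gx[symmetric] by simp
  next
    assume eq: "cnj B + cnj A * z = (A + B * z) * z"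
    then have "g x = (A + B * z) *s x" unfolding eq_iff_coords[of "g x"] by (simp only: gx h_simps x mult_1_right)
    then show "\<exists>s. s \<noteq> 0 \<and> g x = s *s x" using nz by (metis vector_smult_lzero)
  qed
  also have "\<dots> \<longleftrightarrow> B * z\<^sup>2 + (A - cnj A) * z - cnj B = 0"
  proof
    show "B * z\<^sup>2 + (A - cnj A) * z - cnj B = 0" if "cnj B + cnj A * z = (A + B * z) * z"
      using that by algebra
    show "cnj B + cnj A * z = (A + B * z) * z" if "B * z\<^sup>2 + (A - cnj A) * z - cnj B = 0"
      using that by algebra
  qed
  finally show ?thesis by (simp add: x_def)
qed

lemma fixes_line_square:
  fixes A B z :: complex
  assumes "B \<noteq> 0" "A * cnj A - B * cnj B = 1"
  shows "B * z\<^sup>2 + (A - cnj A) * z - cnj B = 0 \<longleftrightarrow> (B * z + \<i> * of_real (Im A))\<^sup>2 = of_real ((Re A)\<^sup>2 - 1)"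
proof -
  define I where "I = complex_of_real (Im A)"
  have A: "A - cnj A = 2 * \<i> * I" by (simp add: I_def complex_eq_iff)
  have n: "A * cnj A = of_real ((Re A)\<^sup>2) + I\<^sup>2"
    unfolding I_def complex_norm_square[symmetric] by (simp add: cmod_power2)
  have i: "\<i> * \<i> = -1" by simp
  have "B * (B * z\<^sup>2 + (A - cnj A) * z - cnj B) = (B * z + \<i> * I)\<^sup>2 - (of_real ((Re A)\<^sup>2) - 1)"
    unfolding A using assms(2) n i by algebra
  then show ?thesis using assms(1) unfolding I_def of_real_diff of_real_1
    by (metis eq_iff_diff_eq_0 mult_eq_0_iff)
qed

lemma elliptic_if:
  assumes lin: "Vector_Spaces.linear (*s) (*s) g"
    and ge: "\<And>x. h (g x) e = A * h x e + B * h x f" and gf: "\<And>x. h (g x) f = cnj B * h x e + cnj A * h x f"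
    and det: "A * cnj A - B * cnj B = 1" and tr: "\<bar>Re A\<bar> < 1"
  shows "elliptic h g"
proof -
  have "\<not> trivial_in_PU g"
  proof
    assume "trivial_in_PU g"
    then obtain l where l: "\<And>v. g v = l *s v" by (auto simp: trivial_in_PU_def)
    have "A = l" "cnj A = l" "B = 0"
      using ge[of e] gf[of f] ge[of f] by (simp_all add: l h_simps ee ff ef fe)
    then have "A * A = 1" "Im A = 0" using det by (simp_all add: complex_eq_iff)
    then have "(Re A)\<^sup>2 = 1" by (simp add: complex_eq_iff power2_eq_square)
    then show False using tr by (simp add: power2_eq_1_iff abs_if split: if_splits)
  qed
  moreover have "\<exists>L \<in> BV h. g ` L = L"
  proof -
    have "\<exists>z. cmod z < 1 \<and> B * z\<^sup>2 + (A - cnj A) * z - cnj B = 0"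
    proof (cases "B = 0")
      case True then show ?thesis by (intro exI[of _ 0]) simp
    next
      case False
      define q where "q = sqrt (1 - (Re A)\<^sup>2)"
      define I where "I = Im A"
      have r: "(Re A)\<^sup>2 < 1" using tr by (simp add: abs_square_less_1)
      then have q: "q > 0" "q\<^sup>2 = 1 - (Re A)\<^sup>2" by (auto simp: q_def)
      have "complex_of_real ((cmod A)\<^sup>2 - (cmod B)\<^sup>2) = of_real 1"
        using det unfolding of_real_diff complex_norm_square by simp
      then have "(cmod A)\<^sup>2 - (cmod B)\<^sup>2 = 1" using of_real_eq_iff by blast
      then have B2: "(cmod B)\<^sup>2 = I\<^sup>2 - q\<^sup>2" using q by (simp add: cmod_power2 I_def)
      have "(cmod B)\<^sup>2 > 0" using False by simp
      then have "q\<^sup>2 < \<bar>I\<bar>\<^sup>2" using B2 by simp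
      then have qI: "q < \<bar>I\<bar>" by (rule power2_less_imp_less) simp
      \<comment> \<open>The fixed slopes are \<open>\<i> (s - I) / B\<close> with
        \<open>s = q\<close> or \<open>s = - q\<close>. Giving \<open>s\<close> the sign of
        \<open>I\<close> selects the root of smaller modulus, which lies in the unit disc.\<close>
      define s where "s = (if I \<ge> 0 then q else - q)"
      have s: "\<bar>s - I\<bar> = \<bar>I\<bar> - q" "s\<^sup>2 = q\<^sup>2" using qI q by (auto simp: s_def abs_if)
      define z where "z = \<i> * of_real (s - I) / B"
      have Bz: "B * z + \<i> * of_real I = \<i> * of_real s"
      proof -
        have "B * z = \<i> * of_real (s - I)" using False by (simp add: z_def)
        then show ?thesis by (simp add: algebra_simps)
      qed
      have "(\<i> * of_real s)\<^sup>2 = of_real ((Re A)\<^sup>2 - 1)"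
        using q s by (simp add: power_mult_distrib flip: of_real_power)
      then have 1: "B * z\<^sup>2 + (A - cnj A) * z - cnj B = 0"
        using fixes_line_square[OF False det, of z] Bz by (simp add: I_def)
      have "(\<bar>I\<bar> - q) * (\<bar>I\<bar> - q) < (\<bar>I\<bar> - q) * (\<bar>I\<bar> + q)"
        using qI q by (intro mult_strict_left_mono) auto
      also have "\<dots> = (cmod B)\<^sup>2" using B2 by (simp add: algebra_simps power2_eq_square)
      finally have "(\<bar>I\<bar> - q)\<^sup>2 < (cmod B)\<^sup>2" by (simp add: power2_eq_square)
      then have "\<bar>I\<bar> - q < cmod B" by (rule power2_less_imp_less) simp
      then have "cmod z < 1" using s False by (simp add: z_def norm_divide norm_mult del: of_real_diff)
      then show ?thesis using 1 by blast
    qed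
    then obtain z where z: "cmod z < 1" "B * z\<^sup>2 + (A - cnj A) * z - cnj B = 0" by blast
    have "Re (h (e - z *s f) (e - z *s f)) = 1 - (cmod z)\<^sup>2"
      unfolding h_self by (simp add: h_minus h_simps ee ff ef fe)
    moreover have "(cmod z)\<^sup>2 < 1" using z(1) by (simp add: abs_square_less_1)
    ultimately have "line (e - z *s f) \<in> BV h" by (intro BV_line) simp
    then show ?thesis using fixes_line_iff[OF lin ge gf det] z(2) by blast
  qed
  ultimately show ?thesis by (simp add: elliptic_def)
qed

lemma absolute_eq: "absolute h = {line (e - z *s f) | z. cmod z = 1}"
proof (intro subset_antisym subsetI)
  fix L assume "L \<in> absolute h"
  then obtain v where v: "L = line v" "v \<noteq> 0" "h v v = 0" by (auto simp: absolute_def)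
  then have eq: "cmod (h v e) = cmod (h v f)" using h_self[of v] by (simp add: power2_eq_iff_nonneg)
  have nz: "h v e \<noteq> 0"
  proof
    assume "h v e = 0"
    then have "h v f = 0" using eq by simp
    then show False using v \<open>h v e = 0\<close> eq_iff_coords[of v 0] by (simp add: h_zero)
  qed
  define z where "z = h v f / h v e"
  have "v = h v e *s (e - z *s f)"
    unfolding eq_iff_coords[of v] using nz by (simp add: h_simps h_minus ee ff ef fe z_def)
  then have "L = line (e - z *s f)" using v(1) nz line_scale by metis
  moreover have "cmod z = 1"
  proof -
    have "cmod (h v e) \<noteq> 0" using nz by simp
    then show ?thesis unfolding z_def norm_divide eq[symmetric] by simp
  qed
  ultimately show "L \<in> {line (e - z *s f) | z. cmod z = 1}" by blast
next
  fix L assume "L \<in> {line (e - z *s f) | z. cmod z = 1}"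
  then obtain z where z: "L = line (e - z *s f)" "cmod z = 1" by blast
  have x: "h (e - z *s f) e = 1" "h (e - z *s f) f = z"
    by (simp_all add: h_minus h_simps ee ff ef fe)
  then have "e - z *s f \<noteq> 0" by (metis h_zero(1) zero_neq_one)
  moreover have "h (e - z *s f) (e - z *s f) = 0"
    using h_coords[of "e - z *s f" "e - z *s f"] unit_cnj[OF z(2)] unfolding x by simp
  ultimately show "L \<in> absolute h" using z by (auto simp: absolute_def)
qed

text \<open>Now the square root of \<open>(Re A)\<^sup>2 - 1\<close> is real and positive, so the
  quadratic has two distinct roots; both have modulus 1 because
  \<open>(cmod B)\<^sup>2 = q\<^sup>2 + I\<^sup>2\<close>.\<close>

lemma hyperbolic_if:
  assumes lin: "Vector_Spaces.linear (*s) (*s) g"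
    and ge: "\<And>x. h (g x) e = A * h x e + B * h x f" and gf: "\<And>x. h (g x) f = cnj B * h x e + cnj A * h x f"
    and det: "A * cnj A - B * cnj B = 1" and tr: "Re A < - 1"
  shows "hyperbolic h g"
proof -
  define I where "I = Im A"
  define q where "q = sqrt ((Re A)\<^sup>2 - 1)"
  have r: "(Re A)\<^sup>2 > 1" using one_less_power[of "- Re A" 2] tr by simp
  then have q: "q > 0" "q\<^sup>2 = (Re A)\<^sup>2 - 1" by (auto simp: q_def)
  have "complex_of_real ((cmod A)\<^sup>2 - (cmod B)\<^sup>2) = of_real 1"
    using det unfolding of_real_diff complex_norm_square by simp
  then have "(cmod A)\<^sup>2 - (cmod B)\<^sup>2 = 1" using of_real_eq_iff by blast
  then have B2: "(cmod B)\<^sup>2 = q\<^sup>2 + I\<^sup>2" using q by (simp add: cmod_power2 I_def)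
  then have "(cmod B)\<^sup>2 > 0" using q(1) by (smt (verit) zero_le_power2 zero_less_power)
  then have B: "B \<noteq> 0" by auto
  define z1 z2 where "z1 = (of_real q - \<i> * of_real I) / B" and "z2 = (- of_real q - \<i> * of_real I) / B"
  have root: "B * z\<^sup>2 + (A - cnj A) * z - cnj B = 0 \<longleftrightarrow> z = z1 \<or> z = z2" for z
  proof -
    have "(of_real q)\<^sup>2 = complex_of_real ((Re A)\<^sup>2 - 1)" using q(2) by (simp flip: of_real_power)
    then have "B * z\<^sup>2 + (A - cnj A) * z - cnj B = 0 \<longleftrightarrow> (B * z + \<i> * of_real I)\<^sup>2 = (of_real q)\<^sup>2"
      using fixes_line_square[OF B det, of z] by (simp add: I_def)
    also have "\<dots> \<longleftrightarrow> B * z + \<i> * of_real I = of_real q \<or> B * z + \<i> * of_real I = - of_real q"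
      by (rule power2_eq_iff)
    also have "\<dots> \<longleftrightarrow> z = z1 \<or> z = z2" using B by (auto simp: z1_def z2_def field_simps)
    finally show ?thesis .
  qed
  have norm: "cmod z1 = 1" "cmod z2 = 1"
  proof -
    have "(cmod (of_real q - \<i> * of_real I))\<^sup>2 = (cmod B)\<^sup>2" "(cmod (- of_real q - \<i> * of_real I))\<^sup>2 = (cmod B)\<^sup>2"
      unfolding B2 by (simp_all add: cmod_power2)
    then have "cmod (of_real q - \<i> * of_real I) = cmod B" "cmod (- of_real q - \<i> * of_real I) = cmod B"
      by (simp_all add: power2_eq_iff_nonneg)
    then show "cmod z1 = 1" "cmod z2 = 1" using B by (simp_all add: z1_def z2_def norm_divide)
  qed
  have "z1 \<noteq> z2"
  proof
    assume "z1 = z2"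
    then have "complex_of_real q - \<i> * of_real I = - of_real q - \<i> * of_real I"
      using B by (simp add: z1_def z2_def)
    then show False using q by simp
  qed
  have "{L \<in> absolute h. g ` L = L} = {line (e - z1 *s f), line (e - z2 *s f)}"
    unfolding absolute_eq
  proof (intro subset_antisym subsetI)
    fix L assume "L \<in> {L \<in> {line (e - z *s f) |z. cmod z = 1}. g ` L = L}"
    then obtain z where "L = line (e - z *s f)" "g ` L = L" by blast
    then have "z = z1 \<or> z = z2" using fixes_line_iff[OF lin ge gf det, of z] root[of z] by simp
    then show "L \<in> {line (e - z1 *s f), line (e - z2 *s f)}" using \<open>L = line (e - z *s f)\<close> by blast
  next
    fix L assume "L \<in> {line (e - z1 *s f), line (e - z2 *s f)}"
    then obtain z where L: "L = line (e - z *s f)" and z: "z = z1 \<or> z = z2" by blast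
    then have "g ` L = L" using fixes_line_iff[OF lin ge gf det, of z] root[of z] by simp
    then show "L \<in> {L \<in> {line (e - z *s f) |z. cmod z = 1}. g ` L = L}" using L z norm by blast
  qed
  moreover have "line (e - z1 *s f) \<noteq> line (e - z2 *s f)" using \<open>z1 \<noteq> z2\<close> line_eq_iff_slope by blast
  ultimately show ?thesis by (simp add: hyperbolic_def)
qed

text \<open>The product is a matrix of SU(1,1), so \<open>Re A\<close> is half its trace. The entry
  \<open>A\<close> depends on \<open>v\<close> only through \<open>ta h v e\<close>, which makes the
  kind of the isometry a function of \<open>t3\<close>.\<close>

lemma rotation_product:
  assumes v: "h v v = 1" and k: "cmod k = 1" "cmod k0 = 1"
  obtains A B where "Vector_Spaces.linear (*s) (*s) (rot h e k0 \<circ> rot h v k)"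
    "\<And>x. h ((rot h e k0 \<circ> rot h v k) x) e = A * h x e + B * h x f"
    "\<And>x. h ((rot h e k0 \<circ> rot h v k) x) f = cnj B * h x e + cnj A * h x f"
    "A * cnj A - B * cnj B = 1" "A = cnj k0 * vertex_u k (ta h v e)"
proof -
  define G N where "G = h v e" and "N = h v f"
  have GN: "G * cnj G - N * cnj N = 1" using h_coords[of v v] v by (simp add: G_def N_def)
  have k': "k * cnj k = 1" "k0 * cnj k0 = 1" using k unit_cnj by auto
  define A where "A = cnj k0 * ((cnj k - k) * (G * cnj G) + k)"
  define B where "B = - cnj k0 * (cnj k - k) * G * cnj N"
  have xv: "h x v = h x e * cnj G - h x f * cnj N" for x using h_coords[of x v] by (simp add: G_def N_def)
  have r: "h (rot h v k x) y = (cnj k - k) * (h x e * cnj G - h x f * cnj N) * h v y + k * h x y" for x y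
    unfolding rot_def h_simps v unfolding xv by simp
  have r0: "h (rot h e k0 x) e = cnj k0 * h x e" "h (rot h e k0 x) f = k0 * h x f" for x
    unfolding rot_def h_simps ee ef by (simp_all add: algebra_simps)
  have "h ((rot h e k0 \<circ> rot h v k) x) e = A * h x e + B * h x f" for x
    unfolding o_apply r0 r A_def B_def by (simp add: G_def algebra_simps)
  moreover have "h ((rot h e k0 \<circ> rot h v k) x) f = cnj B * h x e + cnj A * h x f" for x
    unfolding o_apply r0 r A_def B_def N_def[symmetric] complex_cnj_mult complex_cnj_add complex_cnj_diff
      complex_cnj_cnj complex_cnj_minus using GN by algebra
  moreover have "A * cnj A - B * cnj B = 1"
    unfolding A_def B_def complex_cnj_mult complex_cnj_add complex_cnj_diff
      complex_cnj_cnj complex_cnj_minus using GN k' by algebra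
  moreover have "A = cnj k0 * vertex_u k (ta h v e)"
  proof -
    have "complex_of_real (ta h v e) = G * cnj G"
      unfolding ta_def h_cnj[of e v] G_def[symmetric] v ee complex_norm_square[symmetric] by simp
    then show ?thesis by (simp add: A_def vertex_u_def mult.commute)
  qed
  moreover have "Vector_Spaces.linear (*s) (*s) (rot h e k0 \<circ> rot h v k)"
    by (rule Vector_Spaces.linear_compose[OF linear_rot[OF herm] linear_rot[OF herm]])
  ultimately show thesis using that by blast
qed

lemma isometry_kind:
  assumes c: "c \<in> quads h a T" and t: "vertex_t h a T c = (t1, t2, t3)"
  defines "r \<equiv> cos (a 0) * cos (a 3) - sin (a 0) * (sin (a 3) * (2 * t3 - 1))"
  shows "\<bar>r\<bar> < 1 \<Longrightarrow> elliptic h (vertex_rot h a c 0 \<circ> vertex_rot h a c 3)"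
    "r < -1 \<Longrightarrow> hyperbolic h (vertex_rot h a c 0 \<circ> vertex_rot h a c 3)"
proof -
  obtain p where p: "c 0 = line p" "h p p = 1" using BV_unit[OF quads_BV[OF c]] by metis
  obtain v where v: "c 3 = line v" "h v v = 1" using BV_unit[OF quads_BV[OF c]] by metis
  obtain q where "hermitian_plane h p q" by (rule orthonormal_completion[OF p(2)])
  then interpret P: hermitian_plane h p q .
  have nz: "p \<noteq> 0" "v \<noteq> 0" using p v h_zero by auto
  have "t3 = ta h v p" using t unfolding vertex_t_eq[OF quads_BV[OF c]]
    by (simp add: Let_def p v ta_rep_line[OF herm nz(2) nz(1)])
  have eq: "vertex_rot h a c 0 \<circ> vertex_rot h a c 3 = rot h p (cis (a 0)) \<circ> rot h v (cis (a 3))"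
    using p v by (simp add: prot_line)
  obtain A B where AB: "Vector_Spaces.linear (*s) (*s) (rot h p (cis (a 0)) \<circ> rot h v (cis (a 3)))"
    "\<And>x. h ((rot h p (cis (a 0)) \<circ> rot h v (cis (a 3))) x) p = A * h x p + B * h x q"
    "\<And>x. h ((rot h p (cis (a 0)) \<circ> rot h v (cis (a 3))) x) q = cnj B * h x p + cnj A * h x q"
    "A * cnj A - B * cnj B = 1" "A = cnj (cis (a 0)) * vertex_u (cis (a 3)) (ta h v p)"
    by (rule P.rotation_product[OF v(2) norm_cis[of "a 3"] norm_cis[of "a 0"]]) (rule that)
  have "Re A = r" unfolding AB(5) \<open>t3 = ta h v p\<close>[symmetric] r_def vertex_u_def
    by (simp add: algebra_simps)
  then show "\<bar>r\<bar> < 1 \<Longrightarrow> elliptic h (vertex_rot h a c 0 \<circ> vertex_rot h a c 3)"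
    "r < -1 \<Longrightarrow> hyperbolic h (vertex_rot h a c 0 \<circ> vertex_rot h a c 3)"
    unfolding eq using P.elliptic_if[OF AB(1-4)] P.hyperbolic_if[OF AB(1-4)] by blast+
qed

end

section \<open>The components\<close>

text \<open>Each entry is minus the imaginary part of the corresponding \<open>u_coeff\<close>,
  whose real part \<open>cos (a j)\<close> is constant.\<close>

definition heights :: "(4 \<Rightarrow> real) \<Rightarrow> real \<times> real \<times> real \<Rightarrow> real \<times> real \<times> real" where
  "heights a = (\<lambda>(t1, t2, t3). (sin (a 1) * (2 * t1 - 1), sin (a 2) * (2 * t2 - 1), sin (a 3) * (2 * t3 - 1)))"

lemma u_coeff_Complex: "u_coeff a j t = Complex (cos (a j)) (- (sin (a j) * (2 * t - 1)))"
  by (simp add: u_coeff_def complex_eq_iff algebra_simps)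

lemma slice_conic_gram:
  assumes "d\<^sup>2 = (1 :: real)" "s0\<^sup>2 + c0\<^sup>2 = (1 :: real)"
  shows "slice_conic (d * (c0 * c3 - s0 * y3)) (d * (c0 * y3 + c3 * s0)) c1 c2 y1 y2 =
     (cmod (Complex c1 (- y1)))\<^sup>2 + (cmod (Complex c2 (- y2)))\<^sup>2 + (cmod (Complex c3 (- y3)))\<^sup>2 -
     (1 + 2 * d * Re (cnj (Complex c0 s0) * Complex c1 (- y1) * Complex c2 (- y2) * Complex c3 (- y3)))"
proof -
  have "Re (cnj (Complex c0 s0) * Complex c1 (- y1) * Complex c2 (- y2) * Complex c3 (- y3)) =
     (c0 * c3 - s0 * y3) * (c1 * c2 - y1 * y2) - (c0 * y3 + c3 * s0) * (c1 * y2 + c2 * y1)"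
    by (simp add: algebra_simps)
  then show ?thesis unfolding cmod_power2 slice_conic_def complex.sel using assms by algebra
qed

lemma signed_solutions_iff_gram:
  assumes a: "\<And>j. 0 < a j \<and> a j < pi" and d: "d\<^sup>2 = 1"
  shows "t \<in> signed_solutions d a \<longleftrightarrow> heights a t \<in> gram_solutions d (a 0) (a 1) (a 2) (a 3)"
proof -
  obtain t1 t2 t3 where t: "t = (t1, t2, t3)" by (cases t)
  define y where "y j t = sin (a j) * (2 * t - 1)" for j t
  have s: "sin (a j) > 0" for j using a sin_gt_zero by blast
  have ge: "sin (a j) \<le> y j t \<longleftrightarrow> t \<ge> 1" for j t
  proof -
    have "sin (a j) \<le> y j t \<longleftrightarrow> sin (a j) * 1 \<le> sin (a j) * (2 * t - 1)" by (simp add: y_def)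
    also have "\<dots> \<longleftrightarrow> 1 \<le> 2 * t - 1" using s by (rule mult_le_cancel_left_pos)
    finally show ?thesis by simp
  qed
  have u: "u_coeff a j t = Complex (cos (a j)) (- y j t)" for j t
    by (simp add: u_coeff_Complex y_def)
  have "slice_conic (d * (cos (a 0) * cos (a 3) - sin (a 0) * y 3 t3)) (d * (cos (a 0) * y 3 t3 + cos (a 3) * sin (a 0)))
      (cos (a 1)) (cos (a 2)) (y 1 t1) (y 2 t2) =
     (cmod (u_coeff a 1 t1))\<^sup>2 + (cmod (u_coeff a 2 t2))\<^sup>2 + (cmod (u_coeff a 3 t3))\<^sup>2 -
     (1 + 2 * d * Re (cnj (cis (a 0)) * u_coeff a 1 t1 * u_coeff a 2 t2 * u_coeff a 3 t3))"
    unfolding u cis.code by (rule slice_conic_gram[OF d sin_cos_squared_add])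
  then show ?thesis
    unfolding t signed_solutions_def gram_solutions_def heights_def
    by (simp add: y_def[symmetric] ge) (auto simp: algebra_simps)
qed

lemma signed_solutions_homeomorphic_gram:
  assumes a: "\<And>j. 0 < a j \<and> a j < pi" and d: "d\<^sup>2 = 1"
  shows "signed_solutions d a homeomorphic gram_solutions d (a 0) (a 1) (a 2) (a 3)"
proof -
  define g where "g = (\<lambda>(y1, y2, y3). ((y1 / sin (a 1) + 1) / 2, (y2 / sin (a 2) + 1) / 2, (y3 / sin (a 3) + 1) / 2))"
  have s: "sin (a j) \<noteq> 0" for j using a[of j] sin_gt_zero[of "a j"] by auto
  have gh: "g (heights a t) = t" "heights a (g t) = t" for t
    using s by (cases t; simp add: g_def heights_def field_simps)+
  have "homeomorphism (signed_solutions d a) (gram_solutions d (a 0) (a 1) (a 2) (a 3)) (heights a) g"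
  proof (rule homeomorphismI)
    show "continuous_on (signed_solutions d a) (heights a)"
      unfolding heights_def case_prod_unfold by (intro continuous_intros)
    show "continuous_on (gram_solutions d (a 0) (a 1) (a 2) (a 3)) g"
      unfolding g_def case_prod_unfold using s by (intro continuous_intros) auto
  qed (simp_all add: image_subset_iff signed_solutions_iff_gram[where a = a, OF a d] gh)
  then show ?thesis unfolding homeomorphic_def by blast
qed

lemma signed_solutions_minus_singleton:
  assumes a: "\<And>j. 0 < a j \<and> a j < pi" and S: "a 0 + a 1 + a 2 + a 3 = pi \<or> a 0 + a 1 + a 2 + a 3 = 3 * pi"
  shows "signed_solutions (- 1) a = {(1, 1, 1)}"
proof -
  have f: "four_angles (a 0) (a 1) (a 2) (a 3)" using a by (simp add: four_angles_def)
  have s: "sin (a j) \<noteq> 0" for j using a[of j] sin_gt_zero[of "a j"] by auto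
  have "t \<in> signed_solutions (- 1) a \<longleftrightarrow> t = (1, 1, 1)" for t
    unfolding signed_solutions_iff_gram[where a = a, OF a, of "- 1", simplified] gram_solutions_singleton[OF f S]
    using s by (cases t) (auto simp: heights_def)
  then show ?thesis by blast
qed

lemma signed_solutions_plane:
  assumes a: "\<And>j. 0 < a j \<and> a j < pi"
  shows "signed_solutions 1 a homeomorphic (UNIV :: complex set)"
    "connected (signed_solutions 1 a)" "signed_solutions 1 a \<noteq> {}"
proof -
  have "four_angles (a 0) (a 1) (a 2) (a 3)" using a by (simp add: four_angles_def)
  then show *: "signed_solutions 1 a homeomorphic (UNIV :: complex set)"
    using signed_solutions_homeomorphic_gram[where a = a, OF a, of 1] gram_solutions_plane homeomorphic_trans by fastforce
  show "connected (signed_solutions 1 a)" using homeomorphic_connectedness[OF *] connected_UNIV by blast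
  show "signed_solutions 1 a \<noteq> {}" using * homeomorphic_empty by force
qed

lemma connected_signed_solutions:
  assumes a: "\<And>j. 0 < a j \<and> a j < pi" and d: "d = 1 \<or> d = -1"
  shows "connected (signed_solutions d a)"
proof (cases "d = 1")
  case True
  then show ?thesis using signed_solutions_plane[where a = a, OF a] by simp
next
  case False
  then have d: "d = -1" using d by simp
  have f: "four_angles (a 0) (a 1) (a 2) (a 3)" using a by (simp add: four_angles_def)
  have hom: "signed_solutions (- 1) a homeomorphic gram_solutions (- 1) (a 0) (a 1) (a 2) (a 3)"
    by (rule signed_solutions_homeomorphic_gram[where a = a, OF a]) simp
  consider "a 0 + a 1 + a 2 + a 3 < pi \<or> 3 * pi < a 0 + a 1 + a 2 + a 3"
    | "a 0 + a 1 + a 2 + a 3 = pi \<or> a 0 + a 1 + a 2 + a 3 = 3 * pi"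
    | "pi < a 0 + a 1 + a 2 + a 3" "a 0 + a 1 + a 2 + a 3 < 3 * pi"
    by argo
  then have "connected (gram_solutions (- 1) (a 0) (a 1) (a 2) (a 3))"
  proof cases
    case 1
    show ?thesis using homeomorphic_connectedness[OF gram_solutions_sphere[OF f 1]] by (simp add: connected_sphere)
  next
    case 2
    show ?thesis unfolding gram_solutions_singleton[OF f 2] by simp
  next
    case 3
    show ?thesis unfolding gram_solutions_minus_empty[OF f 3] by simp
  qed
  then show ?thesis using homeomorphic_connectedness[OF hom] d by simp
qed

context hermitian_plane
begin

lemma orbit_mem_over:
  assumes "c \<in> quads h a T"
  shows "(T, orbit h c) \<in> hexagons_over h a T E \<longleftrightarrow> vertex_t h a T c \<in> E"
proof -
  have "orbit h c \<in> topspace (hexagon_type_space a T)"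
    using assms by (simp add: topspace_quotient_topology topspace_quad_space del: topspace_subtopology)
  then show ?thesis
    unfolding hexagons_over_eq using hexagon_t_orbit[OF assms] by (simp del: hexagon_t.simps)
qed

lemma hexagon_t_mem:
  assumes a: "\<And>j. 0 < a j \<and> a j < pi" and P: "P \<in> topspace (hexagon_type_space a T)"
  shows "hexagon_t h a (T, P) \<in> both_solutions a"
proof -
  have "(\<lambda>P. hexagon_t h a (T, P)) ` topspace (hexagon_type_space a T) = both_solutions a"
    using homeomorphic_imp_surjective_map[OF homeomorphic_map_hexagon_type[where a = a, OF a]] by simp
  then show ?thesis using P by blast
qed

text \<open>The set is closed as the preimage of a closed set. It is open since, inside the open
  summand of type \<open>T\<close>, it is the complement of the closed set for the opposite sign.
  Connectedness comes from the solution set.\<close>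

lemma form_component:
  assumes a: "\<And>j. 0 < a j \<and> a j < pi" and d: "d = 1 \<or> d = -1" and ne: "signed_solutions d a \<noteq> {}"
  shows "form_component h a T (signed_solutions d a)"
proof -
  define C where "C d = hexagons_over h a T (signed_solutions d a)" for d
  have sub: "signed_solutions d a \<subseteq> both_solutions a" using d by auto
  have hom: "homeomorphic_map (subtopology (hexagon_space h a) (C d)) (top_of_set (signed_solutions d a)) (hexagon_t h a)"
    unfolding C_def by (rule homeomorphic_map_hexagons_over[where a = a, OF a sub])
  have clo: "closedin (hexagon_space h a) (C d)" unfolding C_def by (rule closedin_hexagons_over[where a = a, OF a d])
  then have sub': "C d \<subseteq> topspace (hexagon_space h a)" by (rule closedin_subset)
  have "connected_space (subtopology (hexagon_space h a) (C d))"
    using homeomorphic_connected_space[OF homeomorphic_map_imp_homeomorphic_space[OF hom]]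
      connected_signed_solutions[where a = a, OF a d] by (simp add: connected_space_subtopology)
  then have conn: "connectedin (hexagon_space h a) (C d)" using sub' by (simp add: connectedin_def)
  have "hexagon_t h a ` C d = signed_solutions d a"
    using homeomorphic_imp_surjective_map[OF hom] sub' by (simp add: Int_absorb1)
  then have ne': "C d \<noteq> {}" using ne by auto
  have "closedin (hexagon_space h a) (C (- d))"
    unfolding C_def using d by (intro closedin_hexagons_over[where a = a, OF a]) auto
  moreover have "{T} \<times> topspace (hexagon_type_space a T) - C (- d) = C d"
  proof -
    have "hexagon_t h a (T, P) \<in> signed_solutions d a \<longleftrightarrow> hexagon_t h a (T, P) \<notin> signed_solutions (- d) a"
      if "P \<in> topspace (hexagon_type_space a T)" for P
      using hexagon_t_mem[where a = a, OF a that] signed_solutions_disjoint[of a] d by (auto simp del: hexagon_t.simps)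
    then show ?thesis unfolding C_def hexagons_over_eq by (auto simp del: hexagon_t.simps)
  qed
  moreover have "openin (hexagon_space h a) ({T} \<times> topspace (hexagon_type_space a T))"
  proof -
    have "openin (hexagon_type_space a T') {P. (T', P) \<in> {T} \<times> topspace (hexagon_type_space a T)}" for T'
      by (cases "T' = T") simp_all
    then show ?thesis unfolding hexagon_space_eq openin_sum_topology by auto
  qed
  ultimately have "openin (hexagon_space h a) (C d)" by (metis openin_diff)
  then have "C d \<in> connected_components_of (hexagon_space h a)"
    using clopen_connected_component clo conn ne' by blast
  moreover have "C d \<subseteq> {T} \<times> UNIV" by (auto simp: C_def hexagons_over_def)
  ultimately show ?thesis using hom by (simp add: form_component_def components_of_type_def C_def)
qed

text \<open>The components for the two signs cover all hexagons of the type, so every component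
  meets one of them and equals it.\<close>

lemma components_of_type_eq:
  assumes a: "\<And>j. 0 < a j \<and> a j < pi"
  shows "components_of_type h a T =
    {hexagons_over h a T (signed_solutions d a) | d. (d = 1 \<or> d = -1) \<and> signed_solutions d a \<noteq> {}}"
proof (intro subset_antisym subsetI)
  fix D assume "D \<in> components_of_type h a T"
  then have D: "D \<in> connected_components_of (hexagon_space h a)" "D \<subseteq> {T} \<times> UNIV"
    by (auto simp: components_of_type_def)
  obtain x where "x \<in> D" using nonempty_connected_components_of[OF D(1)] by blast
  moreover obtain P where x: "x = (T, P)" using D(2) \<open>x \<in> D\<close> by auto
  moreover have "D \<subseteq> topspace (hexagon_space h a)" by (rule connected_components_of_subset[OF D(1)])
  ultimately have P: "P \<in> topspace (hexagon_type_space a T)" by (auto simp: hexagon_space_eq)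
  then obtain d where d: "d = 1 \<or> d = -1" "hexagon_t h a (T, P) \<in> signed_solutions d a"
    using hexagon_t_mem[where a = a, OF a P] by blast
  then have ne: "signed_solutions d a \<noteq> {}" by blast
  have "x \<in> hexagons_over h a T (signed_solutions d a)"
    using d P unfolding x hexagons_over_eq by blast
  moreover have "hexagons_over h a T (signed_solutions d a) \<in> connected_components_of (hexagon_space h a)"
    using form_component[where a = a, OF a d(1) ne] by (simp add: form_component_def components_of_type_def)
  ultimately have "D = hexagons_over h a T (signed_solutions d a)"
    using connected_components_of_disjoint[OF D(1)] \<open>x \<in> D\<close> unfolding disjnt_def by blast
  then show "D \<in> {hexagons_over h a T (signed_solutions d a) | d. (d = 1 \<or> d = -1) \<and> signed_solutions d a \<noteq> {}}"
    using d ne by blast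
next
  fix D assume "D \<in> {hexagons_over h a T (signed_solutions d a) | d. (d = 1 \<or> d = -1) \<and> signed_solutions d a \<noteq> {}}"
  then show "D \<in> components_of_type h a T" using form_component[where a = a, OF a] by (auto simp: form_component_def)
qed

lemma component_homeomorphic:
  assumes "form_component h a T E" "E homeomorphic F"
  shows "subtopology (hexagon_space h a) (hexagons_over h a T E) homeomorphic_space top_of_set F"
proof -
  have "subtopology (hexagon_space h a) (hexagons_over h a T E) homeomorphic_space top_of_set E"
    using assms(1) homeomorphic_map_imp_homeomorphic_space unfolding form_component_def by blast
  moreover have "top_of_set E homeomorphic_space top_of_set F"
  proof -
    obtain F1 F2 where "homeomorphism E F F1 F2" using assms(2) unfolding homeomorphic_def by blast
    then have "homeomorphic_maps (top_of_set E) (top_of_set F) F1 F2"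
      by (force simp: Pi_iff homeomorphic_maps_def homeomorphism_def)
    then show ?thesis unfolding homeomorphic_space_def by blast
  qed
  ultimately show ?thesis using homeomorphic_space_trans by blast
qed

lemma solution_hexagon:
  assumes a: "\<And>j. 0 < a j \<and> a j < pi" and d: "d = 1 \<or> d = -1" and t: "t \<in> signed_solutions d a"
  obtains c where "c \<in> quads h a T" "vertex_t h a T c = t"
proof -
  obtain t1 t2 t3 where tt: "t = (t1, t2, t3)" by (cases t)
  then obtain z where "(t, z, d) \<in> phases T a" using phase_exists[OF d, of t1 t2 t3] t by blast
  then show thesis using that[OF lift_centre(2)[where a = a, OF a]] lift_centre(3)[where a = a, OF a, of "(t, z, d)" T] by simp
qed

lemma exists_hyperbolic:
  assumes a: "\<And>j. 0 < a j \<and> a j < pi"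
  shows "\<exists>c \<in> quads h a T. (T, orbit h c) \<in> hexagons_over h a T (signed_solutions 1 a) \<and>
     hyperbolic h (vertex_rot h a c 0 \<circ> vertex_rot h a c 3)"
proof -
  interpret four_angles "a 0" "a 1" "a 2" "a 3" using a by unfold_locales auto
  obtain y1 y2 y where y: "(y1, y2, y) \<in> gram_solutions 1 (a 0) (a 1) (a 2) (a 3)" "rho y < -1"
    using hyperbolic_solution by blast
  define t where "t = ((y1 / sin (a 1) + 1) / 2, (y2 / sin (a 2) + 1) / 2, (y / sin (a 3) + 1) / 2)"
  have inv: "s * (2 * ((x / s + 1) / 2) - 1) = x" if "s > 0" for s x :: real
    using that by (simp add: field_simps)
  have h: "heights a t = (y1, y2, y)"
    by (simp only: t_def heights_def prod.case inv[OF sin_pos(2)] inv[OF sin_pos(3)] inv[OF sin_pos(4)])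
  then have t: "t \<in> signed_solutions 1 a" using signed_solutions_iff_gram[where a = a, OF a, of 1] y by simp
  obtain c where c: "c \<in> quads h a T" "vertex_t h a T c = t" using solution_hexagon[where a = a, OF a _ t] by blast
  have "hyperbolic h (vertex_rot h a c 0 \<circ> vertex_rot h a c 3)"
    using isometry_kind(2)[OF c(1) c(2)[unfolded t_def]] y(2) unfolding inv[OF sin_pos(4)] rho_def .
  then show ?thesis using c t orbit_mem_over by blast
qed

lemma all_elliptic:
  assumes a: "\<And>j. 0 < a j \<and> a j < pi" and c: "c \<in> quads h a T"
    and mem: "(T, orbit h c) \<in> hexagons_over h a T (signed_solutions (- 1) a)"
  shows "elliptic h (vertex_rot h a c 0 \<circ> vertex_rot h a c 3)"
proof -
  interpret four_angles "a 0" "a 1" "a 2" "a 3" using a by unfold_locales auto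
  obtain t1 t2 t3 where t: "vertex_t h a T c = (t1, t2, t3)" using prod_cases3 by blast
  then have "(t1, t2, t3) \<in> signed_solutions (- 1) a" using orbit_mem_over[OF c] mem by simp
  then have "heights a (t1, t2, t3) \<in> gram_solutions (- 1) (a 0) (a 1) (a 2) (a 3)"
    using signed_solutions_iff_gram[where a = a, OF a, of "- 1"] by simp
  then have "\<bar>rho (sin (a 3) * (2 * t3 - 1))\<bar> < 1"
    unfolding heights_def prod.case by (rule gram_solutions_minus_abs_rho)
  then show ?thesis using isometry_kind(1)[OF c t] by (simp add: rho_def)
qed

end

theorem corollary4p5p3:
  fixes h :: "complex ^ 2 \<Rightarrow> complex ^ 2 \<Rightarrow> complex" and a :: "4 \<Rightarrow> real"
  assumes "hermitian_form h" and "signature_1_1 h"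
    and "\<And>j. 0 < a j \<and> a j < pi"
  shows "let \<Sigma> = a 0 + a 1 + a 2 + a 3;
             S = hexagon_space h a;
             C1 = (\<lambda>T. hexagons_over h a T (E1_solutions a));
             C0 = (\<lambda>T. hexagons_over h a T (E0_solutions a))
    in
      \<comment> \<open>(1)\<close>
      (\<forall>T. form_component h a T (E1_solutions a) \<and>
           subtopology S (C1 T) homeomorphic_space (euclidean :: (real ^ 2) topology) \<and>
           (\<exists>c \<in> quads h a T. (T, orbit h c) \<in> C1 T \<and>
              hyperbolic h (vertex_rot h a c 0 \<circ> vertex_rot h a c 3))) \<and>
      \<comment> \<open>(2)\<close>
      (\<not> (\<Sigma> \<le> pi \<or> 3 * pi \<le> \<Sigma>) \<longrightarrow> E0_solutions a = {}) \<and>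
      (\<Sigma> = pi \<or> \<Sigma> = 3 * pi \<longrightarrow>
         (\<exists>!t. t \<in> E0_solutions a) \<and>
         (\<forall>T. form_component h a T (E0_solutions a) \<and>
              (\<forall>c \<in> quads h a T. (T, orbit h c) \<in> C0 T \<longrightarrow>
                 elliptic h (vertex_rot h a c 0 \<circ> vertex_rot h a c 3)))) \<and>
      (\<Sigma> < pi \<or> 3 * pi < \<Sigma> \<longrightarrow>
         (\<forall>T. form_component h a T (E0_solutions a) \<and>
              subtopology S (C0 T) homeomorphic_space top_of_set (sphere (0 :: real ^ 3) 1) \<and>
              (\<forall>c \<in> quads h a T. (T, orbit h c) \<in> C0 T \<longrightarrow>
                 elliptic h (vertex_rot h a c 0 \<circ> vertex_rot h a c 3)))) \<and>
      \<comment> \<open>(3)\<close>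
      (\<forall>T. components_of_type h a T =
             (if \<Sigma> \<le> pi \<or> 3 * pi \<le> \<Sigma> then {C1 T, C0 T} else {C1 T}))"
proof -
  note a = assms(3)
  obtain e f where "h e e = 1" "h f f = -1" "h e f = 0"
    using assms(2) unfolding signature_1_1_def by blast
  then interpret hermitian_plane h e f
    using assms(1) by unfold_locales
  have f4: "four_angles (a 0) (a 1) (a 2) (a 3)" using a by (simp add: four_angles_def)
  define \<Sigma> where "\<Sigma> = a 0 + a 1 + a 2 + a 3"
  have hom0: "signed_solutions (- 1) a homeomorphic gram_solutions (- 1) (a 0) (a 1) (a 2) (a 3)"
    by (rule signed_solutions_homeomorphic_gram[where a = a, OF a]) simp
  have comp1: "form_component h a T (signed_solutions 1 a)" for T
    by (rule form_component[where a = a, OF a _ signed_solutions_plane(3)[where a = a, OF a]]) simp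
  have plane: "signed_solutions 1 a homeomorphic (UNIV :: (real ^ 2) set)"
    using signed_solutions_plane(1)[where a = a, OF a] homeomorphic_UNIV_UNIV[where 'a = complex and 'b = "real ^ 2"]
      homeomorphic_trans by fastforce
  have empty: "signed_solutions (- 1) a = {}" if "\<not> (\<Sigma> \<le> pi \<or> 3 * pi \<le> \<Sigma>)"
    using hom0 gram_solutions_minus_empty[OF f4] that homeomorphic_empty(2) unfolding \<Sigma>_def by force
  have single: "signed_solutions (- 1) a = {(1, 1, 1)}" if "\<Sigma> = pi \<or> \<Sigma> = 3 * pi"
    using signed_solutions_minus_singleton[where a = a, OF a] that unfolding \<Sigma>_def by blast
  have sphere: "signed_solutions (- 1) a homeomorphic sphere (0 :: real ^ 3) 1" if "\<Sigma> < pi \<or> 3 * pi < \<Sigma>"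
    using hom0 gram_solutions_sphere[OF f4] that homeomorphic_trans unfolding \<Sigma>_def by blast
  have ne: "signed_solutions (- 1) a \<noteq> {}" if "\<Sigma> \<le> pi \<or> 3 * pi \<le> \<Sigma>"
  proof (cases "\<Sigma> = pi \<or> \<Sigma> = 3 * pi")
    case True
    then show ?thesis using single by simp
  next
    case False
    then have "signed_solutions (- 1) a homeomorphic sphere (0 :: real ^ 3) 1" using sphere that by linarith
    then show ?thesis using homeomorphic_empty(2) by force
  qed
  have comp0: "form_component h a T (signed_solutions (- 1) a)" if "\<Sigma> \<le> pi \<or> 3 * pi \<le> \<Sigma>" for T
    by (rule form_component[where a = a, OF a _ ne[OF that]]) simp
  have comps: "components_of_type h a T = (if \<Sigma> \<le> pi \<or> 3 * pi \<le> \<Sigma>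
      then {hexagons_over h a T (signed_solutions 1 a), hexagons_over h a T (signed_solutions (- 1) a)}
      else {hexagons_over h a T (signed_solutions 1 a)})" for T
    unfolding components_of_type_eq[where a = a, OF a] using signed_solutions_plane(3)[where a = a, OF a] ne empty by auto
  have plane': "subtopology (hexagon_space h a) (hexagons_over h a T (signed_solutions 1 a))
      homeomorphic_space (euclidean :: (real ^ 2) topology)" for T
    using component_homeomorphic[OF comp1 plane] by simp
  have sphere': "subtopology (hexagon_space h a) (hexagons_over h a T (signed_solutions (- 1) a))
      homeomorphic_space top_of_set (sphere (0 :: real ^ 3) 1)" if "\<Sigma> < pi \<or> 3 * pi < \<Sigma>" for T
    using that by (intro component_homeomorphic comp0 sphere) auto
  show ?thesis
    unfolding Let_def signed_solutions_eq \<Sigma>_def[symmetric]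
    using comp1 plane' exists_hyperbolic[where a = a, OF a] empty single comp0 all_elliptic[where a = a, OF a] sphere' comps
    by (intro conjI impI allI ballI) auto
qed

end
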